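(* Let $X_1$ and $X_2$ be complex Banach spaces and let $X_1\tilde{\otimes}X_2$ be a tensor product of $X_1$ and $X_2$ relative to the dual pairings $\langle X_1,X_1'\rangle$ and $\langle X_2,X_2'\rangle$. Let $S=(S_1,\ldots,S_n)$ and $T=(T_1,\ldots,T_m)$ be tuples of commuting bounded linear operators on $X_1$ and $X_2$ respectively, and let $(S\otimes I,I\otimes T)=(S_1\otimes I,\ldots,S_n\otimes I,I\otimes T_1,\ldots,I\otimes T_m)$, an $(n+m)$-tuple of commuting operators on $X_1\tilde{\otimes}X_2$. Then: (i) $\sigma_{\mathcal{B}_-}(S)\times\sigma_\delta(T)\cup\sigma_\delta(S)\times\sigma_{\mathcal{B}_-}(T)\subseteq\sigma_{\mathcal{B}_-}(S\otimes I,I\otimes T)\subseteq sp_{\mathcal{B}_-}(S\otimes I,I\otimes T)\subseteq sp_{\mathcal{B}_-}(S)\times sp_\delta(T)\cup sp_\delta(S)\times sp_{\mathcal{B}_-}(T)$; (ii) $\sigma_{\mathcal{B}_+}(S)\times\sigma_\pi(T)\cup\sigma_\pi(S)\times\sigma_{\mathcal{B}_+}(T)\subseteq\sigma_{\mathcal{B}_+}(S\otimes I,I\otimes T)\subseteq sp_{\mathcal{B}_+}(S\otimes I,I\otimes T)\subseteq sp_{\mathcal{B}_+}(S)\times sp_\pi(T)\cup sp_\pi(S)\times sp_{\mathcal{B}_+}(T)$. In addition, if $X_1$ and $X_2$ are Hilbert spaces, all the inclusions in (i) and (ii) are equalities.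
   Context: Joint spectra. Let $X$ be a complex Banach space and $T=(T_1,\ldots,T_n)$ an $n$-tuple of commuting bounded linear operators on $X$. $R(\cdot)$ and $N(\cdot)$ denote range and null space. For $\lambda\in\mathbb{C}^n$, $T-\lambda=(T_1-\lambda_1I,\ldots,T_n-\lambda_nI)$. Define $\hat{T}\colon X^n\to X$, $\hat{T}(x_1,\ldots,x_n)=T_1x_1+\cdots+T_nx_n$, and $\tilde{T}\colon X\to X^n$, $\tilde{T}(x)=(T_1x,\ldots,T_nx)$. For $k\in\mathbb{N}$, $k\ge1$, $M_k(T)=R(T_1^k)+\cdots+R(T_n^k)$; $R^\infty(T)=\bigcap_{k\ge1}M_k(T)$; $N^\infty(T)=\bigcup_{k\ge1}[N(T_1^k)\cap\cdots\cap N(T_n^k)]$. A subspace of a Banach space has a direct complement if there is a closed subspace such that the whole space is the direct sum of the two. - $T$ is lower semi-Browder if $\operatorname{codim}R^\infty(T)<\infty$; $\sigma_{\mathcal{B}_-}(T)$ is the set of $\lambda\in\mathbb{C}^n$ such that $T-\lambda$ is not lower semi-Browder. - $T$ is upper semi-Fredholm if $\dim N(\tilde{T})<\infty$ and $R(\tilde{T})$ is closed. $T$ is upper semi-Browder if it is upper semi-Fredholm and $\dim N^\infty(T)<\infty$; $\sigma_{\mathcal{B}_+}(T)$ is the set of $\lambda\in\mathbb{C}^n$ such that $T-\lambda$ is not upper semi-Browder. - $\sigma_\delta(T)=\{\lambda\in\mathbb{C}^n:\operatorname{codim}M_1(T-\lambda)\ne0\}$ (defect spectrum). - $\sigma_\pi(T)=\{\lambda\in\mathbb{C}^n: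 N(\widetilde{T-\lambda})\ne0$ or $R(\widetilde{T-\lambda})$ is not closed$\}$ (approximate point spectrum). - $\mathcal{C}_-(T)=\{\lambda\in\mathbb{C}^n: N(\widehat{T-\lambda})$ has no direct complement in $X^n\}$ and $\mathcal{C}_+(T)=\{\lambda\in\mathbb{C}^n: R(\widetilde{T-\lambda})$ has no direct complement in $X^n\}$. - $sp_\delta(T)=\sigma_\delta(T)\cup\mathcal{C}_-(T)$ and $sp_\pi(T)=\sigma_\pi(T)\cup\mathcal{C}_+(T)$ (split defect and split approximate point spectra). - $sp_{\mathcal{B}_-}(T)$ (lower split semi-Browder spectrum) is the set of $\lambda\in\mathbb{C}^n$ such that it is not the case that both $\operatorname{codim}R^\infty(T-\lambda)<\infty$ and $N(\widehat{T-\lambda})$ has a direct complement in $X^n$; i.e. $sp_{\mathcal{B}_-}(T)=\sigma_{\mathcal{B}_-}(T)\cup\mathcal{C}_-(T)$. - $sp_{\mathcal{B}_+}(T)$ (upper split semi-Browder spectrum) is the set of $\lambda\in\mathbb{C}^n$ such that it is not the case that both $T-\lambda$ is upper semi-Browder and $R(\widetilde{T-\lambda})$ has a direct complement in $X^n$; i.e. $sp_{\mathcal{B}_+}(T)=\sigma_{\mathcal{B}_+}(T)\cup\mathcal{C}_+(T)$. Tensor product (in the sense of Eschmeier). $\mathrm{L}(X)$ is the algebra of bounded linear operators on $X$, and $X'$ is the dual space. A tensor product of $X_1$ and $X_2$ relative to $\langle X_1,X_1'\rangle$ and $\langle X_2,X_2'\rangle$ is a Banach space $X_1\tilde{\otimes}X_2$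 together with continuous bilinear mappings $X_1\times X_2\to X_1\tilde{\otimes}X_2$, $(x,y)\mapsto x\otimes y$, and $\mathrm{L}(X_1)\times\mathrm{L}(X_2)\to\mathrm{L}(X_1\tilde{\otimes}X_2)$, $(A,B)\mapsto A\otimes B$, such that for all vectors $x\in X_1$, $y\in X_2$, functionals $u\in X_1'$, $v\in X_2'$ and operators: (T1) $\|x\otimes y\|=\|x\|\,\|y\|$; (T2) $(A\otimes B)(x\otimes y)=(Ax)\otimes(By)$; (T3) $(A_1\otimes B_1)\circ(A_2\otimes B_2)=(A_1A_2)\otimes(B_1B_2)$ and $I\otimes I=I$; (T4) $\operatorname{Im}(f_{x,u}\otimes I)\subseteq\{x\otimes y':y'\in X_2\}$ and $\operatorname{Im}(I\otimes f_{y,v})\subseteq\{x'\otimes y:x'\in X_1\}$, where $f_{x,u}\in\mathrm{L}(X_1)$ is $z\mapsto u(z)x$ and $f_{y,v}\in\mathrm{L}(X_2)$ is $z\mapsto v(z)y$. *)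

theory Defs
  imports "HOL-Analysis.Analysis" "HOL-Library.Extended_Nat"
begin

section \<open>Complex Banach spaces\<close>

class complex_normed_vector = real_normed_vector +
  fixes scaleC :: "complex \<Rightarrow> 'a \<Rightarrow> 'a" (infixr \<open>*\<^sub>C\<close> 75)
  assumes scaleC_add_right: "c *\<^sub>C (x + y) = c *\<^sub>C x + c *\<^sub>C y"
    and scaleC_add_left: "(c + d) *\<^sub>C x = c *\<^sub>C x + d *\<^sub>C x"
    and scaleC_scaleC: "c *\<^sub>C (d *\<^sub>C x) = (c * d) *\<^sub>C x"
    and scaleC_of_real: "complex_of_real r *\<^sub>C x = r *\<^sub>R x"
    and norm_scaleC: "norm (c *\<^sub>C x) = cmod c * norm x"

class cbanach = complex_normed_vector + complete_space

subclass (in cbanach) banach ..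

global_interpretation complex_vector: vector_space "scaleC :: complex \<Rightarrow> 'a \<Rightarrow> 'a::complex_normed_vector"
  defines csubspace = complex_vector.subspace
    and cspan = complex_vector.span
proof
  fix c d :: complex and x y :: 'a
  show "1 *\<^sub>C x = x"
    using scaleC_of_real[of 1 x] by simp
qed (simp_all add: scaleC_add_right scaleC_add_left scaleC_scaleC)

instantiation complex :: cbanach
begin

definition scaleC_complex :: "complex \<Rightarrow> complex \<Rightarrow> complex"
  where "scaleC_complex c x = c * x"

instance
  by standard (simp_all add: scaleC_complex_def algebra_simps norm_mult scaleR_conv_of_real)

end

text \<open>The power \<open>X\<^sup>n\<close> is \<^typ>\<open>'a ^ 'n\<close> with the Euclidean combination of the norms; all the usual
  product norms are equivalent, and only closedness in \<open>X\<^sup>n\<close> is used.\<close>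

instantiation vec :: (complex_normed_vector, finite) complex_normed_vector
begin

definition scaleC_vec :: "complex \<Rightarrow> 'a ^ 'b \<Rightarrow> 'a ^ 'b"
  where "scaleC_vec c x = (\<chi> i. c *\<^sub>C (x $ i))"

instance
proof
  fix c d :: complex and r :: real and x y :: "'a ^ 'b"
  show "norm (c *\<^sub>C x) = cmod c * norm x"
    by (simp add: norm_vec_def scaleC_vec_def norm_scaleC L2_set_right_distrib)
qed (simp_all add: scaleC_vec_def vec_eq_iff scaleC_add_right scaleC_add_left scaleC_scaleC
    scaleC_of_real)

end

instance vec :: (cbanach, finite) cbanach ..

definition cdim :: "'a::complex_normed_vector set \<Rightarrow> enat"
  where "cdim V = (INF B \<in> {B. finite B \<and> cspan B = V}. enat (card B))"

text \<open>The codimension of a subspace \<open>W\<close> is the dimension of the quotient of the whole space by \<open>W\<close>;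
  the classes of the elements of \<open>B\<close> span this quotient iff \<open>W \<union> B\<close> spans the whole space.\<close>

definition ccodim :: "'a::complex_normed_vector set \<Rightarrow> enat"
  where "ccodim W = (INF B \<in> {B. finite B \<and> cspan (W \<union> B) = UNIV}. enat (card B))"

definition has_direct_complement :: "'a::complex_normed_vector set \<Rightarrow> bool"
  where "has_direct_complement W \<longleftrightarrow>
    (\<exists>V. csubspace V \<and> closed V \<and> W \<inter> V = {0} \<and> (\<forall>x. \<exists>w\<in>W. \<exists>v\<in>V. x = w + v))"

definition hilbert_space :: "'a::cbanach itself \<Rightarrow> bool"
  where "hilbert_space _ \<longleftrightarrow> (\<exists>ip :: 'a \<Rightarrow> 'a \<Rightarrow> complex.
    (\<forall>x y z. ip (x + y) z = ip x z + ip y z) \<and>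
    (\<forall>c x y. ip (c *\<^sub>C x) y = c * ip x y) \<and>
    (\<forall>x y. ip y x = cnj (ip x y)) \<and>
    (\<forall>x. ip x x = complex_of_real ((norm x)\<^sup>2)))"


section \<open>Bounded complex-linear operators\<close>

definition bounded_clinear :: "('a::complex_normed_vector \<Rightarrow> 'b::complex_normed_vector) \<Rightarrow> bool"
  where "bounded_clinear f \<longleftrightarrow> bounded_linear f \<and> (\<forall>c x. f (c *\<^sub>C x) = c *\<^sub>C f x)"

lemma bounded_linear_scaleC_right: "bounded_linear (\<lambda>x :: 'a::complex_normed_vector. c *\<^sub>C x)"
  by (rule bounded_linear_intro[where K = "cmod c"])
    (simp_all add: scaleC_add_right scaleC_scaleC norm_scaleC mult.commute flip: scaleC_of_real)

lemma bounded_clinear_zero: "bounded_clinear (\<lambda>x. 0)"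
  by (simp add: bounded_clinear_def)

typedef (overloaded) ('a, 'b) cblinfun (\<open>(_ \<Rightarrow>\<^sub>C\<^sub>L /_)\<close> [22, 21] 21) =
  "{f :: 'a::complex_normed_vector \<Rightarrow> 'b::complex_normed_vector. bounded_clinear f}"
  morphisms cblinfun_apply CBlinfun
  using bounded_clinear_zero by blast

setup_lifting type_definition_cblinfun

declare [[coercion cblinfun_apply]]

lemma cblinfun_eqI: "(\<And>x. cblinfun_apply f x = cblinfun_apply g x) \<Longrightarrow> f = g"
  by transfer auto

instantiation cblinfun :: (complex_normed_vector, complex_normed_vector) complex_normed_vector
begin

lift_definition norm_cblinfun :: "'a \<Rightarrow>\<^sub>C\<^sub>L 'b \<Rightarrow> real" is onorm .

lift_definition zero_cblinfun :: "'a \<Rightarrow>\<^sub>C\<^sub>L 'b" is "\<lambda>x. 0"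
  by (rule bounded_clinear_zero)

lift_definition plus_cblinfun :: "'a \<Rightarrow>\<^sub>C\<^sub>L 'b \<Rightarrow> 'a \<Rightarrow>\<^sub>C\<^sub>L 'b \<Rightarrow> 'a \<Rightarrow>\<^sub>C\<^sub>L 'b" is "\<lambda>f g x. f x + g x"
  by (auto simp: bounded_clinear_def scaleC_add_right intro: bounded_linear_add)

lift_definition minus_cblinfun :: "'a \<Rightarrow>\<^sub>C\<^sub>L 'b \<Rightarrow> 'a \<Rightarrow>\<^sub>C\<^sub>L 'b \<Rightarrow> 'a \<Rightarrow>\<^sub>C\<^sub>L 'b" is "\<lambda>f g x. f x - g x"
  by (auto simp: bounded_clinear_def complex_vector.scale_right_diff_distrib intro: bounded_linear_sub)

lift_definition uminus_cblinfun :: "'a \<Rightarrow>\<^sub>C\<^sub>L 'b \<Rightarrow> 'a \<Rightarrow>\<^sub>C\<^sub>L 'b" is "\<lambda>f x. - f x"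
  by (auto simp: bounded_clinear_def intro: bounded_linear_minus)

lift_definition scaleR_cblinfun :: "real \<Rightarrow> 'a \<Rightarrow>\<^sub>C\<^sub>L 'b \<Rightarrow> 'a \<Rightarrow>\<^sub>C\<^sub>L 'b" is "\<lambda>r f x. r *\<^sub>R f x"
  by (auto simp: bounded_clinear_def scaleC_scaleC mult.commute simp flip: scaleC_of_real
      intro: bounded_linear_compose[OF bounded_linear_scaleC_right])

lift_definition scaleC_cblinfun :: "complex \<Rightarrow> 'a \<Rightarrow>\<^sub>C\<^sub>L 'b \<Rightarrow> 'a \<Rightarrow>\<^sub>C\<^sub>L 'b" is "\<lambda>c f x. c *\<^sub>C f x"
  by (auto simp: bounded_clinear_def scaleC_scaleC mult.commute
      intro: bounded_linear_compose[OF bounded_linear_scaleC_right])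

definition dist_cblinfun :: "'a \<Rightarrow>\<^sub>C\<^sub>L 'b \<Rightarrow> 'a \<Rightarrow>\<^sub>C\<^sub>L 'b \<Rightarrow> real"
  where "dist_cblinfun f g = norm (f - g)"

definition sgn_cblinfun :: "'a \<Rightarrow>\<^sub>C\<^sub>L 'b \<Rightarrow> 'a \<Rightarrow>\<^sub>C\<^sub>L 'b"
  where "sgn_cblinfun f = inverse (norm f) *\<^sub>R f"

definition uniformity_cblinfun :: "(('a \<Rightarrow>\<^sub>C\<^sub>L 'b) \<times> ('a \<Rightarrow>\<^sub>C\<^sub>L 'b)) filter"
  where "uniformity_cblinfun = (INF e\<in>{0 <..}. principal {(x, y). dist x y < e})"

definition open_cblinfun :: "('a \<Rightarrow>\<^sub>C\<^sub>L 'b) set \<Rightarrow> bool"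
  where "open_cblinfun U = (\<forall>x\<in>U. \<forall>\<^sub>F (x', y) in uniformity. x' = x \<longrightarrow> y \<in> U)"

instance
proof
  fix f g h :: "'a \<Rightarrow>\<^sub>C\<^sub>L 'b" and r s :: real and c d :: complex
  show "dist f g = norm (f - g)" by (rule dist_cblinfun_def)
  show "sgn f = inverse (norm f) *\<^sub>R f" by (rule sgn_cblinfun_def)
  show "(uniformity :: (('a \<Rightarrow>\<^sub>C\<^sub>L 'b) \<times> ('a \<Rightarrow>\<^sub>C\<^sub>L 'b)) filter)
      = (INF e\<in>{0 <..}. principal {(x, y). dist x y < e})"
    by (rule uniformity_cblinfun_def)
  show "open U = (\<forall>x\<in>U. \<forall>\<^sub>F (x', y) in uniformity. x' = x \<longrightarrow> y \<in> U)" for U :: "('a \<Rightarrow>\<^sub>C\<^sub>L 'b) set"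
    by (rule open_cblinfun_def)
  show "f + g + h = f + (g + h)" by transfer (simp add: add.assoc)
  show "f + g = g + f" by transfer (simp add: add.commute)
  show "0 + f = f" by transfer simp
  show "- f + f = 0" by transfer simp
  show "f - g = f + - g" by transfer simp
  show "r *\<^sub>R (f + g) = r *\<^sub>R f + r *\<^sub>R g" by transfer (simp add: scaleR_add_right)
  show "(r + s) *\<^sub>R f = r *\<^sub>R f + s *\<^sub>R f" by transfer (simp add: scaleR_add_left)
  show "r *\<^sub>R s *\<^sub>R f = (r * s) *\<^sub>R f" by transfer simp
  show "1 *\<^sub>R f = f" by transfer simp
  show "norm f = 0 \<longleftrightarrow> f = 0"
    by transfer (auto simp: bounded_clinear_def onorm_eq_0)
  show "norm (f + g) \<le> norm f + norm g"
    by transfer (auto simp: bounded_clinear_def intro: onorm_triangle)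
  show "norm (r *\<^sub>R f) = \<bar>r\<bar> * norm f"
    by transfer (auto simp: bounded_clinear_def intro: onorm_scaleR)
  show "c *\<^sub>C (f + g) = c *\<^sub>C f + c *\<^sub>C g" by transfer (simp add: scaleC_add_right)
  show "(c + d) *\<^sub>C f = c *\<^sub>C f + d *\<^sub>C f" by transfer (simp add: scaleC_add_left)
  show "c *\<^sub>C d *\<^sub>C f = (c * d) *\<^sub>C f" by transfer (simp add: scaleC_scaleC)
  show "complex_of_real r *\<^sub>C f = r *\<^sub>R f" by transfer (simp add: scaleC_of_real)
  show "norm (c *\<^sub>C f) = cmod c * norm f"
  proof transfer
    fix c :: complex and f :: "'a \<Rightarrow> 'b"
    assume "bounded_clinear f"
    then have f: "bounded_linear f" by (simp add: bounded_clinear_def)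
    then have "onorm (\<lambda>x. c *\<^sub>C f x) = onorm (\<lambda>x. cmod c *\<^sub>R f x)"
      by (simp add: onorm_def norm_scaleC)
    also have "\<dots> = cmod c * onorm f"
      using onorm_scaleR[OF f, of "cmod c"] by simp
    finally show "onorm (\<lambda>x. c *\<^sub>C f x) = cmod c * onorm f" .
  qed
qed

end

lift_definition cblinfun_id :: "'a::complex_normed_vector \<Rightarrow>\<^sub>C\<^sub>L 'a" is "\<lambda>x. x"
  by (simp add: bounded_clinear_def bounded_linear_ident)

lift_definition cblinfun_compose ::
  "'b::complex_normed_vector \<Rightarrow>\<^sub>C\<^sub>L 'c::complex_normed_vector \<Rightarrow> 'a::complex_normed_vector \<Rightarrow>\<^sub>C\<^sub>L 'b \<Rightarrow> 'a \<Rightarrow>\<^sub>C\<^sub>L 'c"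
  (infixl \<open>o\<^sub>C\<^sub>L\<close> 55) is "(o)"
  by (auto simp: bounded_clinear_def o_def intro: bounded_linear_compose)

lift_definition rank_one :: "'a::complex_normed_vector \<Rightarrow> 'a \<Rightarrow>\<^sub>C\<^sub>L complex \<Rightarrow> 'a \<Rightarrow>\<^sub>C\<^sub>L 'a"
  is "\<lambda>x u z. u z *\<^sub>C x"
proof -
  fix x :: 'a and u :: "'a \<Rightarrow> complex"
  assume u: "bounded_clinear u"
  have "bounded_linear (\<lambda>c. c *\<^sub>C x)"
    by (rule bounded_linear_intro[where K = "norm x"])
      (simp_all add: scaleC_add_left norm_scaleC scaleR_conv_of_real scaleC_scaleC flip: scaleC_of_real)
  with u show "bounded_clinear (\<lambda>z. u z *\<^sub>C x)"
    by (auto simp: bounded_clinear_def scaleC_complex_def scaleC_scaleC intro: bounded_linear_compose)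
qed

definition bounded_cbilinear ::
  "('a::complex_normed_vector \<Rightarrow> 'b::complex_normed_vector \<Rightarrow> 'c::complex_normed_vector) \<Rightarrow> bool"
  where "bounded_cbilinear p \<longleftrightarrow> bounded_bilinear p \<and>
    (\<forall>c x y. p (c *\<^sub>C x) y = c *\<^sub>C p x y) \<and> (\<forall>c x y. p x (c *\<^sub>C y) = c *\<^sub>C p x y)"


section \<open>Joint spectra\<close>

definition commuting_tuple :: "('a::cbanach \<Rightarrow>\<^sub>C\<^sub>L 'a) ^ 'n \<Rightarrow> bool"
  where "commuting_tuple T \<longleftrightarrow> (\<forall>i j. T $ i o\<^sub>C\<^sub>L T $ j = T $ j o\<^sub>C\<^sub>L T $ i)"

definition tuple_shift :: "('a::cbanach \<Rightarrow>\<^sub>C\<^sub>L 'a) ^ 'n \<Rightarrow> complex ^ 'n \<Rightarrow> ('a \<Rightarrow>\<^sub>C\<^sub>L 'a) ^ 'n"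
  where "tuple_shift T l = (\<chi> i. T $ i - l $ i *\<^sub>C cblinfun_id)"

definition hat_op :: "('a::cbanach \<Rightarrow>\<^sub>C\<^sub>L 'a) ^ 'n \<Rightarrow> 'a ^ 'n \<Rightarrow> 'a"
  where "hat_op T x = (\<Sum>i\<in>UNIV. (T $ i) (x $ i))"

definition tilde_op :: "('a::cbanach \<Rightarrow>\<^sub>C\<^sub>L 'a) ^ 'n \<Rightarrow> 'a \<Rightarrow> 'a ^ 'n"
  where "tilde_op T x = (\<chi> i. (T $ i) x)"

definition null_space :: "('a \<Rightarrow> 'b::zero) \<Rightarrow> 'a set"
  where "null_space f = {x. f x = 0}"

definition M_sum :: "nat \<Rightarrow> ('a::cbanach \<Rightarrow>\<^sub>C\<^sub>L 'a) ^ 'n \<Rightarrow> 'a set"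
  where "M_sum k T = {\<Sum>i\<in>UNIV. y i | y. \<forall>i. y i \<in> range (cblinfun_apply (T $ i) ^^ k)}"

definition R_infty :: "('a::cbanach \<Rightarrow>\<^sub>C\<^sub>L 'a) ^ 'n \<Rightarrow> 'a set"
  where "R_infty T = (\<Inter>k\<in>{1..}. M_sum k T)"

definition N_infty :: "('a::cbanach \<Rightarrow>\<^sub>C\<^sub>L 'a) ^ 'n \<Rightarrow> 'a set"
  where "N_infty T = (\<Union>k\<in>{1..}. \<Inter>i. null_space (cblinfun_apply (T $ i) ^^ k))"

definition lower_semi_Browder :: "('a::cbanach \<Rightarrow>\<^sub>C\<^sub>L 'a) ^ 'n \<Rightarrow> bool"
  where "lower_semi_Browder T \<longleftrightarrow> ccodim (R_infty T) < \<infinity>"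

definition upper_semi_Fredholm :: "('a::cbanach \<Rightarrow>\<^sub>C\<^sub>L 'a) ^ 'n \<Rightarrow> bool"
  where "upper_semi_Fredholm T \<longleftrightarrow> cdim (null_space (tilde_op T)) < \<infinity> \<and> closed (range (tilde_op T))"

definition upper_semi_Browder :: "('a::cbanach \<Rightarrow>\<^sub>C\<^sub>L 'a) ^ 'n \<Rightarrow> bool"
  where "upper_semi_Browder T \<longleftrightarrow> upper_semi_Fredholm T \<and> cdim (N_infty T) < \<infinity>"

definition sigma_B_minus :: "('a::cbanach \<Rightarrow>\<^sub>C\<^sub>L 'a) ^ 'n \<Rightarrow> (complex ^ 'n) set"
  where "sigma_B_minus T = {l. \<not> lower_semi_Browder (tuple_shift T l)}"

definition sigma_B_plus :: "('a::cbanach \<Rightarrow>\<^sub>C\<^sub>L 'a) ^ 'n \<Rightarrow> (complex ^ 'n) set"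
  where "sigma_B_plus T = {l. \<not> upper_semi_Browder (tuple_shift T l)}"

definition sigma_delta :: "('a::cbanach \<Rightarrow>\<^sub>C\<^sub>L 'a) ^ 'n \<Rightarrow> (complex ^ 'n) set"
  where "sigma_delta T = {l. ccodim (M_sum 1 (tuple_shift T l)) \<noteq> 0}"

definition sigma_pi :: "('a::cbanach \<Rightarrow>\<^sub>C\<^sub>L 'a) ^ 'n \<Rightarrow> (complex ^ 'n) set"
  where "sigma_pi T = {l. null_space (tilde_op (tuple_shift T l)) \<noteq> {0}
    \<or> \<not> closed (range (tilde_op (tuple_shift T l)))}"

definition C_minus :: "('a::cbanach \<Rightarrow>\<^sub>C\<^sub>L 'a) ^ 'n \<Rightarrow> (complex ^ 'n) set"
  where "C_minus T = {l. \<not> has_direct_complement (null_space (hat_op (tuple_shift T l)))}"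

definition C_plus :: "('a::cbanach \<Rightarrow>\<^sub>C\<^sub>L 'a) ^ 'n \<Rightarrow> (complex ^ 'n) set"
  where "C_plus T = {l. \<not> has_direct_complement (range (tilde_op (tuple_shift T l)))}"

definition sp_delta :: "('a::cbanach \<Rightarrow>\<^sub>C\<^sub>L 'a) ^ 'n \<Rightarrow> (complex ^ 'n) set"
  where "sp_delta T = sigma_delta T \<union> C_minus T"

definition sp_pi :: "('a::cbanach \<Rightarrow>\<^sub>C\<^sub>L 'a) ^ 'n \<Rightarrow> (complex ^ 'n) set"
  where "sp_pi T = sigma_pi T \<union> C_plus T"

definition sp_B_minus :: "('a::cbanach \<Rightarrow>\<^sub>C\<^sub>L 'a) ^ 'n \<Rightarrow> (complex ^ 'n) set"
  where "sp_B_minus T = {l. \<not> (ccodim (R_infty (tuple_shift T l)) < \<infinity>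
    \<and> has_direct_complement (null_space (hat_op (tuple_shift T l))))}"

definition sp_B_plus :: "('a::cbanach \<Rightarrow>\<^sub>C\<^sub>L 'a) ^ 'n \<Rightarrow> (complex ^ 'n) set"
  where "sp_B_plus T = {l. \<not> (upper_semi_Browder (tuple_shift T l)
    \<and> has_direct_complement (range (tilde_op (tuple_shift T l))))}"


section \<open>Tensor products in the sense of Eschmeier\<close>

text \<open>The space \<^typ>\<open>'c\<close> plays the role of the tensor product; \<open>tens\<close> is the bilinear map on vectors
  and \<open>otens\<close> the one on operators.\<close>

locale eschmeier_tensor_product =
  fixes tens :: "'a::cbanach \<Rightarrow> 'b::cbanach \<Rightarrow> 'c::cbanach"
    and otens :: "('a \<Rightarrow>\<^sub>C\<^sub>L 'a) \<Rightarrow> ('b \<Rightarrow>\<^sub>C\<^sub>L 'b) \<Rightarrow> ('c \<Rightarrow>\<^sub>C\<^sub>L 'c)"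
  assumes tens_bilinear: "bounded_cbilinear tens"
    and otens_bilinear: "bounded_cbilinear otens"
    and norm_tens: "norm (tens x y) = norm x * norm y"
    and otens_tens: "otens A B (tens x y) = tens (A x) (B y)"
    and otens_compose: "otens A1 B1 o\<^sub>C\<^sub>L otens A2 B2 = otens (A1 o\<^sub>C\<^sub>L A2) (B1 o\<^sub>C\<^sub>L B2)"
    and otens_id: "otens cblinfun_id cblinfun_id = cblinfun_id"
    and range_rank_one_left: "range (otens (rank_one x u) cblinfun_id) \<subseteq> {tens x y' | y'. True}"
    and range_rank_one_right: "range (otens cblinfun_id (rank_one y v)) \<subseteq> {tens x' y | x'. True}"

text \<open>The \<open>(n + m)\<close>-tuples are indexed by the disjoint sum of the two index types.\<close>

definition tensor_tuple ::
  "(('a::cbanach \<Rightarrow>\<^sub>C\<^sub>L 'a) \<Rightarrow> ('b::cbanach \<Rightarrow>\<^sub>C\<^sub>L 'b) \<Rightarrow> ('c::cbanach \<Rightarrow>\<^sub>C\<^sub>L 'c))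
    \<Rightarrow> ('a \<Rightarrow>\<^sub>C\<^sub>L 'a) ^ 'n \<Rightarrow> ('b \<Rightarrow>\<^sub>C\<^sub>L 'b) ^ 'm \<Rightarrow> ('c \<Rightarrow>\<^sub>C\<^sub>L 'c) ^ ('n + 'm)"
  where "tensor_tuple otens S T =
    (\<chi> k. case k of Inl i \<Rightarrow> otens (S $ i) cblinfun_id | Inr j \<Rightarrow> otens cblinfun_id (T $ j))"

definition tuple_append :: "'a ^ 'n \<Rightarrow> 'a ^ 'm \<Rightarrow> 'a ^ ('n + 'm)"
  where "tuple_append a b = (\<chi> k. case k of Inl i \<Rightarrow> a $ i | Inr j \<Rightarrow> b $ j)"

definition spec_times :: "(complex ^ 'n) set \<Rightarrow> (complex ^ 'm) set \<Rightarrow> (complex ^ ('n + 'm)) set"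
  (infixr \<open>\<times>\<^sub>s\<close> 80)
  where "A \<times>\<^sub>s B = {tuple_append a b | a b. a \<in> A \<and> b \<in> B}"

end

theory Submission
  imports Defs
begin

text \<open>
  Shifting \<open>(S \<otimes> I, I \<otimes> T)\<close> by \<open>(a, b)\<close> gives the tensor tuple of \<open>S - a\<close> and \<open>T - b\<close>, so only the
  point 0 matters. A functional \<open>v\<close> on \<open>X\<^sub>2\<close> gives a slice map from
  \<open>X\<^sub>1 \<otimes> X\<^sub>2\<close> to \<open>X\<^sub>1\<close> that intertwines \<open>S\<^sub>i \<otimes> I\<close> with \<open>S\<^sub>i\<close>. If \<open>v\<close> annihilates the range of \<open>T\<close>
  (or equals 1 on a joint null vector of \<open>T\<close>), slicing transports the semi-Browder property from the tensor
  tuple to \<open>S\<close>. If \<open>T\<close> is singular without such an exact \<open>v\<close>, approximate annihilators or approximate null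
  vectors of both tuples would contradict the closed range of the tensor tuple, so \<open>S\<close> is not singular at all.

  Conversely, splitting gives bounded \<open>V\<^sub>i\<close>, \<open>W\<^sub>j\<close> with \<open>\<Sum> S\<^sub>i V\<^sub>i = I - P\<close> and \<open>\<Sum> T\<^sub>j W\<^sub>j = I - Q\<close> where
  \<open>P\<close>, \<open>Q\<close> have finite rank, and \<open>(V \<otimes> I, P \<otimes> W)\<close> is a generalised inverse for the tensor tuple. Modulo
  the algebraic tensor product the tensor tuple is surjective, hence so are its powers, and on algebraic
  tensors the Browder conditions can be read off from \<open>S\<close> and \<open>T\<close>. The other half is dual.
\<close>

text \<open>The obstacle is how little the axioms say about a general element of the tensor product:
  algebraic tensors need not be dense, and slices are not known to separate points. A conclusion
  drawn from slices is therefore confined to algebraic tensors. Finite rank is what leads there: by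
  (T4) a rank-one operator tensored with the identity sends every element to an elementary tensor,
  so \<open>P \<otimes> I\<close> with \<open>P\<close> of finite rank sends the whole space into
  the algebraic tensors.

  An exact annihilator \<open>v\<close> fails to exist when the range for \<open>T\<close> is proper
  but dense, and an exact joint null vector fails to exist when \<open>T\<close> is injective with
  non-closed range. The contradiction in these cases is quantitative: the accuracy \<open>a\<close>
  of the approximate vectors and functionals is fixed in terms of an open mapping constant
  \<open>C\<close> and a bound \<open>K\<close> for the slice maps. Hence \<open>K\<close> must not
  depend on the functional, which is chosen after \<open>a\<close>.

  The tensor product is not assumed to be a Hilbert space. In the Hilbert case only the outer terms
  of each chain, which concern \<open>S\<close> and \<open>T\<close>, are compared directly.\<close>

section \<open>Calculus of bounded complex-linear operators\<close>

lemma bounded_clinear_cblinfun [simp]: "bounded_clinear (cblinfun_apply A)"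
  using cblinfun_apply by blast

lemma cblinfun_bounded_linear [simp]: "bounded_linear (cblinfun_apply A)"
  using bounded_clinear_cblinfun bounded_clinear_def by blast

lemma cblinfun_scaleC_right [simp]: "cblinfun_apply A (c *\<^sub>C x) = c *\<^sub>C cblinfun_apply A x"
  using bounded_clinear_cblinfun[of A] unfolding bounded_clinear_def by blast

lemma cblinfun_linear [simp]: "linear (cblinfun_apply A)"
  by (simp add: bounded_linear.linear)

lemma cblinfun_add_right: "cblinfun_apply A (x + y) = cblinfun_apply A x + cblinfun_apply A y"
  by (simp add: linear_add)

lemma cblinfun_diff_right: "cblinfun_apply A (x - y) = cblinfun_apply A x - cblinfun_apply A y"
  by (simp add: linear_diff)

lemma cblinfun_zero_right [simp]: "cblinfun_apply A 0 = 0"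
  by (simp add: linear_0)

lemma cblinfun_sum_right: "cblinfun_apply A (sum f I) = (\<Sum>i\<in>I. cblinfun_apply A (f i))"
  by (simp add: linear_sum)

lemma cblinfun_apply_add [simp]: "cblinfun_apply (A + B) x = cblinfun_apply A x + cblinfun_apply B x"
  by transfer simp

lemma cblinfun_apply_diff [simp]: "cblinfun_apply (A - B) x = cblinfun_apply A x - cblinfun_apply B x"
  by transfer simp

lemma cblinfun_apply_zero [simp]: "cblinfun_apply 0 x = 0"
  by transfer simp

lemma cblinfun_apply_scaleC [simp]: "cblinfun_apply (c *\<^sub>C A) x = c *\<^sub>C cblinfun_apply A x"
  by transfer simp

lemma cblinfun_apply_sum: "cblinfun_apply (sum A I) x = (\<Sum>i\<in>I. cblinfun_apply (A i) x)"
  by (induction I rule: infinite_finite_induct) auto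

lemma cblinfun_apply_id [simp]: "cblinfun_apply cblinfun_id x = x"
  by transfer simp

lemma cblinfun_apply_compose [simp]:
  "cblinfun_apply (A o\<^sub>C\<^sub>L B) x = cblinfun_apply A (cblinfun_apply B x)"
  by transfer simp

lemma rank_one_apply [simp]: "cblinfun_apply (rank_one x u) z = cblinfun_apply u z *\<^sub>C x"
  by transfer simp

lemma cblinfun_compose_id [simp]: "A o\<^sub>C\<^sub>L cblinfun_id = A" "cblinfun_id o\<^sub>C\<^sub>L A = A"
  by (auto intro: cblinfun_eqI)

lemma cblinfun_compose_zero [simp]: "A o\<^sub>C\<^sub>L 0 = 0" "0 o\<^sub>C\<^sub>L A = 0"
  by (auto intro: cblinfun_eqI)

lemma norm_cblinfun_apply: "norm (cblinfun_apply A x) \<le> norm A * norm x"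
  by transfer (simp add: bounded_clinear_def onorm)

lemma norm_cblinfun_bound:
  assumes "0 \<le> c" "\<And>x. norm (cblinfun_apply A x) \<le> c * norm x"
  shows "norm A \<le> c"
  using assms by transfer (metis onorm_bound)

lemma CBlinfun_apply [simp]: "bounded_clinear f \<Longrightarrow> cblinfun_apply (CBlinfun f) = f"
  by (simp add: CBlinfun_inverse)

lemma continuous_on_cblinfun [continuous_intros]:
  "continuous_on X f \<Longrightarrow> continuous_on X (\<lambda>x. cblinfun_apply A (f x))"
  by (rule bounded_linear.continuous_on) auto

lemma csubspace_imp_subspace: "csubspace W \<Longrightarrow> subspace W"
  unfolding complex_vector.subspace_def subspace_def by (metis scaleC_of_real)

lemma bounded_clinearI:
  assumes "\<And>x y. f (x + y) = f x + f y" "\<And>c x. f (c *\<^sub>C x) = c *\<^sub>C f x"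
    and "\<And>x. norm (f x) \<le> norm x * K"
  shows "bounded_clinear f"
  unfolding bounded_clinear_def
proof
  show "bounded_linear f"
    by (rule bounded_linear_intro[where K = K]) (simp_all add: assms flip: scaleC_of_real)
qed (simp add: assms)

section \<open>The Hahn--Banach theorem\<close>

text \<open>Homogeneity is an inequality here, which is the form that passes to infima without
  effort; scaling back by \<open>inverse t\<close> gives equality.\<close>

definition sublinear :: "('a::real_vector \<Rightarrow> real) \<Rightarrow> bool"
  where "sublinear q \<longleftrightarrow> (\<forall>x y. q (x + y) \<le> q x + q y) \<and> (\<forall>t>0. \<forall>x. q (t *\<^sub>R x) \<le> t * q x)"

lemma sublinear_add: "sublinear q \<Longrightarrow> q (x + y) \<le> q x + q y"
  by (simp add: sublinear_def)

lemma sublinear_scale: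
  assumes "sublinear q" "t > 0"
  shows "q (t *\<^sub>R x) = t * q x"
proof (rule antisym)
  show "q (t *\<^sub>R x) \<le> t * q x"
    using assms by (simp add: sublinear_def)
  have "q (inverse t *\<^sub>R (t *\<^sub>R x)) \<le> inverse t * q (t *\<^sub>R x)"
    using assms unfolding sublinear_def by (meson positive_imp_inverse_positive)
  then show "t * q x \<le> q (t *\<^sub>R x)"
    using assms by (simp add: field_simps)
qed

lemma sublinear_zero:
  assumes "sublinear q"
  shows "q 0 = 0"
  using sublinear_scale[OF assms, of 2 0] by simp

lemma sublinear_lower: "sublinear q \<Longrightarrow> - q (- x) \<le> q x"
  using sublinear_add[of q x "- x"] sublinear_zero[of q] by simp

text \<open>The index \<open>k\<close> may depend on the vectors as well as on \<open>i\<close> and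
  \<open>j\<close>. This covers three infima at once: over a lowering parameter (index
  \<open>i + j\<close>), over a chain of functionals (the smaller of two), and over the vectors of a
  subspace (their sum).\<close>

lemma sublinear_INF:
  assumes ne: "I \<noteq> {}"
    and bdd: "\<And>x. bdd_below ((\<lambda>i. h i x) ` I)"
    and add: "\<And>i j x y. i \<in> I \<Longrightarrow> j \<in> I \<Longrightarrow> \<exists>k\<in>I. h k (x + y) \<le> h i x + h j y"
    and scale: "\<And>i t x. i \<in> I \<Longrightarrow> t > 0 \<Longrightarrow> \<exists>k\<in>I. h k (t *\<^sub>R x) \<le> t * h i x"
  shows "sublinear (\<lambda>x. INF i\<in>I. h i x :: real)"
  unfolding sublinear_def
proof (intro conjI allI impI)
  fix x y
  have "(INF i\<in>I. h i (x + y)) - h j y \<le> (INF i\<in>I. h i x)" if "j \<in> I" for j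
  proof (rule cINF_greatest[OF ne])
    fix i assume "i \<in> I"
    then obtain k where "k \<in> I" "h k (x + y) \<le> h i x + h j y"
      using add \<open>j \<in> I\<close> by blast
    moreover from this have "(INF i\<in>I. h i (x + y)) \<le> h k (x + y)"
      by (intro cINF_lower bdd)
    ultimately show "(INF i\<in>I. h i (x + y)) - h j y \<le> h i x"
      by simp
  qed
  then have "(INF i\<in>I. h i (x + y)) - (INF i\<in>I. h i x) \<le> h j y" if "j \<in> I" for j
    using that by (simp add: algebra_simps)
  then have "(INF i\<in>I. h i (x + y)) - (INF i\<in>I. h i x) \<le> (INF i\<in>I. h i y)"
    using ne by (intro cINF_greatest) auto
  then show "(INF i\<in>I. h i (x + y)) \<le> (INF i\<in>I. h i x) + (INF i\<in>I. h i y)"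
    by simp
next
  fix t :: real and x assume t: "t > 0"
  have "inverse t * (INF i\<in>I. h i (t *\<^sub>R x)) \<le> (INF i\<in>I. h i x)"
  proof (rule cINF_greatest[OF ne])
    fix i assume "i \<in> I"
    then obtain k where "k \<in> I" "h k (t *\<^sub>R x) \<le> t * h i x"
      using scale t by blast
    moreover from this have "(INF i\<in>I. h i (t *\<^sub>R x)) \<le> h k (t *\<^sub>R x)"
      by (intro cINF_lower bdd)
    ultimately show "inverse t * (INF i\<in>I. h i (t *\<^sub>R x)) \<le> h i x"
      using t by (simp add: field_simps)
  qed
  then show "(INF i\<in>I. h i (t *\<^sub>R x)) \<le> t * (INF i\<in>I. h i x)"
    using t by (simp add: field_simps)
qed

text \<open>Lowering \<open>q\<close> in this way forces \<open>q' (- y) \<le> - q y\<close>.\<close>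

lemma sublinear_lowering:
  fixes q :: "'a::real_vector \<Rightarrow> real" and y :: 'a
  assumes q: "sublinear q"
  defines "q' \<equiv> \<lambda>x. INF t\<in>{0..}. q (x + t *\<^sub>R y) - t * q y"
  shows "sublinear q'" "\<And>x. q' x \<le> q x" "q' (- y) \<le> - q y"
proof -
  have scale: "q (t *\<^sub>R x) = t * q x" if "t \<ge> 0" for t x
    using that sublinear_scale[OF q, of t x] sublinear_zero[OF q] by (cases "t = 0") auto
  have "- q (- x) \<le> q (x + t *\<^sub>R y) - t * q y" if "t \<ge> 0" for x t
    using sublinear_add[OF q, of "x + t *\<^sub>R y" "- x"] scale[OF that, of y] by simp
  then have bdd: "bdd_below ((\<lambda>t. q (x + t *\<^sub>R y) - t * q y) ` {0..})" for x
    by (intro bdd_belowI2[of _ "- q (- x)"]) auto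
  show "sublinear q'"
    unfolding q'_def
  proof (rule sublinear_INF[OF _ bdd])
    fix i j :: real and x z assume ij: "i \<in> {0..}" "j \<in> {0..}"
    have "q ((x + i *\<^sub>R y) + (z + j *\<^sub>R y)) \<le> q (x + i *\<^sub>R y) + q (z + j *\<^sub>R y)"
      by (rule sublinear_add[OF q])
    with ij show "\<exists>k\<in>{0..}. q (x + z + k *\<^sub>R y) - k * q y
        \<le> q (x + i *\<^sub>R y) - i * q y + (q (z + j *\<^sub>R y) - j * q y)"
      by (intro bexI[of _ "i + j"]) (auto simp: algebra_simps)
  next
    fix i t :: real and x assume "i \<in> {0..}" "t > 0"
    then show "\<exists>k\<in>{0..}. q (t *\<^sub>R x + k *\<^sub>R y) - k * q y \<le> t * (q (x + i *\<^sub>R y) - i * q y)"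
      using scale[of t "x + i *\<^sub>R y"]
      by (intro bexI[of _ "t * i"]) (auto simp: algebra_simps)
  qed auto
  \<comment> \<open>This bound is the member \<open>t = 0\<close> of the infimum, and the next one
    is \<open>t = 1\<close>.\<close>
  show "q' x \<le> q x" for x
    unfolding q'_def using cINF_lower[OF bdd, of 0 x] by simp
  show "q' (- y) \<le> - q y"
    unfolding q'_def using cINF_lower[OF bdd, of 1 "- y"] sublinear_zero[OF q] by simp
qed

text \<open>Zorn's lemma for the reversed pointwise order. A nonempty chain is bounded by its
  pointwise infimum, which is finite because a sublinear \<open>q\<close> below \<open>p\<close>
  satisfies \<open>q x \<ge> - q (- x) \<ge> - p (- x)\<close>.\<close>

lemma minimal_sublinear:
  assumes p: "sublinear p"
  obtains q where "sublinear q" "\<And>x. q x \<le> p x"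
    "\<And>r. sublinear r \<Longrightarrow> (\<And>x. r x \<le> q x) \<Longrightarrow> r = q"
proof -
  define A where "A = {q. sublinear q \<and> q \<le> p}"
  define P where "P q r \<longleftrightarrow> r \<le> q" for q r :: "'a \<Rightarrow> real"
  have "\<exists>m\<in>A. \<forall>a\<in>A. P m a \<longrightarrow> a = m"
  proof (rule predicate_Zorn)
    show "partial_order_on A (relation_of P A)"
      unfolding P_def
      by (auto simp: relation_of_def partial_order_on_def preorder_on_def refl_on_def trans_def
          antisym_def intro: order_trans)
    fix C assume C: "C \<in> Chains (relation_of P A)"
    then have CA: "C \<subseteq> A" and comp: "\<And>q r. q \<in> C \<Longrightarrow> r \<in> C \<Longrightarrow> q \<le> r \<or> r \<le> q"
      unfolding Chains_def relation_of_def P_def by auto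
    show "\<exists>u\<in>A. \<forall>a\<in>C. P a u"
    proof (cases "C = {}")
      case True
      with p show ?thesis by (auto simp: A_def)
    next
      case False
      have "- p (- x) \<le> q x" if "q \<in> C" for q x
      proof -
        have "sublinear q" "q (- x) \<le> p (- x)"
          using CA that by (auto simp: A_def le_fun_def)
        then show ?thesis using sublinear_lower[of q x] by simp
      qed
      then have bdd: "bdd_below ((\<lambda>q. q x) ` C)" for x
        by (intro bdd_belowI2[of _ "- p (- x)"])
      define u where "u = (\<lambda>x. INF q\<in>C. q x)"
      have le: "u \<le> q" if "q \<in> C" for q
        unfolding u_def le_fun_def by (intro allI cINF_lower[OF bdd] that)
      have "sublinear u"
        unfolding u_def
      proof (rule sublinear_INF[OF False bdd])
        fix q r :: "'a \<Rightarrow> real" and x y assume "q \<in> C" "r \<in> C"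
        then obtain k where k: "k \<in> C" "k \<le> q" "k \<le> r"
          using comp by blast
        then have "k (x + y) \<le> k x + k y"
          using CA sublinear_add unfolding A_def by blast
        also have "\<dots> \<le> q x + r y"
          using k by (simp add: le_fun_def add_mono)
        finally show "\<exists>k\<in>C. k (x + y) \<le> q x + r y"
          using k by blast
      next
        fix q :: "'a \<Rightarrow> real" and t :: real and x assume "q \<in> C" "t > 0"
        then show "\<exists>k\<in>C. k (t *\<^sub>R x) \<le> t * q x"
          using CA unfolding A_def sublinear_def by blast
      qed
      moreover from False obtain q where "q \<in> C"
        by blast
      then have "u \<le> p"
        using CA le[of q] by (auto simp: A_def)
      ultimately show ?thesis
        using le by (auto simp: A_def P_def)
    qed
  qed
  then obtain q where q: "sublinear q" "q \<le> p" and min: "\<And>r. sublinear r \<Longrightarrow> r \<le> p \<Longrightarrow> r \<le> q \<Longrightarrow> r = q"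
    unfolding A_def P_def by auto
  show thesis
  proof (rule that[OF q(1)])
    show "q x \<le> p x" for x
      using q(2) by (simp add: le_fun_def)
    fix r :: "'a \<Rightarrow> real" assume "sublinear r" "\<And>x. r x \<le> q x"
    moreover from this have "r \<le> q"
      by (simp add: le_fun_def)
    ultimately show "r = q"
      using min q(2) order_trans by blast
  qed
qed

text \<open>A minimal sublinear functional is linear, since it coincides with all its lowerings.\<close>

lemma real_Hahn_Banach:
  assumes p: "sublinear p"
  obtains u where "linear u" "\<And>x. u x \<le> p x" "u y = p y"
proof -
  \<comment> \<open>Minimality alone does not control the value at \<open>y\<close>. Lowering
    \<open>p\<close> along \<open>y\<close> beforehand forces \<open>u (- y) \<le> - p y\<close>,
    that is \<open>u y \<ge> p y\<close>.\<close>
  define p' where "p' x = (INF t\<in>{0..}. p (x + t *\<^sub>R y) - t * p y)" for x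
  have p': "sublinear p'" "\<And>x. p' x \<le> p x" "p' (- y) \<le> - p y"
    unfolding p'_def by (fact sublinear_lowering[OF p])+
  obtain u where u: "sublinear u" "\<And>x. u x \<le> p' x"
    and min: "\<And>r. sublinear r \<Longrightarrow> (\<And>x. r x \<le> u x) \<Longrightarrow> r = u"
    using minimal_sublinear[OF p'(1)] by blast
  have neg: "u (- x) = - u x" for x
  proof -
    have "u (- x) \<le> - u x"
      using fun_cong[OF min[OF sublinear_lowering(1,2)[OF u(1), where y = x]], of "- x"]
        sublinear_lowering(3)[OF u(1), of x]
      by simp
    with sublinear_lower[OF u(1), of "- x"] show ?thesis by simp
  qed
  have add: "u (x + z) = u x + u z" for x z
    using sublinear_add[OF u(1), of x z] sublinear_add[OF u(1), of "- x" "- z"] neg[of "x + z"] neg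
    by simp
  have "u (t *\<^sub>R x) = t *\<^sub>R u x" for t x
  proof (cases "t < 0")
    case True
    then show ?thesis
      using sublinear_scale[OF u(1), of "- t" x] neg[of "t *\<^sub>R x"] by simp
  next
    case False
    then show ?thesis
      using sublinear_scale[OF u(1), of t x] sublinear_zero[OF u(1)] by (cases "t = 0") auto
  qed
  with add have "linear u"
    by (intro linearI)
  moreover have "u x \<le> p x" for x
    using u(2)[of x] p'(2)[of x] by simp
  moreover have "p y \<le> u y"
    using neg[of y] u(2)[of "- y"] p'(3) by simp
  ultimately show thesis
    by (intro that[of u]) (auto intro: antisym)
qed

text \<open>A complex functional is determined by its real part \<open>u\<close> as u(x) - i u(ix).
  Multiplying \<open>x\<close> by a unimodular scalar makes \<open>v x\<close> real and
  non-negative, so that the one-sided real bound controls the modulus.\<close>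

lemma Hahn_Banach_seminorm:
  fixes p :: "'a::complex_normed_vector \<Rightarrow> real"
  assumes add: "\<And>x y. p (x + y) \<le> p x + p y"
    and scale: "\<And>c x. p (c *\<^sub>C x) = cmod c * p x"
    and bound: "\<And>x. p x \<le> K * norm x"
  obtains v :: "'a \<Rightarrow>\<^sub>C\<^sub>L complex"
  where "\<And>x. cmod (cblinfun_apply v x) \<le> p x" "cblinfun_apply v y = complex_of_real (p y)"
proof -
  have "sublinear p"
    unfolding sublinear_def by (simp add: add scale flip: scaleC_of_real)
  then obtain u where lin: "linear u" and le: "\<And>x. u x \<le> p x" and y: "u y = p y"
    using real_Hahn_Banach by blast
  define v where "v x = Complex (u x) (- u (\<i> *\<^sub>C x))" for x
  have uC: "u (c *\<^sub>C x) = Re c * u x + Im c * u (\<i> *\<^sub>C x)" for c x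
  proof -
    have "c *\<^sub>C x = Re c *\<^sub>R x + Im c *\<^sub>R (\<i> *\<^sub>C x)"
      unfolding scaleC_scaleC scaleC_of_real[symmetric] scaleC_add_left[symmetric]
      by (metis complex_eq mult.commute)
    then show ?thesis
      using lin by (simp add: linear_add linear_scale)
  qed
  have v_add: "v (x + z) = v x + v z" for x z
    unfolding v_def using lin by (simp add: complex_eq_iff scaleC_add_right linear_add)
  have v_scale: "v (c *\<^sub>C x) = c * v x" for c x
  proof -
    have "u (\<i> *\<^sub>C (c *\<^sub>C x)) = - Im c * u x + Re c * u (\<i> *\<^sub>C x)"
      unfolding scaleC_scaleC by (subst uC) simp
    then show ?thesis
      unfolding v_def uC[of c] by (simp add: complex_eq_iff)
  qed
  have le_p: "cmod (v x) \<le> p x" for x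
  proof (cases "v x = 0")
    case True
    have "p 0 = 0" using scale[of 0 0] by simp
    moreover have "p (- x) = p x"
      using scale[of "-1" x] by simp
    ultimately have "0 \<le> p x"
      using add[of x "- x"] by simp
    with True show ?thesis by simp
  next
    case False
    define c where "c = cnj (sgn (v x))"
    have "c * v x = complex_of_real (cmod (v x))"
    proof -
      have "v x * cnj (v x) = complex_of_real (cmod (v x)) * complex_of_real (cmod (v x))"
        by (metis complex_norm_square power2_eq_square of_real_mult)
      then show ?thesis
        using False unfolding c_def by (simp add: sgn_eq field_simps)
    qed
    moreover have "cmod c = 1"
      unfolding c_def using False by (simp add: norm_sgn)
    ultimately show ?thesis
      using v_scale[of c x] le[of "c *\<^sub>C x"] scale[of c x] unfolding v_def
      by (metis Re_complex_of_real complex.sel(1) mult_1)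
  qed
  have "bounded_clinear v"
    by (rule bounded_clinearI[where K = K])
      (auto simp: v_add v_scale scaleC_complex_def mult.commute intro: order_trans[OF le_p bound])
  moreover have "v y = complex_of_real (p y)"
  proof -
    have "Re (v y) = p y" by (simp add: v_def y)
    moreover have "cmod (v y) \<le> p y" by (rule le_p)
    ultimately have "Im (v y) = 0"
      by (smt (verit) cmod_power2 power2_less_imp_less power_mono norm_ge_zero zero_less_power2)
    with \<open>Re (v y) = p y\<close> show ?thesis by (simp add: complex_eq_iff)
  qed
  ultimately show thesis
    using le_p by (intro that[of "CBlinfun v"]) auto
qed

text \<open>Hahn--Banach is applied to the seminorm sending \<open>z\<close> to the infimum of
  \<open>a * norm e + norm (z - f e)\<close> over \<open>e \<in> E\<close>. For \<open>f = 0\<close>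
  and \<open>a = 0\<close> it is the norm, which gives norming functionals; for \<open>f\<close> the
  identity and \<open>a = 0\<close> it is the distance to \<open>E\<close>, which gives
  annihilators; for \<open>a > 0\<close> it gives functionals that almost annihilate the range of
  \<open>f\<close>.\<close>

lemma separating_functional:
  fixes f :: "'e::complex_normed_vector \<Rightarrow> 'a::complex_normed_vector"
  assumes add: "\<And>x y. f (x + y) = f x + f y" and scale: "\<And>c x. f (c *\<^sub>C x) = c *\<^sub>C f x"
    and E: "csubspace E" and a: "0 \<le> a"
    and d: "\<And>e. e \<in> E \<Longrightarrow> d \<le> a * norm e + norm (y - f e)"
  obtains v :: "'a \<Rightarrow>\<^sub>C\<^sub>L complex" and r where
    "\<And>z. cmod (cblinfun_apply v z) \<le> norm z"
    "\<And>e. e \<in> E \<Longrightarrow> cmod (cblinfun_apply v (f e)) \<le> a * norm e"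
    "cblinfun_apply v y = complex_of_real r" "d \<le> r"
proof -
  have ne: "E \<noteq> {}" and E0: "0 \<in> E"
    using E complex_vector.subspace_0 by auto
  have f0: "f 0 = 0" using scale[of 0 0] by simp
  define h where "h e z = a * norm e + norm (z - f e)" for e z
  have h0: "0 \<le> h e z" for e z
    unfolding h_def using a by simp
  have bdd: "bdd_below ((\<lambda>e. h e z) ` E)" for z
    by (rule bdd_belowI2[of _ 0]) (rule h0)
  define p where "p z = (INF e\<in>E. h e z)" for z
  have p_le: "p z \<le> h e z" if "e \<in> E" for e z
    unfolding p_def by (rule cINF_lower[OF bdd that])
  have hC: "h (c *\<^sub>C e) (c *\<^sub>C z) = cmod c * h e z" for c e z
    unfolding h_def
    by (simp add: scale norm_scaleC algebra_simps flip: complex_vector.scale_right_diff_distrib)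
  have sub: "sublinear p"
    unfolding p_def
  proof (rule sublinear_INF[OF ne bdd])
    fix i j x z assume "i \<in> E" "j \<in> E"
    moreover have "h (i + j) (x + z) \<le> h i x + h j z"
    proof -
      have "norm (x + z - f (i + j)) \<le> norm (x - f i) + norm (z - f j)"
        by (metis add add_diff_add norm_triangle_ineq)
      moreover have "a * norm (i + j) \<le> a * norm i + a * norm j"
        using a by (metis distrib_left mult_left_mono norm_triangle_ineq)
      ultimately show ?thesis
        unfolding h_def by simp
    qed
    ultimately show "\<exists>k\<in>E. h k (x + z) \<le> h i x + h j z"
      using E complex_vector.subspace_add by blast
  next
    fix i x and t :: real assume "i \<in> E" "t > 0"
    then show "\<exists>k\<in>E. h k (t *\<^sub>R x) \<le> t * h i x"
      using hC[of "complex_of_real t" i x] complex_vector.subspace_scale[OF E, of i "complex_of_real t"]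
      by (intro bexI[of _ "complex_of_real t *\<^sub>C i"])
        (auto simp: scaleC_of_real)
  qed
  have p_scale_le: "p (c *\<^sub>C z) \<le> cmod c * p z" if "c \<noteq> 0" for c z
  proof -
    have "inverse (cmod c) * p (c *\<^sub>C z) \<le> p z"
      unfolding p_def[of z]
    proof (rule cINF_greatest[OF ne])
      fix e assume "e \<in> E"
      then have "p (c *\<^sub>C z) \<le> h (c *\<^sub>C e) (c *\<^sub>C z)"
        using E by (intro p_le) (auto simp: complex_vector.subspace_scale)
      then show "inverse (cmod c) * p (c *\<^sub>C z) \<le> h e z"
        using that by (simp add: hC field_simps)
    qed
    then show ?thesis
      using that by (simp add: field_simps)
  qed
  have p_scale: "p (c *\<^sub>C z) = cmod c * p z" for c z
  proof (cases "c = 0")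
    case True
    then show ?thesis using sublinear_zero[OF sub] by simp
  next
    case False
    have "p (inverse c *\<^sub>C (c *\<^sub>C z)) \<le> cmod (inverse c) * p (c *\<^sub>C z)"
      using False by (intro p_scale_le) auto
    then have "cmod c * p z \<le> p (c *\<^sub>C z)"
      using False by (simp add: scaleC_scaleC norm_divide field_simps)
    with p_scale_le[OF False] show ?thesis by (intro antisym)
  qed
  have p_norm: "p z \<le> norm z" for z
    using p_le[OF E0, of z] by (simp add: h_def f0)
  obtain v :: "'a \<Rightarrow>\<^sub>C\<^sub>L complex" where v: "\<And>x. cmod (cblinfun_apply v x) \<le> p x"
      "cblinfun_apply v y = complex_of_real (p y)"
  proof (rule Hahn_Banach_seminorm[of p 1])
  qed (use sublinear_add[OF sub] p_scale p_norm in auto)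
  show thesis
  proof (rule that[of v "p y"])
    show "cmod (cblinfun_apply v z) \<le> norm z" for z
      using v(1)[of z] p_norm[of z] by simp
    show "cmod (cblinfun_apply v (f e)) \<le> a * norm e" if "e \<in> E" for e
      using v(1)[of "f e"] p_le[OF that, of "f e"] by (simp add: h_def)
    show "d \<le> p y"
      unfolding p_def using d by (intro cINF_greatest[OF ne]) (auto simp: h_def)
  qed (rule v(2))
qed

lemma norming_functional:
  fixes x :: "'a::complex_normed_vector"
  shows "\<exists>v :: 'a \<Rightarrow>\<^sub>C\<^sub>L complex. (\<forall>z. cmod (cblinfun_apply v z) \<le> norm z)
    \<and> cblinfun_apply v x = complex_of_real (norm x)"
proof -
  obtain v :: "'a \<Rightarrow>\<^sub>C\<^sub>L complex" and r where v: "\<And>z. cmod (cblinfun_apply v z) \<le> norm z"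
    "cblinfun_apply v x = complex_of_real r" "norm x \<le> r"
    by (rule separating_functional[where f = "\<lambda>x :: 'a. 0 :: 'a" and E = UNIV and a = 0
          and d = "norm x" and y = x]) auto
  moreover have "r = norm x"
    using v(1)[of x] v(2,3) by (smt (verit) norm_of_real norm_ge_zero)
  ultimately show ?thesis by blast
qed

lemma annihilating_functional:
  fixes x :: "'a::complex_normed_vector"
  assumes "csubspace W" "closed W" "x \<notin> W"
  shows "\<exists>v :: 'a \<Rightarrow>\<^sub>C\<^sub>L complex. (\<forall>w\<in>W. cblinfun_apply v w = 0) \<and> cblinfun_apply v x = 1"
proof -
  obtain d where d: "d > 0" "\<And>w. w \<in> W \<Longrightarrow> d \<le> norm (x - w)"
  proof -
    obtain d where "d > 0" "ball x d \<subseteq> - W"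
      using assms by (metis ComplI Compl_eq open_Compl open_contains_ball)
    then show thesis
      by (intro that[of d]) (auto simp: subset_iff dist_norm, meson not_le)
  qed
  obtain v :: "'a \<Rightarrow>\<^sub>C\<^sub>L complex" and r where v:
    "\<And>w. w \<in> W \<Longrightarrow> cmod (cblinfun_apply v w) \<le> 0 * norm w"
    "cblinfun_apply v x = complex_of_real r" "d \<le> r"
    by (rule separating_functional[where f = "\<lambda>x :: 'a. x" and E = W and a = 0
          and d = d and y = x]) (use assms d in auto)
  show ?thesis
    by (rule exI[of _ "complex_of_real (inverse r) *\<^sub>C v"])
      (use v d in \<open>auto simp: scaleC_complex_def simp flip: of_real_mult\<close>)
qed

section \<open>The open mapping theorem\<close>

text \<open>Solve for \<open>w\<close> up to half its norm, then for the residual, and so on: the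
  corrections are dominated by a geometric series of ratio 1/2, hence the factor 2. The target
  \<open>W\<close> is kept general because it is taken to be the image, the closure of the range and
  the whole space in turn.\<close>

lemma approximate_surjection:
  fixes f :: "'a::banach \<Rightarrow> 'b::real_normed_vector"
  assumes f: "bounded_linear f" and U: "subspace U" "closed U" and W: "subspace W" "f ` U \<subseteq> W"
    and approx: "\<And>w. w \<in> W \<Longrightarrow> \<exists>u\<in>U. norm u \<le> C * norm w \<and> norm (w - f u) \<le> norm w / 2"
    and w: "w \<in> W"
  shows "\<exists>u\<in>U. f u = w \<and> norm u \<le> 2 * C * norm w"
proof -
  interpret f: bounded_linear f by (rule f)
  obtain g where g: "\<And>w. w \<in> W \<Longrightarrow> g w \<in> U" "\<And>w. w \<in> W \<Longrightarrow> norm (g w) \<le> C * norm w"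
    "\<And>w. w \<in> W \<Longrightarrow> norm (w - f (g w)) \<le> norm w / 2"
    using approx by metis
  define r where "r = rec_nat w (\<lambda>_ r. r - f (g r))"
  have r0: "r 0 = w" and rS: "r (Suc n) = r n - f (g (r n))" for n
    by (simp_all add: r_def)
  have rW: "r n \<in> W" for n
  proof (induction n)
    case (Suc n)
    then show ?case
      unfolding rS using W g(1) by (intro subspace_diff) auto
  qed (simp add: r0 w)
  have rn: "norm (r n) \<le> norm w * (1 / 2) ^ n" for n
  proof (induction n)
    case (Suc n)
    then show ?case
      using g(3)[OF rW[of n]] unfolding rS by simp
  qed (simp add: r0)
  \<comment> \<open>The sign of \<open>C\<close> is not prescribed. A negative \<open>C\<close>
    forces all residuals, including \<open>r 0 = w\<close>, to vanish.\<close>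
  have C: "C * norm (r n) \<le> C * norm w * (1 / 2) ^ n" for n
  proof (cases "C \<ge> 0")
    case True
    then show ?thesis using mult_left_mono[OF rn] by (simp add: mult.assoc)
  next
    case False
    then have "norm (r n) = 0" for n
      using g(2)[OF rW[of n]] by (smt (verit) mult_neg_pos norm_ge_zero)
    from this[of n] this[of 0] show ?thesis by (simp add: r0)
  qed
  have un: "norm (g (r n)) \<le> C * norm w * (1 / 2) ^ n" for n
    using g(2)[OF rW[of n]] C[of n] by simp
  have sg: "summable (\<lambda>n. C * norm w * (1 / 2) ^ n)"
    by (intro summable_mult summable_geometric) simp
  then have sm: "summable (\<lambda>n. g (r n))"
    by (rule summable_comparison_test'[where N = 0]) (rule un)
  let ?u = "\<Sum>n. g (r n)"
  have "?u \<in> U"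
  proof (rule closed_sequentially[OF U(2)])
    show "(\<Sum>k<n. g (r k)) \<in> U" for n
      using U(1) g(1) rW by (intro subspace_sum) auto
    show "(\<lambda>n. \<Sum>k<n. g (r k)) \<longlonglongrightarrow> ?u"
      by (rule summable_LIMSEQ[OF sm])
  qed
  moreover have "f ?u = w"
  proof -
    have "(\<lambda>n. norm w * (1 / 2) ^ n) \<longlonglongrightarrow> 0"
      by (intro tendsto_mult_right_zero LIMSEQ_power_zero) simp
    then have "r \<longlonglongrightarrow> 0"
      by (rule Lim_null_comparison[OF always_eventually, rotated]) (rule allI, rule rn)
    then have "(\<lambda>n. r n - r (Suc n)) sums (r 0 - 0)"
      by (rule telescope_sums')
    then have "(\<lambda>n. f (g (r n))) sums w"
      by (simp add: rS r0)
    then show ?thesis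
      using f.suminf[OF sm] sums_unique by metis
  qed
  moreover have "norm ?u \<le> (\<Sum>n. C * norm w * (1 / 2) ^ n)"
    using un sg by (rule norm_suminf_le)
  moreover have "(\<Sum>n. C * norm w * (1 / 2) ^ n) = 2 * C * norm w"
    by (subst suminf_mult) (auto simp: suminf_geometric)
  ultimately show ?thesis
    by auto
qed

text \<open>Baire's theorem in the closed image, covered by the closures \<open>G n\<close> of the
  images of balls. A closed subspace \<open>U\<close> is allowed as domain so that the lemma applies
  to maps sending \<open>(x, c)\<close> to \<open>F x + c\<close>, with \<open>x\<close> and
  \<open>c\<close> confined to given subspaces.\<close>

lemma open_mapping:
  fixes f :: "'a::banach \<Rightarrow> 'b::banach"
  assumes f: "bounded_linear f" and U: "subspace U" "closed U" and W: "closed (f ` U)"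
  shows "\<exists>C>0. \<forall>w\<in>f ` U. \<exists>u\<in>U. f u = w \<and> norm u \<le> C * norm w"
proof -
  interpret f: bounded_linear f by (rule f)
  let ?W = "f ` U"
  have sW: "subspace ?W"
    using f.linear_axioms U(1) by (rule linear_subspace_image)
  define G where "G n = closure (f ` (U \<inter> cball 0 (real n)))" for n :: nat
  have GW: "G n \<subseteq> ?W" for n
    unfolding G_def by (rule closure_minimal[OF _ W]) auto
  have cl: "closedin (top_of_set ?W) (G n)" for n
    by (rule closed_subset[OF GW]) (simp add: G_def)
  have UG: "\<Union> (range G) = ?W"
  proof
    show "?W \<subseteq> \<Union> (range G)"
    proof clarify
      fix u assume "u \<in> U"
      obtain n :: nat where "norm u \<le> n"
        using real_arch_simple by blast
      with \<open>u \<in> U\<close> have "f u \<in> G n"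
        unfolding G_def by (intro closure_subset[THEN subsetD]) auto
      then show "f u \<in> \<Union> (range G)" by blast
    qed
  qed (use GW in blast)
  have "\<exists>n. top_of_set ?W interior_of G n \<noteq> {}"
  proof (rule ccontr)
    assume "\<not> ?thesis"
    then have "top_of_set ?W interior_of \<Union> (range G) = {}"
      by (intro Baire_category_alt)
        (use W in \<open>auto simp: cl intro!: disjI1
          completely_metrizable_space_closedin[OF completely_metrizable_space_euclidean]\<close>)
    then show False
      using subspace_0[OF sW] unfolding UG by (simp add: interior_of_topspace[of "top_of_set ?W", simplified])
  qed
  then obtain n w0 where "w0 \<in> top_of_set ?W interior_of G n" by blast
  then obtain T where T: "openin (top_of_set ?W) T" "w0 \<in> T" "T \<subseteq> G n"
    unfolding interior_of_def by auto
  then have w0: "w0 \<in> ?W"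
    using openin_imp_subset by blast
  obtain r where r: "r > 0" "ball w0 r \<inter> ?W \<subseteq> G n"
    using T unfolding openin_contains_ball by (metis subset_trans)
  \<comment> \<open>Below, \<open>t\<close> scales \<open>w\<close> to length \<open>r / 2\<close>,
    so that \<open>w0\<close> and \<open>w0 + t *\<^sub>R w\<close> both lie in \<open>G n\<close>.
    Approximate preimages of the two differ by at most \<open>2 * real (Suc n)\<close>, and division
    by \<open>t = r / (2 * norm w)\<close> gives this constant. The two errors of
    \<open>r / 8\<close> add up to \<open>t * (norm w / 2)\<close>. Taking \<open>Suc n\<close>
    keeps \<open>C\<close> positive.\<close>
  define C where "C = 4 * real (Suc n) / r"
  have approx: "\<exists>u\<in>U. norm u \<le> C * norm w \<and> norm (w - f u) \<le> norm w / 2" if w: "w \<in> ?W" for w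
  proof (cases "w = 0")
    case True
    then show ?thesis
      using subspace_0[OF U(1)] by (intro bexI[of _ 0]) (auto simp: f.zero)
  next
    case False
    define t where "t = r / (2 * norm w)"
    have t: "t > 0" "t * norm w = r / 2"
      using False r by (auto simp: t_def)
    have near: "\<exists>u\<in>U. norm u \<le> n \<and> norm (f u - w') < r / 8" if "w' \<in> G n" for w'
    proof -
      have "\<exists>y\<in>f ` (U \<inter> cball 0 (real n)). dist y w' < r / 8"
        using that r unfolding G_def closure_approachable by (meson divide_pos_pos zero_less_numeral)
      then show ?thesis by (auto simp: dist_norm)
    qed
    have "w0 \<in> G n"
      using T by blast
    moreover have "w0 + t *\<^sub>R w \<in> G n"
      using r t w0 w sW by (intro subsetD[OF r(2)])
        (auto simp: dist_norm intro!: subspace_add subspace_scale)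
    ultimately obtain u1 u2 where u: "u1 \<in> U" "norm u1 \<le> n" "norm (f u1 - w0) < r / 8"
      "u2 \<in> U" "norm u2 \<le> n" "norm (f u2 - (w0 + t *\<^sub>R w)) < r / 8"
      using near by meson
    define u where "u = (1 / t) *\<^sub>R (u2 - u1)"
    have "u \<in> U"
      unfolding u_def using U(1) u by (intro subspace_scale subspace_diff)
    moreover have "norm u \<le> C * norm w"
    proof -
      have "norm (u2 - u1) \<le> 2 * real (Suc n)"
        using norm_triangle_ineq4[of u2 u1] u by simp
      then have "norm u \<le> (1 / t) * (2 * real (Suc n))"
        using t(1) by (simp add: u_def divide_right_mono)
      also have "\<dots> = C * norm w"
        using r False by (simp add: C_def t_def field_simps)
      finally show ?thesis .
    qed
    moreover have "norm (w - f u) \<le> norm w / 2"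
    proof -
      have "t *\<^sub>R (w - f u) = (f u1 - w0) - (f u2 - (w0 + t *\<^sub>R w))"
        using t(1) by (simp add: u_def f.diff f.scaleR scaleR_diff_right)
      then have "t * norm (w - f u) = norm ((f u1 - w0) - (f u2 - (w0 + t *\<^sub>R w)))"
        using t(1) by (metis abs_of_pos norm_scaleR)
      also have "\<dots> \<le> norm (f u1 - w0) + norm (f u2 - (w0 + t *\<^sub>R w))"
        by (rule norm_triangle_ineq4)
      also have "\<dots> \<le> r / 4"
        using u by simp
      also have "r / 4 = t * (norm w / 2)"
        using t(2) by simp
      finally show ?thesis
        using t(1) by simp
    qed
    ultimately show ?thesis by blast
  qed
  have "C > 0" unfolding C_def using r by simp
  then show ?thesis
    using approximate_surjection[OF f U sW order_refl approx] by (intro exI[of _ "2 * C"]) auto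
qed

section \<open>Finite-dimensional subspaces\<close>

lemma closed_range_projection:
  assumes "\<And>x. cblinfun_apply P x \<in> W" "\<And>x. x \<in> W \<Longrightarrow> cblinfun_apply P x = x"
  shows "closed W"
proof -
  have "x \<in> W \<longleftrightarrow> cblinfun_apply P x = x" for x
    using assms(1)[of x] assms(2)[of x] by auto
  then have "W = {x. cblinfun_apply P x = x}" by blast
  also have "closed \<dots>"
    by (intro closed_Collect_eq continuous_on_cblinfun continuous_on_id)
  finally show ?thesis .
qed

text \<open>Projection and closedness are obtained together: the projection onto
  \<open>cspan B\<close> exhibits that span as a closed set of fixed points, and closedness supplies
  the functional that separates the next vector from it.\<close>

lemma finite_dim_projection:
  fixes B :: "'a::complex_normed_vector set"
  assumes "finite B"
  shows "\<exists>P :: 'a \<Rightarrow>\<^sub>C\<^sub>L 'a. range (cblinfun_apply P) \<subseteq> cspan B \<and> (\<forall>x\<in>cspan B. cblinfun_apply P x = x)"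
  using assms
proof (induction B)
  case empty
  then show ?case by (intro exI[of _ 0]) auto
next
  case (insert b B)
  then obtain P :: "'a \<Rightarrow>\<^sub>C\<^sub>L 'a" where P: "\<And>x. cblinfun_apply P x \<in> cspan B"
    "\<And>x. x \<in> cspan B \<Longrightarrow> cblinfun_apply P x = x"
    by blast
  show ?case
  proof (cases "b \<in> cspan B")
    case True
    then show ?thesis using P by (auto simp: complex_vector.span_redundant)
  next
    case False
    have "closed (cspan B)"
      using P by (rule closed_range_projection)
    then obtain u :: "'a \<Rightarrow>\<^sub>C\<^sub>L complex" where u: "\<And>x. x \<in> cspan B \<Longrightarrow> cblinfun_apply u x = 0" "cblinfun_apply u b = 1"
      using annihilating_functional[OF complex_vector.subspace_span _ False] by blast
    \<comment> \<open>The correction by \<open>b - P b\<close> makes \<open>b\<close> a fixed point,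
      and since \<open>u\<close> vanishes on the old span the action there is unchanged.\<close>
    let ?P = "P + rank_one (b - cblinfun_apply P b) u"
    have B: "cspan B \<subseteq> cspan (insert b B)"
      by (rule complex_vector.span_mono) auto
    have "cblinfun_apply ?P x \<in> cspan (insert b B)" for x
      using P(1) B by (auto intro!: complex_vector.span_add complex_vector.span_scale
          complex_vector.span_diff complex_vector.span_base[of b])
    moreover have "cblinfun_apply ?P x = x" if x: "x \<in> cspan (insert b B)" for x
    proof -
      obtain k where k: "x - k *\<^sub>C b \<in> cspan B"
        using x complex_vector.span_breakdown_eq by blast
      define y where "y = x - k *\<^sub>C b"
      have "x = y + k *\<^sub>C b" "cblinfun_apply P y = y" "cblinfun_apply u y = 0"
        using k P u by (auto simp: y_def)
      then show ?thesis
        by (simp add: cblinfun_add_right u scaleC_complex_def complex_vector.scale_right_diff_distrib)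
    qed
    ultimately show ?thesis by blast
  qed
qed

lemma closed_cspan:
  fixes B :: "'a::complex_normed_vector set"
  assumes "finite B"
  shows "closed (cspan B)"
proof -
  obtain P :: "'a \<Rightarrow>\<^sub>C\<^sub>L 'a" where P: "range (cblinfun_apply P) \<subseteq> cspan B"
    "\<forall>x\<in>cspan B. cblinfun_apply P x = x"
    using finite_dim_projection[OF assms] by blast
  then show ?thesis
    by (intro closed_range_projection[of P]) auto
qed

text \<open>Axiom (T4) speaks of rank-one operators only; this is how it reaches finite
  rank.\<close>

lemma finite_rank_induct [consumes 2, case_names zero add]:
  fixes P :: "'a::complex_normed_vector \<Rightarrow>\<^sub>C\<^sub>L 'a"
  assumes "finite B" "range (cblinfun_apply P) \<subseteq> cspan B"
    and zero: "Q 0" and add: "\<And>A x u. Q A \<Longrightarrow> Q (A + rank_one x u)"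
  shows "Q P"
  using assms(1,2)
proof (induction B arbitrary: P)
  case empty
  then have "P = 0"
    by (intro cblinfun_eqI) auto
  with zero show ?case by simp
next
  case (insert b B)
  show ?case
  proof (cases "b \<in> cspan B")
    case True
    then show ?thesis using insert by (simp add: complex_vector.span_redundant)
  next
    case False
    then obtain u :: "'a \<Rightarrow>\<^sub>C\<^sub>L complex" where u: "\<And>x. x \<in> cspan B \<Longrightarrow> cblinfun_apply u x = 0" "cblinfun_apply u b = 1"
      using annihilating_functional[OF complex_vector.subspace_span closed_cspan[OF insert(1)]] by blast
    \<comment> \<open>The functional \<open>u\<close> reads off the coefficient of \<open>b\<close>,
      so the difference takes values in the smaller span.\<close>
    let ?P = "P - rank_one b (u o\<^sub>C\<^sub>L P)"
    have "cblinfun_apply ?P x \<in> cspan B" for x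
    proof -
      obtain k where k: "cblinfun_apply P x - k *\<^sub>C b \<in> cspan B"
        using insert.prems complex_vector.span_breakdown_eq by blast
      have "cblinfun_apply u (cblinfun_apply P x) = k"
        using u(1)[OF k] u(2) by (simp add: cblinfun_diff_right scaleC_complex_def)
      with k show ?thesis by simp
    qed
    then have "Q ?P"
      by (intro insert.IH) auto
    from add[OF this, of b "u o\<^sub>C\<^sub>L P"] show ?thesis by simp
  qed
qed

lemma finite_complement:
  fixes W :: "'a::complex_normed_vector set"
  assumes W: "csubspace W" and "finite B"
  shows "\<exists>C. finite C \<and> W \<inter> cspan C = {0} \<and> cspan (W \<union> C) = cspan (W \<union> B)"
  using assms(2)
proof (induction B)
  case empty
  show ?case
    using complex_vector.subspace_0[OF W] by (intro exI[of _ "{}"]) auto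
next
  case (insert b B)
  then obtain C where C: "finite C" "W \<inter> cspan C = {0}" "cspan (W \<union> C) = cspan (W \<union> B)"
    by blast
  have ins: "cspan (insert b (W \<union> C)) = cspan (insert b (W \<union> B))"
    by (simp only: complex_vector.span_insert C(3))
  show ?case
  proof (cases "b \<in> cspan (W \<union> C)")
    case True
    then have "cspan (W \<union> C) = cspan (insert b (W \<union> B))"
      using ins by (simp add: complex_vector.span_redundant)
    with C show ?thesis by (intro exI[of _ C]) simp
  next
    case False
    have "W \<inter> cspan (insert b C) \<subseteq> {0}"
    proof
      fix w assume w: "w \<in> W \<inter> cspan (insert b C)"
      then obtain k where k: "w - k *\<^sub>C b \<in> cspan C"
        using complex_vector.span_breakdown_eq by blast
      have "k = 0"
      proof (rule ccontr)
        assume "k \<noteq> 0"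
        have "w \<in> cspan (W \<union> C)" "w - k *\<^sub>C b \<in> cspan (W \<union> C)"
          using w k complex_vector.span_mono[of C "W \<union> C"] by (auto intro: complex_vector.span_base)
        then have "w - (w - k *\<^sub>C b) \<in> cspan (W \<union> C)"
          by (rule complex_vector.span_diff)
        then have "inverse k *\<^sub>C (w - (w - k *\<^sub>C b)) \<in> cspan (W \<union> C)"
          by (rule complex_vector.span_scale)
        with \<open>k \<noteq> 0\<close> False show False by (simp add: scaleC_scaleC)
      qed
      with k w C(2) show "w \<in> {0}" by auto
    qed
    then have "W \<inter> cspan (insert b C) = {0}"
      using complex_vector.subspace_0[OF W] complex_vector.span_zero by blast
    with C ins show ?thesis
      by (intro exI[of _ "insert b C"]) auto
  qed
qed

lemma cspan_Un_subspace:
  "csubspace W \<Longrightarrow> cspan (W \<union> B) = {w + b | w b. w \<in> W \<and> b \<in> cspan B}"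
  by (simp add: complex_vector.span_Un complex_vector.span_eq_iff[THEN iffD2])

lemma cdim_less_infinity: "cdim V < \<infinity> \<longleftrightarrow> (\<exists>B. finite B \<and> cspan B = V)"
  unfolding cdim_def INF_less_iff by auto

lemma ccodim_less_infinity: "ccodim W < \<infinity> \<longleftrightarrow> (\<exists>B. finite B \<and> cspan (W \<union> B) = UNIV)"
  unfolding ccodim_def INF_less_iff by auto

lemma ccodim_eq_0:
  assumes "csubspace W"
  shows "ccodim W = 0 \<longleftrightarrow> W = UNIV"
proof
  assume "ccodim W = 0"
  then have "ccodim W < 1" by simp
  then obtain B where "finite B" "cspan (W \<union> B) = UNIV" "enat (card B) < 1"
    unfolding ccodim_def by (auto simp: INF_less_iff)
  then show "W = UNIV"
    using assms by (simp add: one_enat_def complex_vector.span_eq_iff[THEN iffD2])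
next
  assume "W = UNIV"
  then have "ccodim W \<le> enat (card ({} :: 'a set))"
    unfolding ccodim_def by (intro INF_lower) auto
  then show "ccodim W = 0"
    by (simp add: zero_enat_def[symmetric])
qed

lemma cdim_subset_finite:
  assumes "csubspace V" "V \<subseteq> cspan B" "finite B"
  shows "cdim V < \<infinity>"
proof -
  obtain A where A: "A \<subseteq> V" "complex_vector.independent A" "V \<subseteq> cspan A"
    using complex_vector.maximal_independent_subset by blast
  then have "finite A"
    using complex_vector.independent_span_bound[OF assms(3)] assms(2) by (meson subset_trans)
  moreover have "cspan A = V"
    using A assms(1) by (meson complex_vector.span_minimal subset_antisym)
  ultimately show ?thesis
    unfolding cdim_less_infinity by blast
qed

text \<open>The traces on \<open>cspan B\<close> of the subspaces have decreasing dimension, hence stabilise; by the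
  modular law the subspaces themselves do.\<close>

lemma decreasing_finite_codim:
  fixes M :: "nat \<Rightarrow> 'a::complex_normed_vector set"
  assumes M: "\<And>k. csubspace (M k)" "\<And>k l. k \<le> l \<Longrightarrow> M l \<subseteq> M k"
    and B: "finite B" "\<And>k. cspan (M k \<union> B) = UNIV"
  shows "cspan ((\<Inter>k. M k) \<union> B) = UNIV"
proof -
  let ?D = "cspan B"
  have sub: "csubspace (M k \<inter> ?D)" for k
    by (intro complex_vector.subspace_inter M complex_vector.subspace_span)
  obtain K where K: "\<And>k. complex_vector.dim (M K \<inter> ?D) \<le> complex_vector.dim (M k \<inter> ?D)"
    using exists_least_iff[of "\<lambda>d. \<exists>k. d = complex_vector.dim (M k \<inter> ?D)"] by (metis not_le)
  have stable: "M K \<inter> ?D \<subseteq> M k \<inter> ?D" if "K \<le> k" for k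
  proof -
    obtain A where A: "A \<subseteq> M k \<inter> ?D" "complex_vector.independent A" "M k \<inter> ?D \<subseteq> cspan A"
      using complex_vector.maximal_independent_subset by blast
    then have "A \<subseteq> M K \<inter> ?D"
      using M(2)[OF that] by blast
    then obtain A' where A': "A \<subseteq> A'" "A' \<subseteq> M K \<inter> ?D" "complex_vector.independent A'"
      "M K \<inter> ?D \<subseteq> cspan A'"
      using complex_vector.maximal_independent_subset_extend A(2) by blast
    have "finite A'"
      using complex_vector.independent_span_bound[OF B(1) A'(3)] A'(2) by blast
    moreover have "card A' \<le> card A"
      using complex_vector.basis_card_eq_dim[OF A'(2,4,3)] complex_vector.basis_card_eq_dim[OF A(1,3,2)]
        K[of k] by simp
    ultimately have "A = A'"
      using A'(1) by (simp add: card_seteq)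
    then show ?thesis
      using A'(4) A(1) sub complex_vector.span_minimal by (metis subset_trans)
  qed
  have "M K \<subseteq> M k" for k
  proof (cases "K \<le> k")
    case True
    show ?thesis
    proof
      fix m assume m: "m \<in> M K"
      have "m \<in> cspan (M k \<union> B)" using B(2) by blast
      then obtain w d where wd: "m = w + d" "w \<in> M k" "d \<in> ?D"
        unfolding cspan_Un_subspace[OF M(1)] by blast
      have "m - w \<in> M K"
        using m wd(2) M(2)[OF True] by (intro complex_vector.subspace_diff[OF M(1)]) auto
      moreover have "d = m - w"
        using wd(1) by simp
      ultimately have "d \<in> M k"
        using wd(3) stable[OF True] by blast
      with wd show "m \<in> M k"
        using complex_vector.subspace_add[OF M(1)] by blast
    qed
  qed (use M(2) in auto)
  then have "(\<Inter>k. M k) = M K" by blast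
  then show ?thesis using B by simp
qed

section \<open>Generalised inverses\<close>

lemma bounded_clinear_bounded_linear: "bounded_clinear f \<Longrightarrow> bounded_linear f"
  by (simp add: bounded_clinear_def)

lemma bounded_clinear_scale: "bounded_clinear f \<Longrightarrow> f (c *\<^sub>C x) = c *\<^sub>C f x"
  by (simp add: bounded_clinear_def)

lemma bounded_clinear_compose:
  "bounded_clinear f \<Longrightarrow> bounded_clinear g \<Longrightarrow> bounded_clinear (\<lambda>x. f (g x))"
  by (auto simp: bounded_clinear_def intro: bounded_linear_compose)

lemma csubspace_null_space:
  assumes "bounded_clinear f"
  shows "csubspace (null_space f)"
proof -
  interpret f: bounded_linear f using assms by (rule bounded_clinear_bounded_linear)
  show ?thesis
    unfolding complex_vector.subspace_def null_space_def
    using bounded_clinear_scale[OF assms] by (auto simp: f.zero f.add)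
qed

lemma csubspace_image:
  assumes "bounded_clinear f" "csubspace V"
  shows "csubspace (f ` V)"
proof -
  interpret f: bounded_linear f using assms(1) by (rule bounded_clinear_bounded_linear)
  show ?thesis
  proof (rule complex_vector.subspaceI)
    show "0 \<in> f ` V"
      using complex_vector.subspace_0[OF assms(2)] by (metis f.zero imageI)
    show "x + y \<in> f ` V" if "x \<in> f ` V" "y \<in> f ` V" for x y
      using that complex_vector.subspace_add[OF assms(2)] by (metis (no_types) f.add imageE imageI)
    show "c *\<^sub>C x \<in> f ` V" if "x \<in> f ` V" for c x
      using that complex_vector.subspace_scale[OF assms(2)] bounded_clinear_scale[OF assms(1)]
      by (metis (no_types) imageE imageI)
  qed
qed

lemma csubspace_range: "bounded_clinear f \<Longrightarrow> csubspace (range f)"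
  using csubspace_image complex_vector.subspace_UNIV by blast

lemma closed_null_space:
  assumes "bounded_clinear f"
  shows "closed (null_space f)"
proof -
  interpret f: bounded_linear f using assms by (rule bounded_clinear_bounded_linear)
  show ?thesis
    unfolding null_space_def by (intro closed_Collect_eq f.continuous_on continuous_on_id continuous_on_const)
qed

lemma bounded_linear_fst_snd:
  assumes "bounded_linear f"
  shows "bounded_linear (\<lambda>p. f (fst p) + snd p)"
  by (intro bounded_linear_add bounded_linear_compose[OF assms] bounded_linear_fst bounded_linear_snd)

text \<open>With a finite-dimensional complement \<open>cspan C\<close> of the range, the map
  sending \<open>(x, c)\<close> to \<open>F x + c\<close> is onto, and the component
  \<open>c\<close> is determined by the value. The open mapping theorem bounds \<open>c\<close> by
  the value. For \<open>z\<close> a limit of elements \<open>s n\<close> of the range,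
  \<open>z\<close> and \<open>z - s n\<close> have the same component, so it is 0.\<close>

lemma closed_range_finite_codim:
  fixes F :: "'a::cbanach \<Rightarrow> 'b::cbanach"
  assumes F: "bounded_clinear F" and B: "finite B" "cspan (range F \<union> B) = UNIV"
  shows "closed (range F)"
proof -
  interpret F: bounded_linear F using F by (rule bounded_clinear_bounded_linear)
  obtain C where C: "finite C" "range F \<inter> cspan C = {0}" "cspan (range F \<union> C) = UNIV"
    using finite_complement[OF csubspace_range[OF F] B(1)] B(2) by auto
  let ?U = "UNIV \<times> cspan C" and ?f = "\<lambda>p. F (fst p) + snd p"
  have im: "?f ` ?U = UNIV"
  proof -
    have "z \<in> ?f ` ?U" for z
    proof -
      have "z \<in> cspan (range F \<union> C)" using C(3) by blast
      then obtain x c where "z = F x + c" "c \<in> cspan C"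
        unfolding cspan_Un_subspace[OF csubspace_range[OF F]] by blast
      then show ?thesis by (intro image_eqI[of _ _ "(x, c)"]) auto
    qed
    then show ?thesis by blast
  qed
  have "subspace ?U"
    using csubspace_imp_subspace[OF complex_vector.subspace_span, of C]
    by (auto simp: subspace_def zero_prod_def)
  moreover have "closed ?U"
    using C(1) by (intro closed_Times closed_UNIV closed_cspan)
  ultimately have "\<exists>K>0. \<forall>z\<in>?f ` ?U. \<exists>u\<in>?U. ?f u = z \<and> norm u \<le> K * norm z"
    by (intro open_mapping bounded_linear_fst_snd F.bounded_linear_axioms) (simp_all add: im)
  then obtain K where K: "K > 0" "\<And>z. \<exists>u\<in>?U. ?f u = z \<and> norm u \<le> K * norm z"
    unfolding im by blast
  show ?thesis
    unfolding closed_sequential_limits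
  proof (intro allI impI)
    fix s z assume s: "(\<forall>n. s n \<in> range F) \<and> s \<longlonglongrightarrow> z"
    obtain x c where xc: "z = F x + c" "c \<in> cspan C"
      using K(2)[of z] by force
    have "norm c \<le> K * norm (z - s n)" for n
    proof -
      obtain x' c' where x': "z - s n = F x' + c'" "c' \<in> cspan C" "norm (x', c') \<le> K * norm (z - s n)"
        using K(2)[of "z - s n"] by (metis mem_Times_iff prod.collapse)
      obtain y where "s n = F y" using s by blast
      then have "c - c' = F (x' + y - x)"
        using x'(1) xc(1) by (simp add: F.add F.diff algebra_simps)
      moreover have "c - c' \<in> cspan C"
        using xc(2) x'(2) by (rule complex_vector.span_diff)
      ultimately have "c - c' \<in> range F \<inter> cspan C"
        by simp
      then have "c = c'" using C(2) by auto
      moreover have "norm c' \<le> norm (x', c')"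
        by (metis norm_snd_le snd_conv)
      ultimately show ?thesis using x'(3) by simp
    qed
    moreover have "(\<lambda>n. K * norm (z - s n)) \<longlonglongrightarrow> K * norm (z - z)"
      using s by (intro tendsto_intros) auto
    ultimately have "norm c \<le> K * norm (z - z)"
      by (intro Lim_bounded2[of _ _ 0 "norm c"]) auto
    then show "z \<in> range F" using xc by simp
  qed
qed

text \<open>The map sending \<open>(v, c)\<close> to \<open>F v + c\<close> is a bijection of
  \<open>V \<times> C\<close> onto the whole space, with bounded inverse by the open mapping
  theorem; \<open>G\<close> is the first component of that inverse. Closedness of the range of
  \<open>F\<close> is a consequence and not part of the hypotheses.\<close>

lemma generalised_inverse:
  fixes F :: "'a::cbanach \<Rightarrow> 'b::cbanach"
  assumes F: "bounded_clinear F"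
    and V: "csubspace V" "closed V" "null_space F \<inter> V = {0}" "\<And>x. \<exists>n\<in>null_space F. \<exists>v\<in>V. x = n + v"
    and C: "csubspace C" "closed C" "range F \<inter> C = {0}" "\<And>z. \<exists>w\<in>range F. \<exists>c\<in>C. z = w + c"
  obtains G where "bounded_clinear G" "\<And>z. z - F (G z) \<in> C" "\<And>x. F (G (F x)) = F x"
proof -
  interpret F: bounded_linear F using F by (rule bounded_clinear_bounded_linear)
  let ?U = "V \<times> C" and ?f = "\<lambda>p. F (fst p) + snd p"
  have inj: "p = q" if "p \<in> ?U" "q \<in> ?U" "?f p = ?f q" for p q
  proof -
    have "F (fst p - fst q) = snd q - snd p"
      using that(3) by (simp add: F.diff algebra_simps)
    moreover have "snd q - snd p \<in> C" "fst p - fst q \<in> V"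
      using that C(1) V(1) by (auto intro: complex_vector.subspace_diff)
    ultimately have "snd q - snd p \<in> range F \<inter> C" "fst p - fst q \<in> V"
      by (metis IntI rangeI)+
    then have "snd q = snd p"
      using C(3) by auto
    moreover from this have "fst p - fst q \<in> null_space F \<inter> V"
      using \<open>F (fst p - fst q) = snd q - snd p\<close> \<open>fst p - fst q \<in> V\<close> by (simp add: null_space_def)
    then have "fst p = fst q"
      using V(3) by auto
    ultimately show ?thesis by (simp add: prod_eq_iff)
  qed
  have im: "?f ` ?U = UNIV"
  proof -
    have "z \<in> ?f ` ?U" for z
    proof -
      obtain x c where "z = F x + c" "c \<in> C" using C(4) by blast
      moreover obtain n v where "x = n + v" "n \<in> null_space F" "v \<in> V" using V(4) by blast
      ultimately show ?thesis
        by (intro image_eqI[of _ _ "(v, c)"]) (auto simp: F.add null_space_def)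
    qed
    then show ?thesis by blast
  qed
  have "subspace ?U"
    using csubspace_imp_subspace[OF C(1)] csubspace_imp_subspace[OF V(1)]
    by (auto simp: subspace_def zero_prod_def)
  moreover have "closed ?U"
    using C(2) V(2) by (rule closed_Times[rotated])
  ultimately have "\<exists>K>0. \<forall>z\<in>?f ` ?U. \<exists>u\<in>?U. ?f u = z \<and> norm u \<le> K * norm z"
    by (intro open_mapping bounded_linear_fst_snd F.bounded_linear_axioms) (simp_all add: im)
  then obtain K where K: "K > 0" "\<And>z. \<exists>u\<in>?U. ?f u = z \<and> norm u \<le> K * norm z"
    unfolding im by blast
  then obtain g where g: "\<And>z. g z \<in> ?U" "\<And>z. ?f (g z) = z" "\<And>z. norm (g z) \<le> K * norm z"
    by metis
  define G where "G z = fst (g z)" for z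
  have gV: "fst (g z) \<in> V" and gC: "snd (g z) \<in> C" for z
    using g(1)[of z] by (auto simp: mem_Times_iff)
  have snd_g: "snd (g z) = z - F (G z)" for z
    using g(2)[of z] by (simp add: G_def algebra_simps)
  have "bounded_clinear G"
  proof (rule bounded_clinearI)
    fix x y c
    have "g (x + y) = g x + g y"
    proof (rule inj)
      show "g x + g y \<in> ?U"
        using gV gC by (auto simp: mem_Times_iff intro!: complex_vector.subspace_add V(1) C(1))
      have "F (fst (g x + g y)) + snd (g x + g y) = ?f (g x) + ?f (g y)"
        by (simp add: F.add)
      then show "?f (g (x + y)) = ?f (g x + g y)"
        by (simp only: g(2))
    qed (rule g(1))
    then show "G (x + y) = G x + G y" by (simp add: G_def)
    have "g (c *\<^sub>C x) = (c *\<^sub>C fst (g x), c *\<^sub>C snd (g x))"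
    proof (rule inj)
      show "(c *\<^sub>C fst (g x), c *\<^sub>C snd (g x)) \<in> ?U"
        using gV gC by (auto intro!: complex_vector.subspace_scale V(1) C(1))
      have "?f (c *\<^sub>C fst (g x), c *\<^sub>C snd (g x)) = c *\<^sub>C ?f (g x)"
        by (simp add: bounded_clinear_scale[OF F] scaleC_add_right)
      then show "?f (g (c *\<^sub>C x)) = ?f (c *\<^sub>C fst (g x), c *\<^sub>C snd (g x))"
        by (simp only: g(2))
    qed (rule g(1))
    then show "G (c *\<^sub>C x) = c *\<^sub>C G x" by (simp add: G_def)
    show "norm (G x) \<le> norm x * K"
      using g(3)[of x] norm_fst_le[of "fst (g x)" "snd (g x)"] by (simp add: G_def mult.commute)
  qed
  moreover have "z - F (G z) \<in> C" for z
    using gC[of z] by (simp add: snd_g)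
  moreover have "F (G (F x)) = F x" for x
  proof -
    have "F x - F (G (F x)) \<in> range F \<inter> C"
      using \<open>F x - F (G (F x)) \<in> C\<close> by (auto simp flip: F.diff)
    then show ?thesis using C(3) by auto
  qed
  ultimately show thesis by (rule that)
qed

text \<open>Since \<open>F o G o F = F\<close>, the maps \<open>G o F\<close> and
  \<open>F o G\<close> are bounded idempotents. The first has the null space of \<open>F\<close> as
  its kernel and the second has the range of \<open>F\<close> as its range, so the other half of
  each idempotent is the required complement.\<close>

lemma generalised_inverse_imp_complement:
  fixes F :: "'a::cbanach \<Rightarrow> 'b::cbanach"
  assumes F: "bounded_clinear F" and G: "bounded_clinear G" and FGF: "\<And>x. F (G (F x)) = F x"
  shows "has_direct_complement (null_space F)" "has_direct_complement (range F)" "closed (range F)"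
proof -
  interpret F: bounded_linear F using F by (rule bounded_clinear_bounded_linear)
  interpret G: bounded_linear G using G by (rule bounded_clinear_bounded_linear)
  note FG = bounded_clinear_compose[OF F G] and GF = bounded_clinear_compose[OF G F]
  interpret FG: bounded_linear "\<lambda>x. F (G x)" using FG by (rule bounded_clinear_bounded_linear)
  interpret GF: bounded_linear "\<lambda>x. G (F x)" using GF by (rule bounded_clinear_bounded_linear)
  show "has_direct_complement (null_space F)"
    unfolding has_direct_complement_def
  proof (intro exI conjI allI)
    show "csubspace (range (\<lambda>x. G (F x)))"
      by (rule csubspace_range[OF GF])
    have "range (\<lambda>x. G (F x)) = {x. G (F x) = x}"
      using FGF by (auto simp: image_iff intro: sym)
    then show "closed (range (\<lambda>x. G (F x)))"
      by (simp add: closed_Collect_eq GF.continuous_on continuous_on_id)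
    have "0 \<in> range (\<lambda>x. G (F x))"
      by (rule image_eqI[of _ _ 0]) (simp_all add: F.zero G.zero)
    then show "null_space F \<inter> range (\<lambda>x. G (F x)) = {0}"
      using FGF by (auto simp: null_space_def F.zero G.zero)
    fix x
    have "x - G (F x) \<in> null_space F" "x = (x - G (F x)) + G (F x)"
      using FGF by (auto simp: null_space_def F.diff)
    then show "\<exists>w\<in>null_space F. \<exists>v\<in>range (\<lambda>x. G (F x)). x = w + v"
      by blast
  qed
  show "has_direct_complement (range F)"
    unfolding has_direct_complement_def
  proof (intro exI conjI allI)
    show "csubspace (null_space (\<lambda>x. F (G x)))"
      by (rule csubspace_null_space[OF FG])
    show "closed (null_space (\<lambda>x. F (G x)))"
      by (rule closed_null_space[OF FG])
    have "0 \<in> range F"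
      by (rule image_eqI[of _ _ 0]) (simp_all add: F.zero)
    then show "range F \<inter> null_space (\<lambda>x. F (G x)) = {0}"
      using FGF by (auto simp: null_space_def F.zero G.zero)
    fix z
    have "z - F (G z) \<in> null_space (\<lambda>x. F (G x))" "z = F (G z) + (z - F (G z))"
      using FGF by (auto simp: null_space_def F.diff G.diff)
    then show "\<exists>w\<in>range F. \<exists>v\<in>null_space (\<lambda>x. F (G x)). z = w + v"
      by blast
  qed
  have "range F = {z. F (G z) = z}"
    using FGF by (auto simp: image_iff intro: sym)
  then show "closed (range F)"
    by (simp add: closed_Collect_eq FG.continuous_on continuous_on_id)
qed

section \<open>Closed ranges, approximate annihilators and approximate null vectors\<close>

lemma subspace_closure:
  fixes W :: "'a::real_normed_vector set"
  assumes "subspace W"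
  shows "subspace (closure W)"
  unfolding subspace_def
proof (intro conjI ballI allI)
  show "0 \<in> closure W"
    using closure_subset subspace_0[OF assms] by blast
next
  fix x y assume "x \<in> closure W" "y \<in> closure W"
  then obtain f g where "\<And>n. f n \<in> W" "f \<longlonglongrightarrow> x" "\<And>n. g n \<in> W" "g \<longlonglongrightarrow> y"
    unfolding closure_sequential by blast
  then show "x + y \<in> closure W"
    unfolding closure_sequential using subspace_add[OF assms]
    by (intro exI[of _ "\<lambda>n. f n + g n"]) (auto intro: tendsto_add)
next
  fix c x assume "x \<in> closure W"
  then obtain f where "\<And>n. f n \<in> W" "f \<longlonglongrightarrow> x"
    unfolding closure_sequential by blast
  then show "c *\<^sub>R x \<in> closure W"
    unfolding closure_sequential using subspace_scale[OF assms]
    by (intro exI[of _ "\<lambda>n. c *\<^sub>R f n"]) (auto intro: tendsto_intros)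
qed

text \<open>A point \<open>w\<close> of the closure lies within \<open>norm w / 2\<close> of some
  \<open>f x\<close>, whose norm is then at most \<open>3 / 2 * norm w\<close>. A short preimage of
  \<open>f x\<close> is thus an approximate preimage of \<open>w\<close> with constant
  \<open>3 / 2 * C\<close>, and successive approximation makes it exact.\<close>

lemma closed_range_bounded_preimages:
  fixes f :: "'a::banach \<Rightarrow> 'b::real_normed_vector"
  assumes f: "bounded_linear f" and pre: "\<And>x. \<exists>x'. f x' = f x \<and> norm x' \<le> C * norm (f x)" and C: "C > 0"
  shows "closed (range f)"
proof -
  interpret f: bounded_linear f by (rule f)
  let ?W = "closure (range f)"
  have sW: "subspace ?W"
    by (intro subspace_closure linear_subspace_image f.linear_axioms subspace_UNIV)
  have approx: "\<exists>u\<in>UNIV. norm u \<le> (3 / 2 * C) * norm w \<and> norm (w - f u) \<le> norm w / 2"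
    if w: "w \<in> ?W" for w
  proof (cases "w = 0")
    case True
    then show ?thesis by (intro bexI[of _ 0]) (auto simp: f.zero)
  next
    case False
    then have "norm w / 2 > 0" by simp
    then obtain x where x: "dist (f x) w < norm w / 2"
      using w unfolding closure_approachable by blast
    obtain x' where x': "f x' = f x" "norm x' \<le> C * norm (f x)"
      using pre by blast
    have "norm (f x) \<le> 3 / 2 * norm w"
      using x norm_triangle_ineq2[of "f x" w] by (simp add: dist_norm)
    then have "C * norm (f x) \<le> C * (3 / 2 * norm w)"
      using C by (intro mult_left_mono) auto
    then have "norm x' \<le> (3 / 2 * C) * norm w"
      using x'(2) by (simp add: mult.assoc)
    moreover have "norm (w - f x') \<le> norm w / 2"
      using x x'(1) by (simp add: dist_norm norm_minus_commute)
    ultimately show ?thesis by blast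
  qed
  have "?W \<subseteq> range f"
  proof
    fix w assume "w \<in> ?W"
    then show "w \<in> range f"
      using approximate_surjection[OF f subspace_UNIV closed_UNIV sW closure_subset approx] by blast
  qed
  then show ?thesis
    by (metis closed_closure closure_subset subset_antisym)
qed

text \<open>A quantitative form of: an operator is surjective if its adjoint is bounded below.\<close>

lemma approximate_annihilator:
  fixes f :: "'e::cbanach \<Rightarrow> 'a::cbanach"
  assumes f: "bounded_clinear f" and ns: "range f \<noteq> UNIV" and a: "a > 0"
  obtains v :: "'a \<Rightarrow>\<^sub>C\<^sub>L complex" and y where
    "\<And>z. cmod (cblinfun_apply v z) \<le> norm z" "cblinfun_apply v y = 1" "norm y \<le> 2"
    "\<And>e. cmod (cblinfun_apply v (f e)) \<le> a * norm e"
proof -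
  interpret f: bounded_linear f using f by (rule bounded_clinear_bounded_linear)
  \<comment> \<open>Some \<open>y\<close> has no approximate preimage with constant
    \<open>C\<close>, since otherwise \<open>f\<close> would be onto. For such a \<open>y\<close>,
    vectors of norm at most \<open>C * norm y\<close> leave a residual above
    \<open>norm y / 2\<close>; for longer vectors the penalty \<open>a * norm e\<close> exceeds
    \<open>a * C * norm y\<close>, and \<open>C\<close> is chosen to make that
    \<open>norm y / 2\<close> as well.\<close>
  define C where "C = 1 / (2 * a)"
  have "\<exists>y. \<forall>u. \<not> (norm u \<le> C * norm y \<and> norm (y - f u) \<le> norm y / 2)"
  proof (rule ccontr)
    assume "\<not> ?thesis"
    then have "\<And>y. y \<in> UNIV \<Longrightarrow> \<exists>u\<in>UNIV. norm u \<le> C * norm y \<and> norm (y - f u) \<le> norm y / 2"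
      by blast
    from approximate_surjection[OF f.bounded_linear_axioms subspace_UNIV closed_UNIV subspace_UNIV
        subset_UNIV this]
    have "\<exists>u. f u = w" for w by blast
    with ns show False by (metis surjI)
  qed
  then obtain y where y: "\<And>u. norm u \<le> C * norm y \<Longrightarrow> \<not> norm (y - f u) \<le> norm y / 2"
    by blast
  have y0: "y \<noteq> 0" using y[of 0] by (auto simp: f.zero)
  have d: "norm y / 2 \<le> a * norm e + norm (y - f e)" for e
  proof (cases "norm e \<le> C * norm y")
    case True
    then have "norm y / 2 < norm (y - f e)" using y[OF True] by (simp only: not_le)
    then show ?thesis using a by (smt (verit) mult_nonneg_nonneg norm_ge_zero)
  next
    case False
    then have "a * (C * norm y) \<le> a * norm e" using a by simp
    moreover have "a * (C * norm y) = norm y / 2" using a by (simp add: C_def)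
    ultimately show ?thesis by (smt (verit) norm_ge_zero)
  qed
  obtain v :: "'a \<Rightarrow>\<^sub>C\<^sub>L complex" and r where v:
    "\<And>z. cmod (cblinfun_apply v z) \<le> norm z"
    "\<And>e. cmod (cblinfun_apply v (f e)) \<le> a * norm e"
    "cblinfun_apply v y = complex_of_real r" "norm y / 2 \<le> r"
    by (rule separating_functional[where f = f and E = UNIV and a = a and d = "norm y / 2" and y = y])
      (use a d f in \<open>auto simp: f.add bounded_clinear_scale\<close>)
  have r: "r > 0" using v(4) y0 by (smt (verit) half_gt_zero zero_less_norm_iff)
  \<comment> \<open>Rescaling by \<open>r \<ge> norm y / 2\<close> normalises \<open>v y\<close> to
    1 and keeps the vector at norm at most 2, a bound free of \<open>a\<close>.\<close>
  show thesis
  proof (rule that[of v "complex_of_real (inverse r) *\<^sub>C y"])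
    show "cblinfun_apply v (complex_of_real (inverse r) *\<^sub>C y) = 1"
      using r v(3) by (simp add: scaleC_complex_def flip: of_real_mult)
    show "norm (complex_of_real (inverse r) *\<^sub>C y) \<le> 2"
      using r v(4) by (simp add: norm_scaleC norm_divide field_simps)
  qed (use v in auto)
qed

text \<open>An operator bounded below by \<open>e\<close> is injective with closed range. This
  supplies approximate null vectors for the upper conditions, as
  \<open>approximate_annihilator\<close> supplies functionals for the lower ones.\<close>

lemma not_bounded_below:
  fixes f :: "'a::cbanach \<Rightarrow> 'b::complex_normed_vector"
  assumes f: "bounded_clinear f" and sing: "null_space f \<noteq> {0} \<or> \<not> closed (range f)" and e: "e > 0"
  shows "\<exists>x. norm x = 1 \<and> norm (f x) < e"
proof (rule ccontr)
  assume neg: "\<not> ?thesis"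
  interpret f: bounded_linear f using f by (rule bounded_clinear_bounded_linear)
  have ge: "e * norm x \<le> norm (f x)" for x
  proof (cases "x = 0")
    case False
    then have "norm (inverse (norm x) *\<^sub>R x) = 1" by simp
    then have "e \<le> norm (f (inverse (norm x) *\<^sub>R x))"
      using neg not_le by blast
    then show ?thesis using False by (simp add: f.scaleR field_simps)
  qed (simp add: f.zero)
  have "null_space f = {0}"
  proof -
    have "x = 0" if "f x = 0" for x
      using ge[of x] that e by (simp add: mult_le_0_iff)
    then show ?thesis by (auto simp: null_space_def f.zero)
  qed
  moreover have "closed (range f)"
    using ge e by (intro complete_imp_closed complete_isometric_image[OF e subspace_UNIV f.bounded_linear_axioms])
      (auto intro: complete_UNIV)
  ultimately show False using sing by blast
qed

section \<open>Closed subspaces of Hilbert spaces\<close>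

text \<open>The complement is described twice. As the set of \<open>y\<close> to which 0 is a
  nearest point of \<open>W\<close>, it is visibly closed and receives \<open>x - l\<close> for a
  nearest point \<open>l\<close> of \<open>W\<close> to \<open>x\<close>; as the orthogonal
  complement, it is visibly a subspace.\<close>

lemma hilbert_space_has_direct_complement:
  fixes W :: "'a::cbanach set"
  assumes H: "hilbert_space TYPE('a)" and W: "csubspace W" "closed W"
  shows "has_direct_complement W"
proof -
  obtain ip :: "'a \<Rightarrow> 'a \<Rightarrow> complex" where
    add: "\<And>x y z. ip (x + y) z = ip x z + ip y z" and
    scale: "\<And>c x y. ip (c *\<^sub>C x) y = c * ip x y" and
    cnj: "\<And>x y. ip y x = cnj (ip x y)" and
    nrm: "\<And>x. ip x x = complex_of_real ((norm x)\<^sup>2)"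
    using H unfolding hilbert_space_def by blast
  have add2: "ip z (x + y) = ip z x + ip z y" for x y z
    using cnj add by (metis complex_cnj_add)
  have scale2: "ip y (c *\<^sub>C x) = cnj c * ip y x" for c x y
    using cnj scale by (metis complex_cnj_mult)
  have sq: "(norm (y + v))\<^sup>2 = (norm y)\<^sup>2 + (norm v)\<^sup>2 + 2 * Re (ip y v)" for y v
  proof -
    have "ip (y + v) (y + v) = ip y y + ip v v + (ip y v + cnj (ip y v))"
      by (simp add: add add2 cnj[of y v] algebra_simps)
    also have "\<dots> = complex_of_real ((norm y)\<^sup>2 + (norm v)\<^sup>2 + 2 * Re (ip y v))"
      by (simp add: nrm complex_add_cnj)
    finally show ?thesis
      unfolding nrm by (simp only: of_real_eq_iff)
  qed
  have neg: "ip y (- v) = - ip y v" for y v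
    using scale2[of y "-1" v] by simp
  have par: "(norm (a + b))\<^sup>2 + (norm (a - b))\<^sup>2 = 2 * (norm a)\<^sup>2 + 2 * (norm b)\<^sup>2" for a b :: 'a
    using sq[of a b] sq[of a "- b"] by (simp add: neg)
  have orth: "(\<forall>v\<in>W. norm y \<le> norm (y + v)) \<longleftrightarrow> (\<forall>v\<in>W. ip y v = 0)" for y
  proof safe
    fix v assume min: "\<forall>v\<in>W. norm y \<le> norm (y + v)" and v: "v \<in> W"
    show "ip y v = 0"
    proof (cases "v = 0")
      case True
      then show ?thesis using scale2[of y 0 0] by simp
    next
      case False
      \<comment> \<open>This \<open>c\<close> minimises the norm of
        \<open>y + c *\<^sub>C v\<close>, and lowers its square by
        \<open>(cmod (ip y v))\<^sup>2 / (norm v)\<^sup>2\<close>.\<close>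
      define c where "c = - (ip y v / complex_of_real ((norm v)\<^sup>2))"
      have "(norm y)\<^sup>2 \<le> (norm (y + c *\<^sub>C v))\<^sup>2"
        using min complex_vector.subspace_scale[OF W(1) v] by (intro power_mono) auto
      also have "\<dots> = (norm y)\<^sup>2 + (cmod c * norm v)\<^sup>2 + 2 * Re (cnj c * ip y v)"
        by (simp add: sq scale2 norm_scaleC)
      also have "cnj c * ip y v = - complex_of_real ((cmod (ip y v))\<^sup>2 / (norm v)\<^sup>2)"
        unfolding c_def using complex_norm_square[of "ip y v"] by (simp add: mult.commute)
      also have "cmod c * norm v = cmod (ip y v) / norm v"
        unfolding c_def using False by (simp add: norm_divide norm_mult power2_eq_square)
      finally have "(cmod (ip y v))\<^sup>2 / (norm v)\<^sup>2 \<le> 0"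
        by (simp add: power_divide)
      then show ?thesis
        using False by (simp add: divide_le_0_iff)
    qed
  next
    fix v assume "\<forall>v\<in>W. ip y v = 0" "v \<in> W"
    then have "(norm y)\<^sup>2 \<le> (norm (y + v))\<^sup>2"
      by (simp add: sq)
    then show "norm y \<le> norm (y + v)"
      by (rule power2_le_imp_le) simp
  qed
  define V where "V = {y. \<forall>v\<in>W. norm y \<le> norm (y + v)}"
  have V: "V = {y. \<forall>v\<in>W. ip y v = 0}"
    unfolding V_def by (simp add: orth)
  have "csubspace V"
    unfolding V complex_vector.subspace_def using scale[of 0 0] by (auto simp: add scale)
  moreover have "closed V"
  proof -
    have "V = (\<Inter>v\<in>W. {y. norm y \<le> norm (y + v)})"
      unfolding V_def by blast
    then show ?thesis
      by (auto intro!: closed_INT closed_Collect_le continuous_intros)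
  qed
  moreover have "W \<inter> V = {0}"
  proof -
    have "y = 0" if "y \<in> W" "y \<in> V" for y
    proof -
      have "- y \<in> W" using complex_vector.subspace_neg[OF W(1)] that by blast
      then have "norm y \<le> norm (y + - y)" using that unfolding V_def by blast
      then show ?thesis by simp
    qed
    then show ?thesis
      using complex_vector.subspace_0[OF W(1)] complex_vector.subspace_0[OF \<open>csubspace V\<close>] by blast
  qed
  moreover have "\<exists>w\<in>W. \<exists>v\<in>V. x = w + v" for x
  proof -
    define d where "d = infdist x W"
    have ne: "W \<noteq> {}" using complex_vector.subspace_0[OF W(1)] by blast
    have d_le: "d \<le> norm (x - w)" if "w \<in> W" for w
      using infdist_le[OF that] unfolding d_def by (simp add: dist_norm)
    have d0: "d \<ge> 0" unfolding d_def by (rule infdist_nonneg)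
    have "\<exists>w\<in>W. (norm (x - w))\<^sup>2 < d\<^sup>2 + e" if "e > 0" for e
    proof -
      have "d < sqrt (d\<^sup>2 + e)" using that d0 by (simp add: real_less_rsqrt)
      then obtain w where w: "w \<in> W" "dist x w < sqrt (d\<^sup>2 + e)"
        unfolding d_def infdist_notempty[OF ne] using cINF_less_iff[OF ne bdd_below_image_dist] by blast
      have "(norm (x - w))\<^sup>2 < (sqrt (d\<^sup>2 + e))\<^sup>2"
        using w by (intro power_strict_mono) (auto simp: dist_norm)
      then show ?thesis using that w(1) by auto
    qed
    then have "\<exists>w\<in>W. (norm (x - w))\<^sup>2 < d\<^sup>2 + 1 / real (Suc n)" for n
      by simp
    then obtain w where w: "\<And>n. w n \<in> W" "\<And>n. (norm (x - w n))\<^sup>2 < d\<^sup>2 + 1 / real (Suc n)"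
      by metis
    \<comment> \<open>Parallelogram law for \<open>x - w n\<close> and \<open>x - w m\<close>: their
      sum has norm at least \<open>2 * d\<close>, because the midpoint of \<open>w n\<close> and
      \<open>w m\<close> is in \<open>W\<close>, so their difference must be small.\<close>
    have dist: "(norm (w n - w m))\<^sup>2 \<le> 2 / real (Suc n) + 2 / real (Suc m)" for m n
    proof -
      have "(1 / 2) *\<^sub>R (w n + w m) \<in> W"
        using w(1) csubspace_imp_subspace[OF W(1)] by (intro subspace_scale subspace_add)
      then have "d \<le> norm (x - (1 / 2) *\<^sub>R (w n + w m))"
        by (rule d_le)
      moreover have "(x - w n) + (x - w m) = 2 *\<^sub>R (x - (1 / 2) *\<^sub>R (w n + w m))"
        by (simp add: algebra_simps scaleR_2)
      ultimately have "2 * d \<le> norm ((x - w n) + (x - w m))"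
        by simp
      then have "(2 * d)\<^sup>2 \<le> (norm ((x - w n) + (x - w m)))\<^sup>2"
        using d0 by (intro power_mono) auto
      moreover have "(x - w n) - (x - w m) = - (w n - w m)" by simp
      then have "norm ((x - w n) - (x - w m)) = norm (w n - w m)" by (metis norm_minus_cancel)
      ultimately show ?thesis
        using par[of "x - w n" "x - w m"] w(2)[of n] w(2)[of m] by (simp add: power_mult_distrib)
    qed
    have "Cauchy w"
    proof (rule metric_CauchyI)
      fix e :: real assume e: "e > 0"
      obtain N where N: "4 / e\<^sup>2 < real (Suc N)"
        using reals_Archimedean2 by (metis less_Suc_eq of_nat_less_iff order_less_trans)
      have "dist (w m) (w n) < e" if "N \<le> m" "N \<le> n" for m n
      proof -
        have "2 / real (Suc m) + 2 / real (Suc n) \<le> 2 / real (Suc N) + 2 / real (Suc N)"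
          using that by (intro add_mono divide_left_mono) auto
        also have "\<dots> = 4 / real (Suc N)"
          by (simp only: flip: add_divide_distrib) simp
        also have "\<dots> < e\<^sup>2"
          using N e by (simp only: pos_divide_less_eq zero_less_power of_nat_0_less_iff zero_less_Suc mult.commute)
        finally have "(norm (w m - w n))\<^sup>2 < e\<^sup>2"
          using dist[of m n] by simp
        then show ?thesis
          unfolding dist_norm by (rule power2_less_imp_less) (use e in simp)
      qed
      then show "\<exists>M. \<forall>m\<ge>M. \<forall>n\<ge>M. dist (w m) (w n) < e" by blast
    qed
    then obtain l where l: "w \<longlonglongrightarrow> l"
      using Cauchy_convergent_iff convergent_def by blast
    have lW: "l \<in> W" using closed_sequentially[OF W(2) w(1) l] .
    have "(norm (x - l))\<^sup>2 \<le> d\<^sup>2 + 0"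
    proof (rule LIMSEQ_le)
      show "(\<lambda>n. (norm (x - w n))\<^sup>2) \<longlonglongrightarrow> (norm (x - l))\<^sup>2"
        by (intro tendsto_intros l)
      show "(\<lambda>n. d\<^sup>2 + 1 / real (Suc n)) \<longlonglongrightarrow> d\<^sup>2 + 0"
        using LIMSEQ_inverse_real_of_nat by (intro tendsto_intros) (simp add: inverse_eq_divide)
    qed (use w(2) less_imp_le in blast)
    then have "norm (x - l) \<le> d"
      using d0 by (simp only: add_0_right) (rule power2_le_imp_le)
    moreover have "d \<le> norm (x - l + v)" if "v \<in> W" for v
      using d_le[of "l - v"] complex_vector.subspace_diff[OF W(1) lW that] by (simp add: algebra_simps)
    ultimately have "x - l \<in> V"
      unfolding V_def by (auto intro: order_trans)
    then show ?thesis using lW by (intro bexI[of _ l] bexI[of _ "x - l"]) auto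
  qed
  ultimately show ?thesis
    unfolding has_direct_complement_def by blast
qed

text \<open>The norm on the power is Euclidean, so it comes from the coordinatewise sum of the inner
  products.\<close>

lemma hilbert_space_vec:
  assumes "hilbert_space TYPE('a::cbanach)"
  shows "hilbert_space TYPE('a ^ 'n::finite)"
proof -
  obtain ip :: "'a \<Rightarrow> 'a \<Rightarrow> complex" where
    ip: "\<And>x y z. ip (x + y) z = ip x z + ip y z" "\<And>c x y. ip (c *\<^sub>C x) y = c * ip x y"
    "\<And>x y. ip y x = cnj (ip x y)" "\<And>x. ip x x = complex_of_real ((norm x)\<^sup>2)"
    using assms unfolding hilbert_space_def by blast
  have "(\<Sum>i\<in>UNIV. ip (x $ i) (x $ i)) = complex_of_real ((norm x)\<^sup>2)" for x :: "'a ^ 'n"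
    by (simp add: ip(4) norm_vec_def L2_set_def sum_nonneg)
  then show ?thesis
    unfolding hilbert_space_def
    by (intro exI[of _ "\<lambda>x y :: 'a ^ 'n. \<Sum>i\<in>UNIV. ip (x $ i) (y $ i)"])
      (auto simp: ip(1,2) sum.distrib sum_distrib_left scaleC_vec_def intro: sum.cong ip(3))
qed

section \<open>Powers of commuting families\<close>

text \<open>Surjectivity modulo an invariant \<open>Y\<close> passes from a commuting family to its
  powers. Each index has its own exponent so that one can be lowered at a time, and the induction is
  on their sum. If some exponent is 0, its summand can be \<open>z\<close> itself. Otherwise write z
  as a sum of terms \<open>A j x\<close> plus an element of \<open>Y\<close>, and decompose each
  \<open>x\<close> with the exponent of \<open>j\<close> lowered by one. It is applied with
  \<open>Y\<close> equal to \<open>{0}\<close> and to the algebraic tensors.\<close>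

lemma power_sum_decomposition:
  fixes A :: "'i::finite \<Rightarrow> 'c::ab_group_add \<Rightarrow> 'c" and e :: "'i \<Rightarrow> nat"
  assumes add: "\<And>i x y. A i (x + y) = A i x + A i y" and comm: "\<And>i j x. A i (A j x) = A j (A i x)"
    and Y: "0 \<in> Y" "\<And>x y. x \<in> Y \<Longrightarrow> y \<in> Y \<Longrightarrow> x + y \<in> Y" "\<And>i y. y \<in> Y \<Longrightarrow> A i y \<in> Y"
    and base: "\<And>z. \<exists>w. \<exists>y\<in>Y. z = (\<Sum>i\<in>UNIV. A i (w i)) + y"
  shows "\<exists>w. \<exists>y\<in>Y. z = (\<Sum>i\<in>UNIV. (A i ^^ e i) (w i)) + y"
proof (induction "\<Sum>i\<in>UNIV. e i" arbitrary: e z rule: less_induct)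
  case less
  define M where "M = {(\<Sum>i\<in>UNIV. (A i ^^ e i) (w i)) + y | w y. y \<in> Y}"
  have A0: "A i 0 = 0" for i using add[of i 0 0] by simp
  have pow_add: "(A i ^^ k) (x + y) = (A i ^^ k) x + (A i ^^ k) y" for i k x y
    by (induction k) (auto simp: add)
  have pow0: "(A i ^^ k) 0 = 0" for i k
    by (induction k) (auto simp: A0)
  have pow_comm: "A j ((A i ^^ k) x) = (A i ^^ k) (A j x)" for i j k x
    by (induction k) (auto simp: comm)
  have M_add: "x + y \<in> M" if x: "x \<in> M" and y: "y \<in> M" for x y
  proof -
    obtain w1 y1 w2 y2 where "y1 \<in> Y" "y2 \<in> Y" "x = (\<Sum>i\<in>UNIV. (A i ^^ e i) (w1 i)) + y1"
      "y = (\<Sum>i\<in>UNIV. (A i ^^ e i) (w2 i)) + y2"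
      using x y unfolding M_def by blast
    then show ?thesis
      unfolding M_def
      by (intro CollectI exI[of _ "\<lambda>i. w1 i + w2 i"] exI[of _ "y1 + y2"])
        (auto simp: pow_add sum.distrib algebra_simps Y)
  qed
  have YM: "y \<in> M" if "y \<in> Y" for y
    unfolding M_def using that by (intro CollectI exI[of _ "\<lambda>i. 0"] exI[of _ y]) (auto simp: pow0)
  have M_sum: "sum f I \<in> M" if "\<And>i. i \<in> I \<Longrightarrow> f i \<in> M" for f and I :: "'i set"
    using finite[of I] that by (induction I rule: finite_induct) (auto simp: YM Y M_add)
  show ?case
  proof (cases "\<exists>i. e i = 0")
    case True
    then obtain i where "e i = 0" by blast
    have "(\<Sum>k\<in>UNIV. (A k ^^ e k) (if k = i then z else 0)) = (\<Sum>k\<in>UNIV. if k = i then z else 0)"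
      using \<open>e i = 0\<close> by (intro sum.cong) (auto simp: pow0)
    then show ?thesis
      using Y(1) by (intro exI[of _ "\<lambda>k. if k = i then z else 0"] bexI[of _ 0]) auto
  next
    case False
    then have pos: "e j > 0" for j by (metis neq0_conv)
    have "A j x \<in> M" for j x
    proof -
      \<comment> \<open>Applying \<open>A j\<close> to a decomposition of \<open>x\<close> restores
        the lowered exponent in the summand \<open>j\<close>; past the other powers it commutes into
        the argument.\<close>
      define e' where "e' = e(j := e j - 1)"
      have "(\<Sum>i\<in>UNIV. e' i) < (\<Sum>i\<in>UNIV. e i)"
        using pos[of j] by (intro sum_strict_mono_ex1) (auto simp: e'_def intro!: exI[of _ j])
      from less.hyps[OF this, of x] obtain w y where wy: "y \<in> Y"
        "x = (\<Sum>i\<in>UNIV. (A i ^^ e' i) (w i)) + y"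
        by blast
      have A_sum: "A j (sum f I) = (\<Sum>i\<in>I. A j (f i))" for f and I :: "'i set"
        by (induction I rule: infinite_finite_induct) (auto simp: add A0)
      have "A j ((A i ^^ e' i) (w i)) = (A i ^^ e i) (if i = j then w i else A j (w i))" for i
      proof (cases "i = j")
        case True
        then show ?thesis
          using pos[of j] by (cases "e j") (auto simp: e'_def)
      qed (simp add: e'_def pow_comm)
      then have "A j x = (\<Sum>i\<in>UNIV. (A i ^^ e i) (if i = j then w i else A j (w i))) + A j y"
        unfolding wy(2) add A_sum by simp
      then show ?thesis
        unfolding M_def using Y(3)[OF wy(1), of j]
        by (intro CollectI exI[of _ "\<lambda>i. if i = j then w i else A j (w i)"] exI[of _ "A j y"] conjI)
    qed
    moreover obtain w y where "y \<in> Y" "z = (\<Sum>i\<in>UNIV. A i (w i)) + y"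
      using base by blast
    ultimately have "z \<in> M"
      by (simp add: M_add M_sum YM)
    then show ?thesis unfolding M_def by blast
  qed
qed

text \<open>The dual of the preceding lemma: joint injectivity modulo \<open>Y\<close> passes to
  powers. By induction on the sum of the exponents each \<open>A j z\<close> is in \<open>Y\<close>,
  since it satisfies the hypothesis with the exponent of \<open>j\<close> lowered by one; an
  exponent 0 says directly that \<open>z\<close> is in \<open>Y\<close>.\<close>

lemma power_joint_membership:
  fixes A :: "'i::finite \<Rightarrow> 'c \<Rightarrow> 'c" and e :: "'i \<Rightarrow> nat"
  assumes comm: "\<And>i j x. A i (A j x) = A j (A i x)" and Y: "\<And>i y. y \<in> Y \<Longrightarrow> A i y \<in> Y"
    and base: "\<And>z. (\<And>i. A i z \<in> Y) \<Longrightarrow> z \<in> Y"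
    and z: "\<And>i. (A i ^^ e i) z \<in> Y"
  shows "z \<in> Y"
  using z
proof (induction "\<Sum>i\<in>UNIV. e i" arbitrary: e z rule: less_induct)
  case less
  have pow_comm: "A j ((A i ^^ k) x) = (A i ^^ k) (A j x)" for i j k x
    by (induction k) (auto simp: comm)
  show ?case
  proof (cases "\<exists>i. e i = 0")
    case True
    then show ?thesis using less.prems by (metis funpow_0)
  next
    case False
    then have pos: "e j > 0" for j by (metis neq0_conv)
    have "A j z \<in> Y" for j
    proof (rule less.hyps)
      show "(\<Sum>i\<in>UNIV. (e(j := e j - 1)) i) < (\<Sum>i\<in>UNIV. e i)"
        using pos[of j] by (intro sum_strict_mono_ex1) (auto intro!: exI[of _ j])
      fix i
      show "(A i ^^ (e(j := e j - 1)) i) (A j z) \<in> Y"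
      proof (cases "i = j")
        case True
        then show ?thesis
          using pos[of j] less.prems[of j] by (cases "e j") (auto simp: funpow_swap1)
      next
        case False
        then show ?thesis
          using Y[OF less.prems[of i], of j] by (simp add: pow_comm)
      qed
    qed
    then show ?thesis by (rule base)
  qed
qed

lemma cspan_image_subset:
  assumes "bounded_clinear f"
  shows "f ` cspan B \<subseteq> cspan (f ` B)"
proof -
  interpret f: bounded_linear f using assms by (rule bounded_clinear_bounded_linear)
  have "csubspace {x. f x \<in> cspan (f ` B)}"
    unfolding complex_vector.subspace_def
    by (auto simp: f.zero f.add bounded_clinear_scale[OF assms] complex_vector.span_zero
        intro: complex_vector.span_add complex_vector.span_scale)
  then have "cspan B \<subseteq> {x. f x \<in> cspan (f ` B)}"
    by (intro complex_vector.span_minimal) (auto intro: complex_vector.span_base)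
  then show ?thesis by blast
qed

lemma csubspace_closure:
  fixes W :: "'a::complex_normed_vector set"
  assumes "csubspace W"
  shows "csubspace (closure W)"
proof -
  have "c *\<^sub>C x \<in> closure W" if "x \<in> closure W" for c x
  proof -
    have "(\<lambda>x. c *\<^sub>C x) ` closure W \<subseteq> closure ((\<lambda>x. c *\<^sub>C x) ` W)"
      by (intro closure_bounded_linear_image_subset bounded_linear_scaleC_right)
    also have "\<dots> \<subseteq> closure W"
      using complex_vector.subspace_scale[OF assms] by (intro closure_mono) auto
    finally show ?thesis using that by blast
  qed
  then show ?thesis
    using subspace_closure[OF csubspace_imp_subspace[OF assms]]
    unfolding complex_vector.subspace_def subspace_def by blast
qed

section \<open>Operator tuples\<close>

lemma bounded_clinear_sum:
  assumes "\<And>i. i \<in> I \<Longrightarrow> bounded_clinear (f i)"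
  shows "bounded_clinear (\<lambda>x. \<Sum>i\<in>I. f i x)"
  using assms by (auto simp: bounded_clinear_def complex_vector.scale_sum_right intro!: bounded_linear_sum sum.cong)

lemma bounded_clinear_vec_nth:
  "bounded_clinear (\<lambda>x :: 'a::complex_normed_vector ^ 'n::finite. x $ i)"
  by (auto simp: bounded_clinear_def scaleC_vec_def)

lemma norm_vec_le_sum:
  fixes x :: "'a::real_normed_vector ^ 'n::finite"
  shows "norm x \<le> (\<Sum>i\<in>UNIV. norm (x $ i))"
  unfolding norm_vec_def by (rule L2_set_le_sum) auto

lemma bounded_clinear_vec_lambda:
  fixes f :: "'n::finite \<Rightarrow> 'a::complex_normed_vector \<Rightarrow> 'b::complex_normed_vector"
  assumes "\<And>i. bounded_clinear (f i)"
  shows "bounded_clinear (\<lambda>x. \<chi> i. f i x)"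
proof -
  have "\<exists>K. \<forall>x. norm (f i x) \<le> norm x * K" for i
    using bounded_linear.bounded[OF bounded_clinear_bounded_linear[OF assms]] .
  then obtain K where K: "\<And>i x. norm (f i x) \<le> norm x * K i" by metis
  have add: "f i (x + y) = f i x + f i y" for i x y
    using bounded_clinear_bounded_linear[OF assms] by (simp add: linear_simps)
  show ?thesis
  proof (rule bounded_clinearI)
    fix x y c
    show "(\<chi> i. f i (x + y)) = (\<chi> i. f i x) + (\<chi> i. f i y)"
      by (simp add: vec_eq_iff add)
    show "(\<chi> i. f i (c *\<^sub>C x)) = c *\<^sub>C (\<chi> i. f i x)"
      by (simp add: vec_eq_iff scaleC_vec_def bounded_clinear_scale[OF assms])
    have "norm (\<chi> i. f i x) \<le> (\<Sum>i\<in>UNIV. norm (f i x))"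
      using norm_vec_le_sum[of "\<chi> i. f i x"] by simp
    also have "\<dots> \<le> (\<Sum>i\<in>UNIV. norm x * K i)"
      by (intro sum_mono K)
    finally show "norm (\<chi> i. f i x) \<le> norm x * (\<Sum>i\<in>UNIV. K i)"
      by (simp add: sum_distrib_left)
  qed
qed

lemma bounded_clinear_axis: "bounded_clinear (axis i :: 'a::complex_normed_vector \<Rightarrow> 'a ^ 'n::finite)"
proof -
  have "bounded_clinear (\<lambda>x :: 'a. if j = i then x else 0)" for j
    by (cases "j = i") (auto simp: bounded_clinear_def)
  then have "bounded_clinear (\<lambda>x :: 'a. \<chi> j. if j = i then x else 0)"
    by (rule bounded_clinear_vec_lambda)
  then show ?thesis
    by (simp add: axis_def[abs_def])
qed

lemma norm_axis_vec: "norm (axis i x :: 'a::real_normed_vector ^ 'n::finite) = norm x"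
proof (rule antisym)
  have "(\<Sum>j\<in>UNIV. norm ((axis i x :: 'a ^ 'n) $ j)) = (\<Sum>j\<in>UNIV. if j = i then norm x else 0)"
    by (intro sum.cong) (auto simp: axis_def)
  then show "norm (axis i x :: 'a ^ 'n) \<le> norm x"
    using norm_vec_le_sum[of "axis i x :: 'a ^ 'n"] by simp
  show "norm x \<le> norm (axis i x :: 'a ^ 'n)"
    using Finite_Cartesian_Product.norm_nth_le[of "axis i x :: 'a ^ 'n" i] by simp
qed

lemma bounded_clinear_hat_op: "bounded_clinear (hat_op T)"
  unfolding hat_op_def[abs_def]
  by (rule bounded_clinear_sum, rule bounded_clinear_compose[OF bounded_clinear_cblinfun bounded_clinear_vec_nth])

lemma bounded_clinear_tilde_op: "bounded_clinear (tilde_op T)"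
  unfolding tilde_op_def[abs_def] by (intro bounded_clinear_vec_lambda bounded_clinear_cblinfun)

lemma hat_op_axis: "hat_op T (axis i x) = cblinfun_apply (T $ i) x"
proof -
  have "hat_op T (axis i x) = (\<Sum>j\<in>UNIV. if j = i then cblinfun_apply (T $ i) x else 0)"
    unfolding hat_op_def by (intro sum.cong) (auto simp: axis_def)
  then show ?thesis by simp
qed

lemma null_space_tilde_op: "null_space (tilde_op T) = {x. \<forall>i. cblinfun_apply (T $ i) x = 0}"
  by (auto simp: null_space_def tilde_op_def vec_eq_iff)

lemma range_hat_op: "range (hat_op T) = {\<Sum>i\<in>UNIV. cblinfun_apply (T $ i) (w i) | w. True}"
proof -
  have "(\<Sum>i\<in>UNIV. cblinfun_apply (T $ i) (w i)) \<in> range (hat_op T)" for w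
    by (rule image_eqI[of _ _ "\<chi> i. w i"]) (simp_all add: hat_op_def)
  then show ?thesis by (auto simp: hat_op_def[of T])
qed

definition cblinfun_power :: "('a::complex_normed_vector \<Rightarrow>\<^sub>C\<^sub>L 'a) \<Rightarrow> nat \<Rightarrow> 'a \<Rightarrow>\<^sub>C\<^sub>L 'a"
  where "cblinfun_power A k = ((o\<^sub>C\<^sub>L) A ^^ k) cblinfun_id"

lemma cblinfun_power_0 [simp]: "cblinfun_power A 0 = cblinfun_id"
  and cblinfun_power_Suc [simp]: "cblinfun_power A (Suc k) = A o\<^sub>C\<^sub>L cblinfun_power A k"
  by (simp_all add: cblinfun_power_def)

lemma cblinfun_apply_power: "cblinfun_apply (cblinfun_power A k) = cblinfun_apply A ^^ k"
  by (induction k) auto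

text \<open>The powers are kept as a tuple of bounded operators so that \<open>M_sum k T\<close>
  becomes the range of \<open>hat_op\<close> for another tuple, and facts about such ranges apply
  for every \<open>k\<close>.\<close>

definition tuple_power :: "('a::cbanach \<Rightarrow>\<^sub>C\<^sub>L 'a) ^ 'n \<Rightarrow> nat \<Rightarrow> ('a \<Rightarrow>\<^sub>C\<^sub>L 'a) ^ 'n"
  where "tuple_power T k = (\<chi> i. cblinfun_power (T $ i) k)"

lemma M_sum_eq:
  fixes T :: "('a::cbanach \<Rightarrow>\<^sub>C\<^sub>L 'a) ^ 'n::finite"
  shows "M_sum k T = range (hat_op (tuple_power T k))"
proof -
  have "(\<forall>i. y i \<in> range (f i)) \<longleftrightarrow> (\<exists>w. y = (\<lambda>i. f i (w i)))" for y :: "'n \<Rightarrow> 'a" and f :: "'n \<Rightarrow> 'a \<Rightarrow> 'a"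
    by (simp add: image_iff fun_eq_iff choice_iff)
  then show ?thesis
    unfolding M_sum_def range_hat_op tuple_power_def by (auto simp: cblinfun_apply_power)
qed

lemma M_sum_1: "M_sum 1 T = range (hat_op T)"
  unfolding M_sum_eq range_hat_op tuple_power_def by (simp add: cblinfun_apply_power)

lemma csubspace_M_sum: "csubspace (M_sum k T)"
  unfolding M_sum_eq by (intro csubspace_range bounded_clinear_hat_op)

lemma M_sum_decreasing:
  assumes "k \<le> l"
  shows "M_sum l T \<subseteq> M_sum k T"
proof -
  have "f ^^ l = f ^^ k \<circ> f ^^ (l - k)" for f :: "'a \<Rightarrow> 'a"
    using assms by (simp flip: funpow_add)
  then have "range (f ^^ l) \<subseteq> range (f ^^ k)" for f :: "'a \<Rightarrow> 'a"
    by auto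
  then show ?thesis
    unfolding M_sum_def by blast
qed

lemma R_infty_subset: "k \<ge> 1 \<Longrightarrow> R_infty T \<subseteq> M_sum k T"
  unfolding R_infty_def by auto

lemma R_infty_eq: "R_infty T = (\<Inter>k. M_sum (Suc k) T)"
  unfolding R_infty_def by (auto, metis Suc_le_D One_nat_def)

lemma csubspace_R_infty: "csubspace (R_infty T)"
  unfolding R_infty_def by (intro complex_vector.subspace_Inter) (auto simp: csubspace_M_sum)

text \<open>One finite \<open>B\<close> for all exponents bounds the codimensions of a decreasing
  sequence, which therefore becomes stationary. The index \<open>Suc k\<close> starts the sequence
  at exponent 1.\<close>

lemma lower_semi_BrowderI:
  assumes "finite B" "\<And>k. cspan (M_sum (Suc k) T \<union> B) = UNIV"
  shows "lower_semi_Browder T"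
  unfolding lower_semi_Browder_def ccodim_less_infinity R_infty_eq
  using assms by (intro exI[of _ B] conjI decreasing_finite_codim csubspace_M_sum M_sum_decreasing) auto

lemma M_sum_UNIV:
  assumes comm: "commuting_tuple T" and surj: "range (hat_op T) = UNIV"
  shows "M_sum k T = UNIV"
proof -
  have "z \<in> M_sum k T" for z
  proof -
    have "\<exists>w. \<exists>y\<in>{0}. z = (\<Sum>i\<in>UNIV. (cblinfun_apply (T $ i) ^^ k) (w i)) + y"
    proof (rule power_sum_decomposition)
      show "cblinfun_apply (T $ i) (cblinfun_apply (T $ j) x)
          = cblinfun_apply (T $ j) (cblinfun_apply (T $ i) x)" for i j x
        using comm unfolding commuting_tuple_def by (metis cblinfun_apply_compose)
      fix z
      have "z \<in> range (hat_op T)" using surj by blast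
      then show "\<exists>w. \<exists>y\<in>{0}. z = (\<Sum>i\<in>UNIV. cblinfun_apply (T $ i) (w i)) + y"
        unfolding range_hat_op by auto
    qed (auto simp: cblinfun_add_right)
    then show ?thesis
      unfolding M_sum_eq range_hat_op tuple_power_def by (auto simp: cblinfun_apply_power)
  qed
  then show ?thesis by blast
qed

lemma surjective_imp_lower_semi_Browder:
  assumes "commuting_tuple T" "range (hat_op T) = UNIV"
  shows "lower_semi_Browder T"
  by (rule lower_semi_BrowderI[of "{}"]) (use M_sum_UNIV[OF assms] in auto)

lemma N_infty_eq:
  "N_infty T = {x. \<exists>k\<ge>1. \<forall>i. (cblinfun_apply (T $ i) ^^ k) x = 0}"
  unfolding N_infty_def null_space_def by auto

lemma csubspace_N_infty: "csubspace (N_infty T)"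
proof -
  have mono: "\<forall>i. (cblinfun_apply (T $ i) ^^ l) x = 0"
    if "\<forall>i. (cblinfun_apply (T $ i) ^^ k) x = 0" "k \<le> l" for k l x
  proof
    fix i
    have "(cblinfun_apply (T $ i) ^^ l) x = (cblinfun_apply (T $ i) ^^ (l - k)) ((cblinfun_apply (T $ i) ^^ k) x)"
      using \<open>k \<le> l\<close> by (metis comp_apply funpow_add le_add_diff_inverse2)
    also have "\<dots> = 0"
      using that(1) by (simp flip: cblinfun_apply_power)
    finally show "(cblinfun_apply (T $ i) ^^ l) x = 0" .
  qed
  show ?thesis
  proof (rule complex_vector.subspaceI)
    show "0 \<in> N_infty T"
      unfolding N_infty_eq by (intro CollectI exI[of _ 1]) (simp flip: cblinfun_apply_power)
    fix x y c assume "x \<in> N_infty T"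
    then obtain k where k: "k \<ge> 1" "\<forall>i. (cblinfun_apply (T $ i) ^^ k) x = 0"
      unfolding N_infty_eq by blast
    show "c *\<^sub>C x \<in> N_infty T"
      unfolding N_infty_eq using k by (intro CollectI exI[of _ k]) (simp flip: cblinfun_apply_power)
    assume "y \<in> N_infty T"
    then obtain l where l: "\<forall>i. (cblinfun_apply (T $ i) ^^ l) y = 0"
      unfolding N_infty_eq by blast
    have "\<forall>i. (cblinfun_apply (T $ i) ^^ (k + l)) (x + y) = 0"
      using mono[OF k(2), of "k + l"] mono[OF l, of "k + l"]
      by (simp add: cblinfun_add_right flip: cblinfun_apply_power)
    then show "x + y \<in> N_infty T"
      unfolding N_infty_eq using k(1) by (intro CollectI exI[of _ "k + l"]) auto
  qed
qed

lemma null_space_subset_N_infty: "null_space (tilde_op T) \<subseteq> N_infty T"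
  unfolding null_space_tilde_op N_infty_eq by (auto intro!: exI[of _ 1])

lemma N_infty_trivial:
  assumes comm: "commuting_tuple T" and inj: "null_space (tilde_op T) = {0}"
  shows "N_infty T = {0}"
proof -
  have "x = 0" if x: "\<And>i. (cblinfun_apply (T $ i) ^^ k) x = 0" for k x
  proof -
    have "x \<in> {0}"
    proof (rule power_joint_membership)
      show "cblinfun_apply (T $ i) (cblinfun_apply (T $ j) x)
          = cblinfun_apply (T $ j) (cblinfun_apply (T $ i) x)" for i j x
        using comm unfolding commuting_tuple_def by (metis cblinfun_apply_compose)
      show "(cblinfun_apply (T $ i) ^^ k) x \<in> {0}" for i
        using x by simp
      show "z \<in> {0}" if "\<And>i. cblinfun_apply (T $ i) z \<in> {0}" for z
        using inj that unfolding null_space_tilde_op by blast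
    qed auto
    then show ?thesis by simp
  qed
  then show ?thesis
    using complex_vector.subspace_0[OF csubspace_N_infty[of T]] unfolding N_infty_eq by blast
qed

text \<open>In this form closedness of the range is visibly invariant under permutations of the tuple.\<close>

lemma closed_range_tilde_op:
  fixes T :: "('a::cbanach \<Rightarrow>\<^sub>C\<^sub>L 'a) ^ 'n::finite"
  shows "closed (range (tilde_op T)) \<longleftrightarrow> (\<exists>C>0. \<forall>x. \<exists>x'. (\<forall>i. cblinfun_apply (T $ i) x' = cblinfun_apply (T $ i) x)
    \<and> norm x' \<le> C * (\<Sum>i\<in>UNIV. norm (cblinfun_apply (T $ i) x)))"
proof
  assume "closed (range (tilde_op T))"
  then have "\<exists>C>0. \<forall>w\<in>range (tilde_op T). \<exists>u\<in>UNIV. tilde_op T u = w \<and> norm u \<le> C * norm w"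
    by (intro open_mapping bounded_clinear_bounded_linear bounded_clinear_tilde_op) auto
  then obtain C where C: "C > 0" "\<And>x. \<exists>x'. tilde_op T x' = tilde_op T x \<and> norm x' \<le> C * norm (tilde_op T x)"
    by blast
  have "norm (tilde_op T x) \<le> (\<Sum>i\<in>UNIV. norm (cblinfun_apply (T $ i) x))" for x
    using norm_vec_le_sum[of "tilde_op T x"] by (simp add: tilde_op_def)
  then have "C * norm (tilde_op T x) \<le> C * (\<Sum>i\<in>UNIV. norm (cblinfun_apply (T $ i) x))" for x
    using C(1) by simp
  moreover have "tilde_op T x' = tilde_op T x \<longleftrightarrow> (\<forall>i. cblinfun_apply (T $ i) x' = cblinfun_apply (T $ i) x)" for x x'
    by (simp add: tilde_op_def vec_eq_iff)
  ultimately show "\<exists>C>0. \<forall>x. \<exists>x'. (\<forall>i. cblinfun_apply (T $ i) x' = cblinfun_apply (T $ i) x)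
    \<and> norm x' \<le> C * (\<Sum>i\<in>UNIV. norm (cblinfun_apply (T $ i) x))"
    using C by (meson order_trans)
next
  assume "\<exists>C>0. \<forall>x. \<exists>x'. (\<forall>i. cblinfun_apply (T $ i) x' = cblinfun_apply (T $ i) x)
    \<and> norm x' \<le> C * (\<Sum>i\<in>UNIV. norm (cblinfun_apply (T $ i) x))"
  then obtain C where C: "C > 0" "\<And>x. \<exists>x'. (\<forall>i. cblinfun_apply (T $ i) x' = cblinfun_apply (T $ i) x)
    \<and> norm x' \<le> C * (\<Sum>i\<in>UNIV. norm (cblinfun_apply (T $ i) x))"
    by blast
  show "closed (range (tilde_op T))"
  proof (rule closed_range_bounded_preimages)
    show "bounded_linear (tilde_op T)"
      by (intro bounded_clinear_bounded_linear bounded_clinear_tilde_op)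
    show "C * real CARD('n) > 0" using C(1) by simp
    fix x
    obtain x' where x': "\<forall>i. cblinfun_apply (T $ i) x' = cblinfun_apply (T $ i) x"
      "norm x' \<le> C * (\<Sum>i\<in>UNIV. norm (cblinfun_apply (T $ i) x))"
      using C(2) by blast
    have "(\<Sum>i\<in>UNIV. norm (cblinfun_apply (T $ i) x)) \<le> (\<Sum>i\<in>(UNIV :: 'n set). norm (tilde_op T x))"
      using Finite_Cartesian_Product.norm_nth_le[of "tilde_op T x"] by (intro sum_mono) (simp add: tilde_op_def)
    then have "C * (\<Sum>i\<in>UNIV. norm (cblinfun_apply (T $ i) x)) \<le> C * (real CARD('n) * norm (tilde_op T x))"
      using C(1) by (intro mult_left_mono) auto
    then show "\<exists>x'. tilde_op T x' = tilde_op T x \<and> norm x' \<le> C * real CARD('n) * norm (tilde_op T x)"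
      using x' by (intro exI[of _ x']) (auto simp: tilde_op_def vec_eq_iff mult.assoc)
  qed
qed

text \<open>The joint null space lies in \<open>N_infty T\<close> and inherits its finite
  dimension.\<close>

lemma upper_semi_Browder_iff:
  "upper_semi_Browder T \<longleftrightarrow> closed (range (tilde_op T)) \<and> cdim (N_infty T) < \<infinity>"
proof -
  have "cdim (null_space (tilde_op T)) < \<infinity>" if "cdim (N_infty T) < \<infinity>"
  proof -
    obtain B where "finite B" "cspan B = N_infty T"
      using \<open>cdim (N_infty T) < \<infinity>\<close> unfolding cdim_less_infinity by blast
    then show ?thesis
      using null_space_subset_N_infty[of T]
      by (intro cdim_subset_finite[of _ B] csubspace_null_space bounded_clinear_tilde_op) auto
  qed
  then show ?thesis
    unfolding upper_semi_Browder_def upper_semi_Fredholm_def by blast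
qed

lemma bounded_below_imp_upper_semi_Browder:
  assumes "commuting_tuple T" "null_space (tilde_op T) = {0}" "closed (range (tilde_op T))"
  shows "upper_semi_Browder T"
proof -
  have "finite {}" "cspan {} = N_infty T"
    using N_infty_trivial[OF assms(1,2)] by (simp_all add: complex_vector.span_empty)
  then show ?thesis
    unfolding upper_semi_Browder_iff cdim_less_infinity using assms(3) by blast
qed

text \<open>With \<open>G\<close> a generalised inverse of \<open>hat_op S\<close>, the operators
  \<open>V i\<close> are its coordinates and \<open>P\<close> is the identity minus
  \<open>hat_op S\<close> after \<open>G\<close>. The values of \<open>P\<close> lie in a
  finite-dimensional complement of the range, and \<open>P\<close> annihilates the range, which on
  vectors supported in one coordinate says that \<open>P\<close> composed with \<open>S $ i\<close>
  is 0.\<close>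

lemma lower_generalised_inverse:
  fixes S :: "('a::cbanach \<Rightarrow>\<^sub>C\<^sub>L 'a) ^ 'n::finite"
  assumes N: "has_direct_complement (null_space (hat_op S))"
    and B: "finite B" "cspan (range (hat_op S) \<union> B) = UNIV"
  shows "\<exists>(V :: 'n \<Rightarrow> 'a \<Rightarrow>\<^sub>C\<^sub>L 'a) P C.
    (\<forall>x. (\<Sum>i\<in>UNIV. cblinfun_apply (S $ i) (cblinfun_apply (V i) x)) + cblinfun_apply P x = x)
    \<and> (\<forall>i. P o\<^sub>C\<^sub>L S $ i = 0) \<and> finite C \<and> range (cblinfun_apply P) \<subseteq> cspan C"
proof -
  note F = bounded_clinear_hat_op[of S]
  obtain U where U: "csubspace U" "closed U" "null_space (hat_op S) \<inter> U = {0}"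
    "\<And>x. \<exists>n\<in>null_space (hat_op S). \<exists>u\<in>U. x = n + u"
    using N unfolding has_direct_complement_def by blast
  obtain C where C: "finite C" "range (hat_op S) \<inter> cspan C = {0}" "cspan (range (hat_op S) \<union> C) = UNIV"
    using finite_complement[OF csubspace_range[OF F] B(1)] B(2) by auto
  have "\<exists>w\<in>range (hat_op S). \<exists>c\<in>cspan C. z = w + c" for z
    using C(3) unfolding cspan_Un_subspace[OF csubspace_range[OF F]] by blast
  then obtain G where G: "bounded_clinear G" "\<And>z. z - hat_op S (G z) \<in> cspan C"
    "\<And>x. hat_op S (G (hat_op S x)) = hat_op S x"
    using generalised_inverse[OF F U complex_vector.subspace_span closed_cspan[OF C(1)] C(2)] by blast
  define V where "V i = CBlinfun (\<lambda>x. G x $ i)" for i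
  have V: "cblinfun_apply (V i) x = G x $ i" for i x
    unfolding V_def using bounded_clinear_compose[OF bounded_clinear_vec_nth G(1)] by simp
  define P where "P = cblinfun_id - CBlinfun (\<lambda>x. hat_op S (G x))"
  have P: "cblinfun_apply P x = x - hat_op S (G x)" for x
    unfolding P_def using bounded_clinear_compose[OF F G(1)] by simp
  show ?thesis
  proof (intro exI[of _ V] exI[of _ P] exI[of _ C] conjI allI)
    show "(\<Sum>i\<in>UNIV. cblinfun_apply (S $ i) (cblinfun_apply (V i) x)) + cblinfun_apply P x = x" for x
      unfolding V P by (simp add: hat_op_def)
    show "P o\<^sub>C\<^sub>L S $ i = 0" for i
      using G(3)[of "axis i _"] by (intro cblinfun_eqI) (simp add: P hat_op_axis)
  qed (use C G(2) P in auto)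
qed

text \<open>Here \<open>V i\<close> is the generalised inverse \<open>G\<close> restricted to the
  coordinate \<open>i\<close>, and \<open>P\<close> is the identity minus \<open>G\<close> after
  \<open>tilde_op S\<close>, which maps into the finite-dimensional joint null space.\<close>

lemma upper_generalised_inverse:
  fixes S :: "('a::cbanach \<Rightarrow>\<^sub>C\<^sub>L 'a) ^ 'n::finite"
  assumes N: "has_direct_complement (range (tilde_op S))"
    and fin: "cdim (null_space (tilde_op S)) < \<infinity>"
  shows "\<exists>(V :: 'n \<Rightarrow> 'a \<Rightarrow>\<^sub>C\<^sub>L 'a) P C.
    (\<forall>x. (\<Sum>i\<in>UNIV. cblinfun_apply (V i) (cblinfun_apply (S $ i) x)) + cblinfun_apply P x = x)
    \<and> (\<forall>i. S $ i o\<^sub>C\<^sub>L P = 0) \<and> finite C \<and> range (cblinfun_apply P) \<subseteq> cspan C"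
proof -
  note F = bounded_clinear_tilde_op[of S]
  interpret F: bounded_linear "tilde_op S" using F by (rule bounded_clinear_bounded_linear)
  obtain U where U: "csubspace U" "closed U" "range (tilde_op S) \<inter> U = {0}"
    "\<And>x. \<exists>n\<in>range (tilde_op S). \<exists>u\<in>U. x = n + u"
    using N unfolding has_direct_complement_def by blast
  obtain C where C: "finite C" "cspan C = null_space (tilde_op S)"
    using fin unfolding cdim_less_infinity by blast
  obtain R :: "'a \<Rightarrow>\<^sub>C\<^sub>L 'a" where R: "\<And>x. cblinfun_apply R x \<in> cspan C"
    "\<And>x. x \<in> cspan C \<Longrightarrow> cblinfun_apply R x = x"
    using finite_dim_projection[OF C(1)] by blast
  \<comment> \<open>The null space is complemented because it has finite dimension: the kernel of
    the projection \<open>R\<close> onto it serves.\<close>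
  have "null_space (tilde_op S) \<inter> null_space (cblinfun_apply R) \<subseteq> {0}"
    using R(2) unfolding C(2)[symmetric] by (auto simp: null_space_def)
  moreover have "0 \<in> null_space (tilde_op S) \<inter> null_space (cblinfun_apply R)"
    by (simp add: null_space_def F.zero)
  ultimately have int: "null_space (tilde_op S) \<inter> null_space (cblinfun_apply R) = {0}"
    by blast
  have dec: "\<exists>n\<in>null_space (tilde_op S). \<exists>v\<in>null_space (cblinfun_apply R). x = n + v" for x
    using R unfolding C(2)[symmetric]
    by (intro bexI[of _ "cblinfun_apply R x"] bexI[of _ "x - cblinfun_apply R x"])
      (auto simp: null_space_def cblinfun_diff_right)
  obtain G where G: "bounded_clinear G" "\<And>x. tilde_op S (G (tilde_op S x)) = tilde_op S x"
    using generalised_inverse[OF F csubspace_null_space closed_null_space int dec U]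
      bounded_clinear_cblinfun by metis
  interpret G: bounded_linear G using G(1) by (rule bounded_clinear_bounded_linear)
  define V where "V i = CBlinfun (\<lambda>x. G (axis i x))" for i
  have V: "cblinfun_apply (V i) x = G (axis i x)" for i x
    unfolding V_def using bounded_clinear_compose[OF G(1) bounded_clinear_axis] by simp
  define P where "P = cblinfun_id - CBlinfun (\<lambda>x. G (tilde_op S x))"
  have P: "cblinfun_apply P x = x - G (tilde_op S x)" for x
    unfolding P_def using bounded_clinear_compose[OF G(1) F] by simp
  have PN: "tilde_op S (cblinfun_apply P x) = 0" for x
    unfolding P by (simp add: F.diff G(2))
  show ?thesis
  proof (intro exI[of _ V] exI[of _ P] exI[of _ C] conjI allI)
    fix x
    have "tilde_op S x = (\<Sum>i\<in>UNIV. axis i (cblinfun_apply (S $ i) x))"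
      by (simp add: vec_eq_iff tilde_op_def axis_def)
    then have "G (tilde_op S x) = (\<Sum>i\<in>UNIV. cblinfun_apply (V i) (cblinfun_apply (S $ i) x))"
      by (simp add: G.sum V)
    then show "(\<Sum>i\<in>UNIV. cblinfun_apply (V i) (cblinfun_apply (S $ i) x)) + cblinfun_apply P x = x"
      by (simp add: P)
  next
    show "S $ i o\<^sub>C\<^sub>L P = 0" for i
      using PN by (intro cblinfun_eqI) (simp add: tilde_op_def vec_eq_iff)
    show "range (cblinfun_apply P) \<subseteq> cspan C"
      unfolding C(2) using PN by (auto simp: null_space_def)
  qed (rule C(1))
qed

section \<open>Slice maps\<close>

context eschmeier_tensor_product
begin

lemma bounded_bilinear_tens: "bounded_bilinear tens"
  and tens_scaleC_left: "tens (c *\<^sub>C x) y = c *\<^sub>C tens x y"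
  and tens_scaleC_right: "tens x (c *\<^sub>C y) = c *\<^sub>C tens x y"
  using tens_bilinear by (auto simp: bounded_cbilinear_def)

lemma bounded_bilinear_otens: "bounded_bilinear otens"
  and otens_scaleC_left: "otens (c *\<^sub>C A) B = c *\<^sub>C otens A B"
  and otens_scaleC_right: "otens A (c *\<^sub>C B) = c *\<^sub>C otens A B"
  using otens_bilinear by (auto simp: bounded_cbilinear_def)

lemmas tens_add_left = bounded_bilinear.add_left[OF bounded_bilinear_tens]
  and tens_add_right = bounded_bilinear.add_right[OF bounded_bilinear_tens]
  and tens_diff_left = bounded_bilinear.diff_left[OF bounded_bilinear_tens]
  and tens_zero_left [simp] = bounded_bilinear.zero_left[OF bounded_bilinear_tens]
  and tens_zero_right [simp] = bounded_bilinear.zero_right[OF bounded_bilinear_tens]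
  and tens_sum_left = bounded_bilinear.sum_left[OF bounded_bilinear_tens]
  and otens_add_left = bounded_bilinear.add_left[OF bounded_bilinear_otens]
  and otens_add_right = bounded_bilinear.add_right[OF bounded_bilinear_otens]
  and otens_diff_left = bounded_bilinear.diff_left[OF bounded_bilinear_otens]
  and otens_diff_right = bounded_bilinear.diff_right[OF bounded_bilinear_otens]
  and otens_zero_left [simp] = bounded_bilinear.zero_left[OF bounded_bilinear_otens]
  and otens_zero_right [simp] = bounded_bilinear.zero_right[OF bounded_bilinear_otens]
  and otens_sum_left = bounded_bilinear.sum_left[OF bounded_bilinear_otens]
  and otens_sum_right = bounded_bilinear.sum_right[OF bounded_bilinear_otens]

lemma bounded_clinear_tens_left: "bounded_clinear (\<lambda>x. tens x y)"
  using bounded_bilinear.bounded_linear_left[OF bounded_bilinear_tens]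
  by (simp add: bounded_clinear_def tens_scaleC_left)

lemma bounded_clinear_tens_right: "bounded_clinear (\<lambda>y. tens x y)"
  using bounded_bilinear.bounded_linear_right[OF bounded_bilinear_tens]
  by (simp add: bounded_clinear_def tens_scaleC_right)

lemma otens_apply_compose:
  "cblinfun_apply (otens A1 B1) (cblinfun_apply (otens A2 B2) z)
    = cblinfun_apply (otens (A1 o\<^sub>C\<^sub>L A2) (B1 o\<^sub>C\<^sub>L B2)) z"
  by (simp flip: otens_compose)

lemma tens_cancel_left: "y \<noteq> 0 \<Longrightarrow> tens x y = tens x' y \<Longrightarrow> x = x'"
  using norm_tens[of "x - x'" y] by (simp add: tens_diff_left)

text \<open>Both factors play the same part in the axioms, so each result on the first factor yields
  one on the second, over the same space.\<close>

lemma swap: "eschmeier_tensor_product (\<lambda>y x. tens x y) (\<lambda>B A. otens A B)"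
proof
  show "bounded_cbilinear (\<lambda>y x. tens x y)"
    unfolding bounded_cbilinear_def
    by (simp add: bounded_bilinear.flip[OF bounded_bilinear_tens] tens_scaleC_left tens_scaleC_right)
  show "bounded_cbilinear (\<lambda>B A. otens A B)"
    unfolding bounded_cbilinear_def
    by (simp add: bounded_bilinear.flip[OF bounded_bilinear_otens] otens_scaleC_left otens_scaleC_right)
qed (use norm_tens otens_tens otens_compose otens_id range_rank_one_left range_rank_one_right
    in \<open>simp_all add: mult.commute\<close>)

text \<open>This is the slice map of \<open>v\<close>, known on elementary tensors as x \<otimes> y
  going to v(y) x. The axioms only provide endomorphisms, so it is extracted from the operators
  \<open>otens cblinfun_id (rank_one y v)\<close>, with one \<open>x\<close> for all
  \<open>y\<close>. If the second space is zero, every \<open>x\<close> qualifies and the choice is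
  arbitrary; hence the nonzero \<open>y0\<close> in the facts below.\<close>

definition slice :: "('b \<Rightarrow>\<^sub>C\<^sub>L complex) \<Rightarrow> 'c \<Rightarrow> 'a"
  where "slice v z = (SOME x. \<forall>y. tens x y = cblinfun_apply (otens cblinfun_id (rank_one y v)) z)"

lemma tens_slice: "tens (slice v z) y = cblinfun_apply (otens cblinfun_id (rank_one y v)) z"
proof -
  have "\<exists>x. \<forall>y. tens x y = cblinfun_apply (otens cblinfun_id (rank_one y v)) z"
  proof (cases "\<exists>y0 :: 'b. y0 \<noteq> 0")
    case True
    then obtain y0 :: 'b where y0: "y0 \<noteq> 0" by blast
    obtain w :: "'b \<Rightarrow>\<^sub>C\<^sub>L complex" where w: "cblinfun_apply w y0 = complex_of_real (norm y0)"
      using norming_functional by blast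
    obtain x where x: "cblinfun_apply (otens cblinfun_id (rank_one y0 v)) z = tens x y0"
      using range_rank_one_right[of y0 v] by blast
    have "tens x y = cblinfun_apply (otens cblinfun_id (rank_one y v)) z" for y
    proof -
      \<comment> \<open>Axiom (T4) gives an \<open>x\<close> for the single vector
        \<open>y0\<close>. An operator \<open>R\<close> carrying \<open>y0\<close> to
        \<open>y\<close> shows that the same \<open>x\<close> works for \<open>y\<close>.\<close>
      define R where "R = complex_of_real (inverse (norm y0)) *\<^sub>C rank_one y w"
      have R: "cblinfun_apply R y0 = y"
        using y0 by (simp add: R_def w scaleC_scaleC flip: of_real_mult)
      have "rank_one y v = R o\<^sub>C\<^sub>L rank_one y0 v"
        by (rule cblinfun_eqI) (simp add: R)
      then have "cblinfun_apply (otens cblinfun_id (rank_one y v)) z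
          = cblinfun_apply (otens cblinfun_id R) (tens x y0)"
        by (simp add: otens_apply_compose flip: x)
      also have "\<dots> = tens x y"
        by (simp add: otens_tens R)
      finally show ?thesis ..
    qed
    then show ?thesis by blast
  next
    case False
    have "tens 0 y = cblinfun_apply (otens cblinfun_id (rank_one y v)) z" for y :: 'b
    proof -
      have "rank_one y v = 0"
        using False by (intro cblinfun_eqI) auto
      then show ?thesis by simp
    qed
    then show ?thesis by blast
  qed
  then have "\<forall>y. tens (slice v z) y = cblinfun_apply (otens cblinfun_id (rank_one y v)) z"
    unfolding slice_def by (rule someI_ex)
  then show ?thesis by blast
qed

context
  fixes y0 :: 'b
  assumes y0: "y0 \<noteq> 0"
begin

lemma slice_eqI: "tens x y0 = cblinfun_apply (otens cblinfun_id (rank_one y0 v)) z \<Longrightarrow> slice v z = x"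
  using tens_cancel_left[OF y0] tens_slice by metis

lemma slice_tens: "slice v (tens x y) = cblinfun_apply v y *\<^sub>C x"
  by (rule slice_eqI) (simp add: otens_tens tens_scaleC_left tens_scaleC_right)

lemma slice_otens_left: "slice v (cblinfun_apply (otens A cblinfun_id) z) = cblinfun_apply A (slice v z)"
proof (rule slice_eqI)
  have "tens (cblinfun_apply A (slice v z)) y0 = cblinfun_apply (otens A cblinfun_id) (tens (slice v z) y0)"
    by (simp add: otens_tens)
  then show "tens (cblinfun_apply A (slice v z)) y0
      = cblinfun_apply (otens cblinfun_id (rank_one y0 v)) (cblinfun_apply (otens A cblinfun_id) z)"
    by (simp add: tens_slice otens_apply_compose)
qed

lemma slice_otens_right: "slice v (cblinfun_apply (otens cblinfun_id B) z) = slice (v o\<^sub>C\<^sub>L B) z"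
proof (rule slice_eqI)
  have "rank_one y0 v o\<^sub>C\<^sub>L B = rank_one y0 (v o\<^sub>C\<^sub>L B)"
    by (rule cblinfun_eqI) simp
  then show "tens (slice (v o\<^sub>C\<^sub>L B) z) y0
      = cblinfun_apply (otens cblinfun_id (rank_one y0 v)) (cblinfun_apply (otens cblinfun_id B) z)"
    by (simp add: tens_slice otens_apply_compose)
qed

lemma slice_zero_functional: "slice 0 z = 0"
proof (rule slice_eqI)
  have "rank_one y0 0 = 0" by (rule cblinfun_eqI) simp
  then show "tens 0 y0 = cblinfun_apply (otens cblinfun_id (rank_one y0 0)) z" by simp
qed

text \<open>The order of quantifiers matters: \<open>K\<close> comes before \<open>v\<close>,
  because the approximate functionals will be chosen after an accuracy that depends on
  \<open>K\<close>. The bound is by the isometry of elementary tensors, with \<open>norm y0\<close>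
  cancelling.\<close>

lemma slice_bound:
  "\<exists>K>0. \<forall>v c z. 0 \<le> c \<longrightarrow> (\<forall>y. cmod (cblinfun_apply v y) \<le> c * norm y) \<longrightarrow> norm (slice v z) \<le> K * c * norm z"
proof -
  obtain L where L: "L > 0" "\<And>A B. norm (otens A B) \<le> norm A * norm B * L"
    using bounded_bilinear.pos_bounded[OF bounded_bilinear_otens] by blast
  \<comment> \<open>Adding 1 makes the constant positive even if the identity of the first space has
    norm 0.\<close>
  have "norm (slice v z) \<le> (L * norm (cblinfun_id :: 'a \<Rightarrow>\<^sub>C\<^sub>L 'a) + 1) * c * norm z"
    if c: "0 \<le> c" "\<And>y. cmod (cblinfun_apply v y) \<le> c * norm y" for v c z
  proof -
    have "norm (rank_one y0 v) \<le> c * norm y0"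
    proof (rule norm_cblinfun_bound)
      show "norm (cblinfun_apply (rank_one y0 v) x) \<le> c * norm y0 * norm x" for x
        using mult_right_mono[OF c(2)[of x] norm_ge_zero[of y0]] by (simp add: norm_scaleC ac_simps)
    qed (use c(1) in simp)
    then have "L * norm (cblinfun_id :: 'a \<Rightarrow>\<^sub>C\<^sub>L 'a) * norm (rank_one y0 v)
        \<le> L * norm (cblinfun_id :: 'a \<Rightarrow>\<^sub>C\<^sub>L 'a) * (c * norm y0)"
      using L(1) by (intro mult_left_mono) auto
    moreover have "norm (slice v z) * norm y0
        \<le> norm (otens cblinfun_id (rank_one y0 v)) * norm z"
      unfolding norm_tens[symmetric] tens_slice by (rule norm_cblinfun_apply)
    moreover have "norm (otens cblinfun_id (rank_one y0 v)) * norm z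
        \<le> (norm (cblinfun_id :: 'a \<Rightarrow>\<^sub>C\<^sub>L 'a) * norm (rank_one y0 v) * L) * norm z"
      by (intro mult_right_mono L) auto
    moreover have "L * norm (cblinfun_id :: 'a \<Rightarrow>\<^sub>C\<^sub>L 'a) * norm (rank_one y0 v) * norm z
        \<le> L * norm (cblinfun_id :: 'a \<Rightarrow>\<^sub>C\<^sub>L 'a) * (c * norm y0) * norm z"
      using calculation(1) by (rule mult_right_mono) simp
    ultimately have "norm (slice v z) * norm y0
        \<le> (L * norm (cblinfun_id :: 'a \<Rightarrow>\<^sub>C\<^sub>L 'a) * c * norm z) * norm y0"
      by (simp add: ac_simps)
    then have "norm (slice v z) \<le> L * norm (cblinfun_id :: 'a \<Rightarrow>\<^sub>C\<^sub>L 'a) * c * norm z"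
      using y0 by simp
    then show ?thesis using c(1) by (simp add: algebra_simps add_increasing)
  qed
  moreover have "L * norm (cblinfun_id :: 'a \<Rightarrow>\<^sub>C\<^sub>L 'a) + 1 > 0"
    using L(1) by (smt (verit) mult_nonneg_nonneg norm_ge_zero)
  ultimately show ?thesis by blast
qed

lemma bounded_clinear_slice: "bounded_clinear (slice v)"
proof -
  obtain K where K: "K > 0" "\<And>v c z. 0 \<le> c \<Longrightarrow> (\<And>y. cmod (cblinfun_apply v y) \<le> c * norm y)
      \<Longrightarrow> norm (slice v z) \<le> K * c * norm z"
    using slice_bound by blast
  show ?thesis
  proof (rule bounded_clinearI)
    show "slice v (x + y) = slice v x + slice v y" for x y
      by (rule slice_eqI) (simp add: tens_add_left tens_slice cblinfun_add_right)
    show "slice v (c *\<^sub>C x) = c *\<^sub>C slice v x" for c x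
      by (rule slice_eqI) (simp add: tens_scaleC_left tens_slice)
    show "norm (slice v x) \<le> norm x * (K * norm v)" for x
      using K(2)[of "norm v" v x] norm_cblinfun_apply[of v] by (simp add: mult.commute)
  qed
qed

end

section \<open>The algebraic tensor product\<close>

abbreviation algebraic_tensors :: "'c set"
  where "algebraic_tensors \<equiv> cspan (range (\<lambda>(x, y). tens x y))"

lemma tens_algebraic: "tens x y \<in> algebraic_tensors"
  by (rule complex_vector.span_base) auto

lemma cspan_induct_closed:
  assumes "z \<in> cspan B" "\<And>b. b \<in> B \<Longrightarrow> b \<in> W" "csubspace W"
  shows "z \<in> W"
  using assms complex_vector.span_minimal by blast

lemma otens_algebraic:
  assumes "z \<in> algebraic_tensors"
  shows "cblinfun_apply (otens A B) z \<in> algebraic_tensors"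
proof -
  have "cblinfun_apply (otens A B) ` range (\<lambda>(x, y). tens x y) \<subseteq> range (\<lambda>(x, y). tens x y)"
    by (auto simp: otens_tens image_iff) blast
  then show ?thesis
    using cspan_image_subset[OF bounded_clinear_cblinfun[of "otens A B"]] assms
      complex_vector.span_mono by blast
qed

text \<open>The element \<open>z\<close> is arbitrary here. For rank one this is (T4), and finite
  rank is a sum of rank ones. It is the passage from the whole space to algebraic tensors.\<close>

lemma finite_rank_algebraic:
  assumes "finite C" "range (cblinfun_apply P) \<subseteq> cspan C"
  shows "cblinfun_apply (otens P cblinfun_id) z \<in> algebraic_tensors"
  using assms
proof (induction P rule: finite_rank_induct)
  case zero
  then show ?case by (simp add: complex_vector.span_zero)
next
  case (add A x u)
  have "cblinfun_apply (otens (rank_one x u) cblinfun_id) z \<in> {tens x y' | y'. True}"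
    using range_rank_one_left by blast
  then have "cblinfun_apply (otens (rank_one x u) cblinfun_id) z \<in> algebraic_tensors"
    using tens_algebraic by auto
  with add show ?case
    by (simp add: otens_add_left complex_vector.span_add)
qed

lemma tens_cspan:
  assumes "x \<in> cspan B" "y \<in> cspan C"
  shows "tens x y \<in> cspan ((\<lambda>(b, c). tens b c) ` (B \<times> C))"
proof -
  have "tens b y \<in> cspan ((\<lambda>(b, c). tens b c) ` (B \<times> C))" if "b \<in> B" for b
  proof -
    have "tens b y \<in> cspan ((\<lambda>y. tens b y) ` C)"
      using cspan_image_subset[OF bounded_clinear_tens_right] assms(2) by blast
    moreover have "(\<lambda>y. tens b y) ` C \<subseteq> (\<lambda>(b, c). tens b c) ` (B \<times> C)"
      using that by auto
    ultimately show ?thesis using complex_vector.span_mono by blast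
  qed
  then have "cspan ((\<lambda>x. tens x y) ` B) \<subseteq> cspan ((\<lambda>(b, c). tens b c) ` (B \<times> C))"
    by (intro complex_vector.span_minimal complex_vector.subspace_span) blast
  moreover have "tens x y \<in> cspan ((\<lambda>x. tens x y) ` B)"
    using cspan_image_subset[OF bounded_clinear_tens_left] assms(1) by blast
  ultimately show ?thesis by blast
qed

lemma otens_finite_rank_algebraic:
  assumes "range (cblinfun_apply P) \<subseteq> cspan B" "range (cblinfun_apply Q) \<subseteq> cspan C"
    and z: "z \<in> algebraic_tensors"
  shows "cblinfun_apply (otens P Q) z \<in> cspan ((\<lambda>(b, c). tens b c) ` (B \<times> C))"
proof -
  have "cblinfun_apply (otens P Q) ` range (\<lambda>(x, y). tens x y) \<subseteq> cspan ((\<lambda>(b, c). tens b c) ` (B \<times> C))"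
    by (auto simp: otens_tens intro!: tens_cspan subsetD[OF assms(1)] subsetD[OF assms(2)])
  then have "cspan (cblinfun_apply (otens P Q) ` range (\<lambda>(x, y). tens x y)) \<subseteq> cspan ((\<lambda>(b, c). tens b c) ` (B \<times> C))"
    by (intro complex_vector.span_minimal complex_vector.subspace_span)
  then show ?thesis
    using cspan_image_subset[OF bounded_clinear_cblinfun[of "otens P Q"]] z by blast
qed

text \<open>The finite set collects right factors: one vector for an elementary tensor, a union for
  a sum. A finite-rank projection fixing it then acts trivially on \<open>z\<close>.\<close>

lemma algebraic_right_support:
  assumes "z \<in> algebraic_tensors"
  shows "\<exists>C. finite C \<and> (\<forall>Q. (\<forall>y\<in>C. cblinfun_apply Q y = y) \<longrightarrow> cblinfun_apply (otens cblinfun_id Q) z = z)"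
    (is "?P z")
proof (rule cspan_induct_closed[where W = "{z. ?P z}", OF assms, simplified mem_Collect_eq])
  fix b assume "b \<in> range (\<lambda>(x, y). tens x y)"
  then obtain x y where "b = tens x y" by auto
  then show "?P b" by (intro exI[of _ "{y}"]) (auto simp: otens_tens)
next
  show "csubspace {z. ?P z}"
  proof (rule complex_vector.subspaceI)
    show "0 \<in> {z. ?P z}" by auto
    fix x y c assume "x \<in> {z. ?P z}"
    then obtain C where C: "finite C" "\<And>Q. (\<forall>y\<in>C. cblinfun_apply Q y = y) \<Longrightarrow> cblinfun_apply (otens cblinfun_id Q) x = x"
      by blast
    then show "c *\<^sub>C x \<in> {z. ?P z}" by auto
    assume "y \<in> {z. ?P z}"
    then obtain D where D: "finite D" "\<And>Q. (\<forall>y\<in>D. cblinfun_apply Q y = y) \<Longrightarrow> cblinfun_apply (otens cblinfun_id Q) y = y"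
      by blast
    show "x + y \<in> {z. ?P z}"
      using C D by (intro CollectI exI[of _ "C \<union> D"]) (auto simp: cblinfun_add_right)
  qed
qed

text \<open>An algebraic tensor equals its image under \<open>otens cblinfun_id Q\<close> for some
  \<open>Q\<close> of finite rank, and that image is a sum of tensors whose left factors are slices
  of \<open>z\<close>.\<close>

lemma slices_separate_algebraic:
  assumes z: "z \<in> algebraic_tensors" and slices: "\<And>v. slice v z = 0"
  shows "z = 0"
proof -
  obtain C where C: "finite C" "\<And>Q. (\<forall>y\<in>C. cblinfun_apply Q y = y) \<Longrightarrow> cblinfun_apply (otens cblinfun_id Q) z = z"
    using algebraic_right_support[OF z] by blast
  obtain Q :: "'b \<Rightarrow>\<^sub>C\<^sub>L 'b" where Q: "range (cblinfun_apply Q) \<subseteq> cspan C" "\<forall>y\<in>cspan C. cblinfun_apply Q y = y"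
    using finite_dim_projection[OF C(1)] by blast
  have "cblinfun_apply (otens cblinfun_id Q) z = 0"
    using C(1) Q(1)
  proof (induction Q rule: finite_rank_induct)
    case (add A y v)
    then show ?case
      using slices tens_slice[of v z y] by (simp add: otens_add_right)
  qed simp
  moreover have "cblinfun_apply (otens cblinfun_id Q) z = z"
    using Q(2) complex_vector.span_base by (intro C(2)) blast
  ultimately show ?thesis by simp
qed

text \<open>The difference of the two sides is algebraic and all its slices vanish. Slices carry
  information only if the second space is nonzero, hence the guard in the hypothesis; over a zero
  space the only algebraic tensor is 0.\<close>

lemma otens_left_fixes:
  assumes z: "z \<in> algebraic_tensors"
    and slices: "\<And>v y0. y0 \<noteq> (0 :: 'b) \<Longrightarrow> cblinfun_apply P (slice v z) = slice v z"
  shows "cblinfun_apply (otens P cblinfun_id) z = z"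
proof (cases "\<exists>y0 :: 'b. y0 \<noteq> 0")
  case True
  then obtain y0 :: 'b where y0: "y0 \<noteq> 0" by blast
  let ?w = "cblinfun_apply (otens P cblinfun_id) z - z"
  have "?w \<in> algebraic_tensors"
    by (intro complex_vector.span_diff otens_algebraic z)
  moreover have "slice v ?w = 0" for v
    using bounded_clinear_bounded_linear[OF bounded_clinear_slice[OF y0, of v]] slices[OF y0, of v]
    by (simp add: linear_simps slice_otens_left[OF y0])
  ultimately have "?w = 0"
    by (rule slices_separate_algebraic)
  then show ?thesis by simp
next
  case False
  have "z \<in> {0}"
  proof (rule cspan_induct_closed[OF z])
    fix b assume "b \<in> range (\<lambda>(x, y). tens x y)"
    then obtain x y where "b = tens x y" by auto
    moreover have "y = 0" using False by blast
    ultimately show "b \<in> {0}" by simp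
  qed (simp add: complex_vector.subspace_single_0)
  then show ?thesis by simp
qed

end

section \<open>The tuple \<open>(S \<otimes> I, I \<otimes> T)\<close>\<close>

lemma sum_UNIV_Plus:
  "(\<Sum>k\<in>(UNIV :: ('n::finite + 'm::finite) set). f k) = (\<Sum>i\<in>UNIV. f (Inl i)) + (\<Sum>j\<in>UNIV. f (Inr j))"
  by (simp add: sum.Plus flip: UNIV_Plus_UNIV)

lemma commuting_tuple_shift:
  assumes "commuting_tuple T"
  shows "commuting_tuple (tuple_shift T l)"
  unfolding commuting_tuple_def
proof (intro allI cblinfun_eqI)
  fix i j x
  have "cblinfun_apply (T $ i) (cblinfun_apply (T $ j) x) = cblinfun_apply (T $ j) (cblinfun_apply (T $ i) x)"
    using assms unfolding commuting_tuple_def by (metis cblinfun_apply_compose)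
  then show "cblinfun_apply (tuple_shift T l $ i o\<^sub>C\<^sub>L tuple_shift T l $ j) x
      = cblinfun_apply (tuple_shift T l $ j o\<^sub>C\<^sub>L tuple_shift T l $ i) x"
    by (simp add: tuple_shift_def cblinfun_diff_right complex_vector.scale_right_diff_distrib
        scaleC_scaleC mult.commute algebra_simps)
qed

context eschmeier_tensor_product
begin

lemma tensor_tuple_nth [simp]:
  "tensor_tuple otens S T $ Inl i = otens (S $ i) cblinfun_id"
  "tensor_tuple otens S T $ Inr j = otens cblinfun_id (T $ j)"
  by (simp_all add: tensor_tuple_def)

lemma otens_power_left: "otens (cblinfun_power A k) cblinfun_id = cblinfun_power (otens A cblinfun_id) k"
proof (induction k)
  case (Suc k)
  have "otens (cblinfun_power A (Suc k)) cblinfun_id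
      = otens A cblinfun_id o\<^sub>C\<^sub>L otens (cblinfun_power A k) cblinfun_id"
    by (simp add: otens_compose)
  then show ?case by (simp add: Suc)
qed (simp add: otens_id)

lemma otens_power_right: "otens cblinfun_id (cblinfun_power B k) = cblinfun_power (otens cblinfun_id B) k"
  using eschmeier_tensor_product.otens_power_left[OF swap] .

lemma tuple_power_tensor:
  "tuple_power (tensor_tuple otens S T) k = tensor_tuple otens (tuple_power S k) (tuple_power T k)"
  by (simp add: vec_eq_iff split_sum_all tuple_power_def otens_power_left otens_power_right)

lemma commuting_tuple_tensor:
  assumes "commuting_tuple S" "commuting_tuple T"
  shows "commuting_tuple (tensor_tuple otens S T)"
  using assms unfolding commuting_tuple_def by (simp add: split_sum_all otens_compose)

lemma tuple_shift_tensor: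
  "tuple_shift (tensor_tuple otens S T) (tuple_append a b) = tensor_tuple otens (tuple_shift S a) (tuple_shift T b)"
  by (simp add: vec_eq_iff split_sum_all tuple_shift_def tuple_append_def otens_diff_left otens_diff_right
      otens_scaleC_left otens_scaleC_right otens_id)

lemma hat_op_tensor: "hat_op (tensor_tuple otens S T) e =
    (\<Sum>i\<in>UNIV. cblinfun_apply (otens (S $ i) cblinfun_id) (e $ Inl i))
    + (\<Sum>j\<in>UNIV. cblinfun_apply (otens cblinfun_id (T $ j)) (e $ Inr j))"
  by (simp add: hat_op_def sum_UNIV_Plus)

lemma range_hat_op_tensor: "range (hat_op (tensor_tuple otens S T)) =
    {(\<Sum>i\<in>UNIV. cblinfun_apply (otens (S $ i) cblinfun_id) (z i))
    + (\<Sum>j\<in>UNIV. cblinfun_apply (otens cblinfun_id (T $ j)) (w j)) | z w. True}" (is "?L = ?R")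
proof
  show "?L \<subseteq> ?R"
    by (auto simp: hat_op_tensor)
  show "?R \<subseteq> ?L"
  proof clarify
    fix z w
    show "(\<Sum>i\<in>UNIV. cblinfun_apply (otens (S $ i) cblinfun_id) (z i))
        + (\<Sum>j\<in>UNIV. cblinfun_apply (otens cblinfun_id (T $ j)) (w j)) \<in> ?L"
      by (rule image_eqI[of _ _ "\<chi> k. case_sum z w k"]) (simp_all add: hat_op_tensor)
  qed
qed

lemma range_hat_op_swap:
  fixes S :: "('a \<Rightarrow>\<^sub>C\<^sub>L 'a) ^ 'n::finite" and T :: "('b \<Rightarrow>\<^sub>C\<^sub>L 'b) ^ 'm::finite"
  shows "range (hat_op (tensor_tuple (\<lambda>B A. otens A B) T S)) = range (hat_op (tensor_tuple otens S T))"
  unfolding eschmeier_tensor_product.range_hat_op_tensor[OF swap] range_hat_op_tensor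
proof -
  have "{g w + f z | w z. True} = {f z + g w | z w. True}" for f :: "('n \<Rightarrow> 'c) \<Rightarrow> 'c" and g :: "('m \<Rightarrow> 'c) \<Rightarrow> 'c"
    by (auto simp: add.commute)
  then show "{(\<Sum>j\<in>UNIV. cblinfun_apply (otens cblinfun_id (T $ j)) (w j))
      + (\<Sum>i\<in>UNIV. cblinfun_apply (otens (S $ i) cblinfun_id) (z i)) | w z. True}
    = {(\<Sum>i\<in>UNIV. cblinfun_apply (otens (S $ i) cblinfun_id) (z i))
      + (\<Sum>j\<in>UNIV. cblinfun_apply (otens cblinfun_id (T $ j)) (w j)) | z w. True}" .
qed

lemma lower_semi_Browder_swap:
  "lower_semi_Browder (tensor_tuple (\<lambda>B A. otens A B) T S) \<longleftrightarrow> lower_semi_Browder (tensor_tuple otens S T)"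
  unfolding lower_semi_Browder_def R_infty_def M_sum_eq
    eschmeier_tensor_product.tuple_power_tensor[OF swap] tuple_power_tensor range_hat_op_swap ..

lemma upper_semi_Browder_swap:
  "upper_semi_Browder (tensor_tuple (\<lambda>B A. otens A B) T S) \<longleftrightarrow> upper_semi_Browder (tensor_tuple otens S T)"
proof -
  have "N_infty (tensor_tuple (\<lambda>B A. otens A B) T S) = N_infty (tensor_tuple otens S T)"
    unfolding N_infty_eq
    by (auto simp: split_sum_all eschmeier_tensor_product.tensor_tuple_nth[OF swap])
  moreover have "closed (range (tilde_op (tensor_tuple (\<lambda>B A. otens A B) T S)))
      \<longleftrightarrow> closed (range (tilde_op (tensor_tuple otens S T)))"
    unfolding closed_range_tilde_op split_sum_all sum_UNIV_Plus tensor_tuple_nth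
      eschmeier_tensor_product.tensor_tuple_nth[OF swap]
    by (simp add: add.commute conj_commute)
  ultimately show ?thesis
    unfolding upper_semi_Browder_iff by simp
qed

section \<open>Lower semi-Browder conditions passed from the tensor tuple to its factors\<close>

lemma tens_range_hat_op_left:
  "x \<in> range (hat_op S) \<Longrightarrow> tens x y \<in> range (hat_op (tensor_tuple otens S T))"
proof -
  assume "x \<in> range (hat_op S)"
  then obtain w where "x = (\<Sum>i\<in>UNIV. cblinfun_apply (S $ i) (w i))"
    unfolding range_hat_op by blast
  then have "tens x y = (\<Sum>i\<in>UNIV. cblinfun_apply (otens (S $ i) cblinfun_id) (tens (w i) y))
      + (\<Sum>j\<in>UNIV. cblinfun_apply (otens cblinfun_id (T $ j)) 0)"
    by (simp add: tens_sum_left otens_tens)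
  then show ?thesis
    unfolding range_hat_op_tensor
    by (intro CollectI exI[of _ "\<lambda>i. tens (w i) y"] exI[of _ "\<lambda>j. 0"] conjI TrueI)
qed

lemma tens_range_hat_op_right:
  "y \<in> range (hat_op T) \<Longrightarrow> tens x y \<in> range (hat_op (tensor_tuple otens S T))"
  using eschmeier_tensor_product.tens_range_hat_op_left[OF swap] range_hat_op_swap by blast

lemma slice_range_hat_op:
  assumes y0: "y0 \<noteq> (0 :: 'b)" and v: "\<And>j. v o\<^sub>C\<^sub>L T $ j = 0"
    and z: "z \<in> range (hat_op (tensor_tuple otens S T))"
  shows "slice v z \<in> range (hat_op S)"
proof -
  interpret sl: bounded_linear "slice v"
    by (rule bounded_clinear_bounded_linear[OF bounded_clinear_slice[OF y0]])
  obtain e where "z = hat_op (tensor_tuple otens S T) e" using z by blast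
  then have "slice v z = (\<Sum>i\<in>UNIV. cblinfun_apply (S $ i) (slice v (e $ Inl i)))"
    by (simp add: hat_op_tensor sl.add sl.sum slice_otens_left[OF y0] slice_otens_right[OF y0]
        v slice_zero_functional[OF y0])
  then show ?thesis
    unfolding range_hat_op by (intro CollectI exI[of _ "\<lambda>i. slice v (e $ Inl i)"] conjI TrueI)
qed

lemma slice_M_sum:
  assumes y0: "y0 \<noteq> (0 :: 'b)" and v: "\<And>j. v o\<^sub>C\<^sub>L T $ j = 0" and k: "k \<ge> 1"
    and z: "z \<in> M_sum k (tensor_tuple otens S T)"
  shows "slice v z \<in> M_sum k S"
proof -
  have "v o\<^sub>C\<^sub>L tuple_power T k $ j = 0" for j
  proof (rule cblinfun_eqI)
    fix x
    have "cblinfun_apply (v o\<^sub>C\<^sub>L T $ j) x = 0" for x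
      by (simp only: v cblinfun_apply_zero)
    then show "cblinfun_apply (v o\<^sub>C\<^sub>L tuple_power T k $ j) x = cblinfun_apply 0 x"
      using k by (cases k) (simp_all add: tuple_power_def)
  qed
  with z show ?thesis
    unfolding M_sum_eq tuple_power_tensor by (rule slice_range_hat_op[OF y0, rotated])
qed

text \<open>Approximate annihilators \<open>u\<close>, \<open>v\<close> of the ranges for \<open>S\<close> and \<open>T\<close> give an approximate annihilator
  \<open>u \<otimes> v\<close> of the range for the tensor tuple.\<close>

lemma range_hat_op_elementary_tensors:
  fixes S :: "('a \<Rightarrow>\<^sub>C\<^sub>L 'a) ^ 'n::finite" and T :: "('b \<Rightarrow>\<^sub>C\<^sub>L 'b) ^ 'm::finite"
  assumes cl: "closed (range (hat_op (tensor_tuple otens S T)))"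
    and tens: "\<And>x y. tens x y \<in> range (hat_op (tensor_tuple otens S T))"
    and T: "range (hat_op T) \<noteq> UNIV"
  shows "range (hat_op S) = UNIV"
proof (rule ccontr)
  assume S: "range (hat_op S) \<noteq> UNIV"
  let ?F = "hat_op (tensor_tuple otens S T)"
  have "\<exists>C>0. \<forall>w\<in>range ?F. \<exists>u\<in>UNIV. ?F u = w \<and> norm u \<le> C * norm w"
    using cl by (intro open_mapping bounded_clinear_bounded_linear bounded_clinear_hat_op) auto
  then obtain C where C: "C > 0" "\<And>w. w \<in> range ?F \<Longrightarrow> \<exists>e. ?F e = w \<and> norm e \<le> C * norm w"
    by blast
  obtain y1 :: 'b where y1: "y1 \<noteq> 0"
  proof -
    obtain y where "y \<notin> range (hat_op T)" using T by blast
    moreover have "0 \<in> range (hat_op T)"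
      by (rule complex_vector.subspace_0[OF csubspace_range[OF bounded_clinear_hat_op]])
    ultimately show thesis using that by metis
  qed
  obtain K where K: "K > 0" "\<And>v c z. 0 \<le> c \<Longrightarrow> (\<And>y. cmod (cblinfun_apply v y) \<le> c * norm y)
      \<Longrightarrow> norm (slice v z) \<le> K * c * norm z"
    using slice_bound[OF y1] by blast
  define N where "N = real CARD('n) + real CARD('m)"
  have N: "N > 0" by (simp add: N_def add_pos_pos)
  \<comment> \<open>Pairing \<open>x \<otimes> y\<close> with \<open>u\<close> and \<open>v\<close>
    gives 1. Through the preimage \<open>e\<close>, whose coordinates have norm at most
    \<open>4 * C\<close>, the same number is a sum of \<open>N\<close> terms of modulus at most
    \<open>a * K * (4 * C)\<close>; this \<open>a\<close> makes the total 1/2.\<close>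
  define a where "a = 1 / (8 * N * K * C)"
  have a: "a > 0" using N K(1) C(1) by (simp add: a_def)
  obtain u :: "'a \<Rightarrow>\<^sub>C\<^sub>L complex" and x where u: "\<And>z. cmod (cblinfun_apply u z) \<le> norm z"
    "cblinfun_apply u x = 1" "norm x \<le> 2" "\<And>e. cmod (cblinfun_apply u (hat_op S e)) \<le> a * norm e"
    using approximate_annihilator[OF bounded_clinear_hat_op S a] by metis
  obtain v :: "'b \<Rightarrow>\<^sub>C\<^sub>L complex" and y where v: "\<And>z. cmod (cblinfun_apply v z) \<le> norm z"
    "cblinfun_apply v y = 1" "norm y \<le> 2" "\<And>e. cmod (cblinfun_apply v (hat_op T e)) \<le> a * norm e"
    using approximate_annihilator[OF bounded_clinear_hat_op T a] by metis
  obtain e where e: "?F e = tens x y" "norm e \<le> C * norm (tens x y)"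
    using C(2) tens by blast
  have "norm x * norm y \<le> 2 * 2"
    using u(3) v(3) by (intro mult_mono) auto
  then have "C * norm (tens x y) \<le> C * 4"
    using C(1) by (simp add: norm_tens)
  then have e4: "norm (e $ k) \<le> 4 * C" for k
    using e(2) Finite_Cartesian_Product.norm_nth_le[of e k] by simp
  interpret sl: bounded_linear "slice v"
    by (rule bounded_clinear_bounded_linear[OF bounded_clinear_slice[OF y1]])
  have Inl: "cmod (cblinfun_apply u (cblinfun_apply (S $ i) (slice v (e $ Inl i)))) \<le> a * K * (4 * C)" for i
  proof -
    have "cmod (cblinfun_apply u (cblinfun_apply (S $ i) (slice v (e $ Inl i)))) \<le> a * norm (slice v (e $ Inl i))"
      using u(4)[of "axis i (slice v (e $ Inl i))"] by (simp add: hat_op_axis norm_axis_vec)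
    also have "\<dots> \<le> a * (K * 1 * norm (e $ Inl i))"
      using a v(1) by (intro mult_left_mono K(2)) auto
    also have "\<dots> \<le> a * (K * 1 * (4 * C))"
      using a K(1) e4 by (intro mult_left_mono) auto
    finally show ?thesis by (simp add: mult.assoc)
  qed
  have Inr: "cmod (cblinfun_apply u (slice (v o\<^sub>C\<^sub>L T $ j) (e $ Inr j))) \<le> a * K * (4 * C)" for j
  proof -
    have "cmod (cblinfun_apply v (cblinfun_apply (T $ j) z)) \<le> a * norm z" for z
      using v(4)[of "axis j z"] by (simp add: hat_op_axis norm_axis_vec)
    then have "norm (slice (v o\<^sub>C\<^sub>L T $ j) (e $ Inr j)) \<le> K * a * norm (e $ Inr j)"
      using a by (intro K(2)) auto
    also have "\<dots> \<le> K * a * (4 * C)"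
      using a K(1) e4 by (intro mult_left_mono) auto
    finally show ?thesis
      using u(1)[of "slice (v o\<^sub>C\<^sub>L T $ j) (e $ Inr j)"] by (simp add: ac_simps)
  qed
  have "1 = cblinfun_apply u (slice v (?F e))"
    by (simp add: e(1) slice_tens[OF y1] u(2) v(2))
  also have "\<dots> = (\<Sum>i\<in>UNIV. cblinfun_apply u (cblinfun_apply (S $ i) (slice v (e $ Inl i))))
      + (\<Sum>j\<in>UNIV. cblinfun_apply u (slice (v o\<^sub>C\<^sub>L T $ j) (e $ Inr j)))"
    by (simp add: hat_op_tensor sl.add sl.sum slice_otens_left[OF y1] slice_otens_right[OF y1]
        cblinfun_add_right cblinfun_sum_right)
  finally have "1 = cmod ((\<Sum>i\<in>UNIV. cblinfun_apply u (cblinfun_apply (S $ i) (slice v (e $ Inl i))))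
      + (\<Sum>j\<in>UNIV. cblinfun_apply u (slice (v o\<^sub>C\<^sub>L T $ j) (e $ Inr j))))"
    by (metis norm_one)
  also have "\<dots> \<le> (\<Sum>i\<in>(UNIV :: 'n set). a * K * (4 * C)) + (\<Sum>j\<in>(UNIV :: 'm set). a * K * (4 * C))"
    by (intro order_trans[OF norm_triangle_ineq] add_mono sum_norm_le Inl Inr)
  also have "\<dots> = N * (a * K * (4 * C))"
    by (simp add: N_def algebra_simps)
  also have "\<dots> = 1 / 2"
    using N K(1) C(1) by (simp add: a_def)
  finally show False by simp
qed

lemma lower_semi_Browder_left:
  assumes comm: "commuting_tuple S" and ST: "lower_semi_Browder (tensor_tuple otens S T)"
    and T: "range (hat_op T) \<noteq> UNIV"
  shows "lower_semi_Browder S"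
proof -
  let ?ST = "tensor_tuple otens S T"
  obtain F where F: "finite F" "cspan (R_infty ?ST \<union> F) = UNIV"
    using ST unfolding lower_semi_Browder_def ccodim_less_infinity by blast
  show ?thesis
  proof (cases "closure (range (hat_op T)) = UNIV")
    \<comment> \<open>Dense range: only the zero functional annihilates it. But the range of the
      tensor tuple has finite codimension, hence is closed, and it contains
      \<open>x \<otimes> y\<close> for \<open>y\<close> in the range of \<open>hat_op T\<close>; by
      density it contains every elementary tensor.\<close>
    case True
    have "R_infty ?ST \<union> F \<subseteq> range (hat_op ?ST) \<union> F"
      using R_infty_subset[of 1 ?ST] unfolding M_sum_1 by auto
    then have "cspan (range (hat_op ?ST) \<union> F) = UNIV"
      using F(2) complex_vector.span_mono by blast
    then have cl: "closed (range (hat_op ?ST))"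
      by (rule closed_range_finite_codim[OF bounded_clinear_hat_op F(1)])
    have "tens x y \<in> range (hat_op ?ST)" for x y
    proof -
      have "(\<lambda>y. tens x y) ` closure (range (hat_op T)) \<subseteq> closure ((\<lambda>y. tens x y) ` range (hat_op T))"
        by (rule closure_bounded_linear_image_subset[OF bounded_clinear_bounded_linear[OF bounded_clinear_tens_right]])
      also have "\<dots> \<subseteq> range (hat_op ?ST)"
        by (intro closure_minimal cl image_subsetI tens_range_hat_op_right)
      finally show ?thesis unfolding True by blast
    qed
    then show ?thesis
      using range_hat_op_elementary_tensors[OF cl _ T] surjective_imp_lower_semi_Browder[OF comm] by blast
  next
    case False
    then obtain y where y: "y \<notin> closure (range (hat_op T))" by blast
    then obtain v :: "'b \<Rightarrow>\<^sub>C\<^sub>L complex" where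
      v: "\<forall>w\<in>closure (range (hat_op T)). cblinfun_apply v w = 0" "cblinfun_apply v y = 1"
      using annihilating_functional[OF csubspace_closure[OF csubspace_range[OF bounded_clinear_hat_op]] closed_closure]
      by metis
    have y0: "y \<noteq> 0" using v(2) by auto
    have vT: "v o\<^sub>C\<^sub>L T $ j = 0" for j
    proof (rule cblinfun_eqI)
      fix x
      have "cblinfun_apply (T $ j) x \<in> closure (range (hat_op T))"
        using closure_subset[of "range (hat_op T)"] by (metis hat_op_axis rangeI subsetD)
      then show "cblinfun_apply (v o\<^sub>C\<^sub>L T $ j) x = cblinfun_apply 0 x"
        using v(1) by simp
    qed
    interpret sl: bounded_linear "slice v"
      by (rule bounded_clinear_bounded_linear[OF bounded_clinear_slice[OF y0]])
    \<comment> \<open>Since \<open>v y = 1\<close>, slicing recovers \<open>x\<close> from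
      \<open>x \<otimes> y\<close>. As it also maps \<open>R_infty\<close> of the tensor tuple into
      that of \<open>S\<close>, the finite set \<open>F\<close> is carried to one spanning the space
      modulo \<open>R_infty S\<close>.\<close>
    have R: "slice v z \<in> R_infty S" if "z \<in> R_infty ?ST" for z
      using that slice_M_sum[OF y0 vT] unfolding R_infty_def by auto
    have "x \<in> cspan (R_infty S \<union> slice v ` F)" for x
    proof -
      have "tens x y \<in> cspan (R_infty ?ST \<union> F)" using F(2) by blast
      then obtain r f where rf: "tens x y = r + f" "r \<in> R_infty ?ST" "f \<in> cspan F"
        unfolding cspan_Un_subspace[OF csubspace_R_infty] by blast
      have "x = slice v (tens x y)" by (simp add: slice_tens[OF y0] v(2))
      also have "\<dots> = slice v r + slice v f" by (simp add: rf(1) sl.add)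
      finally show ?thesis
        unfolding cspan_Un_subspace[OF csubspace_R_infty]
        using R[OF rf(2)] cspan_image_subset[OF bounded_clinear_slice[OF y0]] rf(3) by blast
    qed
    then show ?thesis
      unfolding lower_semi_Browder_def ccodim_less_infinity using F(1) by blast
  qed
qed

lemma lower_semi_Browder_right:
  assumes "commuting_tuple T" "lower_semi_Browder (tensor_tuple otens S T)" "range (hat_op S) \<noteq> UNIV"
  shows "lower_semi_Browder T"
  using eschmeier_tensor_product.lower_semi_Browder_left[OF swap] assms lower_semi_Browder_swap by blast

section \<open>Upper semi-Browder conditions passed from the tensor tuple to its factors\<close>

lemma otens_funpow_left:
  "(cblinfun_apply (otens A cblinfun_id) ^^ k) z = cblinfun_apply (otens (cblinfun_power A k) cblinfun_id) z"
  by (simp add: otens_power_left flip: cblinfun_apply_power)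

lemma otens_funpow_right:
  "(cblinfun_apply (otens cblinfun_id B) ^^ k) z = cblinfun_apply (otens cblinfun_id (cblinfun_power B k)) z"
  by (simp add: otens_power_right flip: cblinfun_apply_power)

lemma slice_N_infty:
  assumes y0: "y0 \<noteq> (0 :: 'b)" and z: "z \<in> N_infty (tensor_tuple otens S T)"
  shows "slice v z \<in> N_infty S"
proof -
  obtain k where k: "k \<ge> 1" "\<And>l. (cblinfun_apply (tensor_tuple otens S T $ l) ^^ k) z = 0"
    using z unfolding N_infty_eq by blast
  interpret sl: bounded_linear "slice v"
    by (rule bounded_clinear_bounded_linear[OF bounded_clinear_slice[OF y0]])
  have "(cblinfun_apply (S $ i) ^^ k) (slice v z) = 0" for i
  proof -
    have "(cblinfun_apply (S $ i) ^^ k) (slice v z) = slice v ((cblinfun_apply (otens (S $ i) cblinfun_id) ^^ k) z)"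
      by (simp add: otens_funpow_left slice_otens_left[OF y0] cblinfun_apply_power)
    then show ?thesis
      using k(2)[of "Inl i"] by (simp add: sl.zero)
  qed
  then show ?thesis
    unfolding N_infty_eq using k(1) by blast
qed

text \<open>Let \<open>x\<close> and \<open>y\<close> be approximate null vectors. Closed range
  provides a small \<open>z'\<close> with the same images as \<open>x \<otimes> y\<close>. Slicing
  the difference with \<open>v y = 1\<close> gives a joint null vector of \<open>S\<close>; if it
  must be 0, then \<open>x\<close> is the slice of \<open>z'\<close> and too small to have norm
  1.\<close>

lemma joint_null_vector:
  fixes S :: "('a \<Rightarrow>\<^sub>C\<^sub>L 'a) ^ 'n::finite" and T :: "('b \<Rightarrow>\<^sub>C\<^sub>L 'b) ^ 'm::finite"
  assumes cl: "closed (range (tilde_op (tensor_tuple otens S T)))"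
    and S: "null_space (tilde_op S) \<noteq> {0} \<or> \<not> closed (range (tilde_op S))"
    and T: "null_space (tilde_op T) \<noteq> {0} \<or> \<not> closed (range (tilde_op T))"
  shows "null_space (tilde_op S) \<noteq> {0}"
proof
  assume null: "null_space (tilde_op S) = {0}"
  obtain C where C: "C > 0" "\<And>z. \<exists>z'. (\<forall>k. cblinfun_apply (tensor_tuple otens S T $ k) z'
        = cblinfun_apply (tensor_tuple otens S T $ k) z)
      \<and> norm z' \<le> C * (\<Sum>k\<in>UNIV. norm (cblinfun_apply (tensor_tuple otens S T $ k) z))"
    using cl unfolding closed_range_tilde_op by blast
  obtain y1 :: 'b where "norm y1 = 1"
    using not_bounded_below[OF bounded_clinear_tilde_op T, of 1] by auto
  then have y1: "y1 \<noteq> 0" by auto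
  obtain K where K: "K > 0" "\<And>v c z. 0 \<le> c \<Longrightarrow> (\<And>y. cmod (cblinfun_apply v y) \<le> c * norm y)
      \<Longrightarrow> norm (slice v z) \<le> K * c * norm z"
    using slice_bound[OF y1] by blast
  define N where "N = real CARD('n) + real CARD('m)"
  have N: "N > 0" by (simp add: N_def add_pos_pos)
  \<comment> \<open>The norm of \<open>z'\<close> is at most \<open>C * (N * a)\<close>, so its
    slice has norm at most \<open>K * (C * (N * a))\<close>, which this choice makes 1/2.\<close>
  define a where "a = 1 / (2 * N * K * C)"
  have a: "a > 0" using N K(1) C(1) by (simp add: a_def)
  obtain x where x: "norm x = 1" "norm (tilde_op S x) < a"
    using not_bounded_below[OF bounded_clinear_tilde_op S a] by blast
  obtain y where y: "norm y = 1" "norm (tilde_op T y) < a"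
    using not_bounded_below[OF bounded_clinear_tilde_op T a] by blast
  have Sx: "norm (cblinfun_apply (S $ i) x) \<le> a" for i
    using Finite_Cartesian_Product.norm_nth_le[of "tilde_op S x" i] x(2) by (simp add: tilde_op_def)
  have Ty: "norm (cblinfun_apply (T $ j) y) \<le> a" for j
    using Finite_Cartesian_Product.norm_nth_le[of "tilde_op T y" j] y(2) by (simp add: tilde_op_def)
  obtain z' where z': "\<And>k. cblinfun_apply (tensor_tuple otens S T $ k) z'
        = cblinfun_apply (tensor_tuple otens S T $ k) (tens x y)"
      "norm z' \<le> C * (\<Sum>k\<in>UNIV. norm (cblinfun_apply (tensor_tuple otens S T $ k) (tens x y)))"
    using C(2) by blast
  have "(\<Sum>k\<in>UNIV. norm (cblinfun_apply (tensor_tuple otens S T $ k) (tens x y)))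
      \<le> (\<Sum>i\<in>(UNIV :: 'n set). a) + (\<Sum>j\<in>(UNIV :: 'm set). a)"
    unfolding sum_UNIV_Plus using Sx Ty x(1) y(1)
    by (intro add_mono sum_mono) (auto simp: otens_tens norm_tens)
  also have "\<dots> = N * a"
    by (simp add: N_def algebra_simps)
  finally have "norm z' \<le> C * (N * a)"
    using z'(2) C(1) by (meson mult_left_mono less_imp_le order_trans)
  obtain v :: "'b \<Rightarrow>\<^sub>C\<^sub>L complex" where v: "\<And>z. cmod (cblinfun_apply v z) \<le> norm z" "cblinfun_apply v y = 1"
    using norming_functional[of y] y(1) by auto
  interpret sl: bounded_linear "slice v"
    by (rule bounded_clinear_bounded_linear[OF bounded_clinear_slice[OF y1]])
  have "cblinfun_apply (S $ i) (slice v (tens x y - z')) = 0" for i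
    using z'(1)[of "Inl i"] by (simp add: cblinfun_diff_right sl.zero flip: slice_otens_left[OF y1])
  then have "slice v (tens x y - z') \<in> null_space (tilde_op S)"
    unfolding null_space_tilde_op by blast
  then have "x = slice v z'"
    unfolding null by (simp add: sl.diff slice_tens[OF y1] v(2))
  then have "1 \<le> K * 1 * norm z'"
    using K(2)[of 1 v z'] v(1) x(1) by simp
  also have "\<dots> \<le> K * (C * (N * a))"
    using \<open>norm z' \<le> C * (N * a)\<close> K(1) by simp
  also have "\<dots> = 1 / 2"
    using N K(1) C(1) by (simp add: a_def)
  finally show False by simp
qed

text \<open>If \<open>T\<close> is jointly injective, \<open>joint_null_vector\<close> with the
  factors exchanged shows that \<open>S\<close> is not singular. Otherwise a joint null vector
  \<open>y\<close> embeds the first space by sending x to x \<otimes> y, compatibly with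
  \<open>S\<close>, and slicing by \<open>v\<close> with \<open>v y = 1\<close> retracts this
  embedding.\<close>

lemma upper_semi_Browder_left:
  fixes S :: "('a \<Rightarrow>\<^sub>C\<^sub>L 'a) ^ 'n::finite" and T :: "('b \<Rightarrow>\<^sub>C\<^sub>L 'b) ^ 'm::finite"
  assumes comm: "commuting_tuple S" and ST: "upper_semi_Browder (tensor_tuple otens S T)"
    and T: "null_space (tilde_op T) \<noteq> {0} \<or> \<not> closed (range (tilde_op T))"
  shows "upper_semi_Browder S"
proof (cases "null_space (tilde_op T) = {0}")
  case True
  have "\<not> (null_space (tilde_op S) \<noteq> {0} \<or> \<not> closed (range (tilde_op S)))"
  proof
    assume S: "null_space (tilde_op S) \<noteq> {0} \<or> \<not> closed (range (tilde_op S))"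
    have "upper_semi_Browder (tensor_tuple (\<lambda>B A. otens A B) T S)"
      using ST upper_semi_Browder_swap by blast
    then have "null_space (tilde_op T) \<noteq> {0}"
      unfolding upper_semi_Browder_iff
      using eschmeier_tensor_product.joint_null_vector[OF swap _ T S] by blast
    with True show False by blast
  qed
  then show ?thesis
    using bounded_below_imp_upper_semi_Browder[OF comm] by blast
next
  case False
  then obtain y where y: "y \<noteq> 0" "\<And>j. cblinfun_apply (T $ j) y = 0"
    using complex_vector.subspace_0[OF csubspace_null_space[OF bounded_clinear_tilde_op[of T]]]
    unfolding null_space_tilde_op by blast
  obtain v0 :: "'b \<Rightarrow>\<^sub>C\<^sub>L complex" where v0: "cblinfun_apply v0 y = complex_of_real (norm y)"
    using norming_functional by blast
  define v where "v = complex_of_real (inverse (norm y)) *\<^sub>C v0"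
  have v: "cblinfun_apply v y = 1"
    using y(1) by (simp add: v_def v0 scaleC_complex_def flip: of_real_mult)
  obtain K where K: "K > 0" "\<And>v c z. 0 \<le> c \<Longrightarrow> (\<And>y. cmod (cblinfun_apply v y) \<le> c * norm y)
      \<Longrightarrow> norm (slice v z) \<le> K * c * norm z"
    using slice_bound[OF y(1)] by blast
  obtain C where C: "C > 0" "\<And>z. \<exists>z'. (\<forall>k. cblinfun_apply (tensor_tuple otens S T $ k) z'
        = cblinfun_apply (tensor_tuple otens S T $ k) z)
      \<and> norm z' \<le> C * (\<Sum>k\<in>UNIV. norm (cblinfun_apply (tensor_tuple otens S T $ k) z))"
    using ST unfolding upper_semi_Browder_iff closed_range_tilde_op by blast
  \<comment> \<open>A short preimage \<open>z'\<close> belonging to \<open>x \<otimes> y\<close> is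
    sliced to a short preimage belonging to \<open>x\<close>; the operators of \<open>T\<close>
    contribute nothing to the bound because they kill \<open>y\<close>. The summand 1 in
    \<open>norm v + 1\<close> gives positivity of the constant directly.\<close>
  have "closed (range (tilde_op S))"
    unfolding closed_range_tilde_op
  proof (intro exI[of _ "K * (norm v + 1) * C * norm y"] conjI allI)
    show "0 < K * (norm v + 1) * C * norm y"
      using K(1) C(1) y(1) by (auto intro!: mult_pos_pos add_nonneg_pos)
    fix x
    obtain z' where z': "\<And>k. cblinfun_apply (tensor_tuple otens S T $ k) z'
          = cblinfun_apply (tensor_tuple otens S T $ k) (tens x y)"
        "norm z' \<le> C * (\<Sum>k\<in>UNIV. norm (cblinfun_apply (tensor_tuple otens S T $ k) (tens x y)))"
      using C(2) by blast
    have "(\<Sum>k\<in>UNIV. norm (cblinfun_apply (tensor_tuple otens S T $ k) (tens x y)))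
        = (\<Sum>i\<in>UNIV. norm (cblinfun_apply (S $ i) x)) * norm y"
      unfolding sum_UNIV_Plus by (simp add: otens_tens norm_tens y(2) sum_distrib_right)
    then have *: "norm z' \<le> C * ((\<Sum>i\<in>UNIV. norm (cblinfun_apply (S $ i) x)) * norm y)"
      using z'(2) by simp
    have "cmod (cblinfun_apply v w) \<le> (norm v + 1) * norm w" for w
      using norm_cblinfun_apply[of v w] norm_ge_zero[of w] by (simp only: distrib_right mult_1_left)
    then have "norm (slice v z') \<le> K * (norm v + 1) * norm z'"
      by (intro K(2)) auto
    also have "\<dots> \<le> K * (norm v + 1) * (C * ((\<Sum>i\<in>UNIV. norm (cblinfun_apply (S $ i) x)) * norm y))"
      using * K(1) by (intro mult_left_mono) auto
    finally have "norm (slice v z') \<le> K * (norm v + 1) * C * norm y * (\<Sum>i\<in>UNIV. norm (cblinfun_apply (S $ i) x))"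
      by (simp add: ac_simps)
    moreover have "cblinfun_apply (S $ i) (slice v z') = cblinfun_apply (S $ i) x" for i
      using z'(1)[of "Inl i"] slice_otens_left[OF y(1), of v "S $ i" z']
      by (simp add: slice_tens[OF y(1)] v otens_tens)
    ultimately show "\<exists>x'. (\<forall>i. cblinfun_apply (S $ i) x' = cblinfun_apply (S $ i) x)
        \<and> norm x' \<le> K * (norm v + 1) * C * norm y * (\<Sum>i\<in>UNIV. norm (cblinfun_apply (S $ i) x))"
      by blast
  qed
  moreover have "cdim (N_infty S) < \<infinity>"
  proof -
    obtain B where B: "finite B" "cspan B = N_infty (tensor_tuple otens S T)"
      using ST unfolding upper_semi_Browder_iff cdim_less_infinity by blast
    have "N_infty S \<subseteq> cspan (slice v ` B)"
    proof
      fix x assume "x \<in> N_infty S"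
      then obtain k where k: "k \<ge> 1" "\<And>i. (cblinfun_apply (S $ i) ^^ k) x = 0"
        unfolding N_infty_eq by blast
      have "(cblinfun_apply (T $ j) ^^ k) y = 0" for j
      proof -
        obtain l where "k = Suc l" using k(1) by (cases k) auto
        then have "(cblinfun_apply (T $ j) ^^ k) y = (cblinfun_apply (T $ j) ^^ l) 0"
          by (simp only: funpow_Suc_right comp_apply y(2))
        then show ?thesis by (simp flip: cblinfun_apply_power)
      qed
      then have "(cblinfun_apply (tensor_tuple otens S T $ l) ^^ k) (tens x y) = 0" for l
        using k(2) by (cases l) (simp_all add: otens_funpow_left otens_funpow_right otens_tens cblinfun_apply_power)
      then have "tens x y \<in> cspan B"
        unfolding B(2) N_infty_eq using k(1) by blast
      then have "slice v (tens x y) \<in> cspan (slice v ` B)"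
        using cspan_image_subset[OF bounded_clinear_slice[OF y(1)]] by blast
      then show "x \<in> cspan (slice v ` B)"
        by (simp add: slice_tens[OF y(1)] v)
    qed
    then show ?thesis
      using B(1) by (intro cdim_subset_finite[OF csubspace_N_infty]) auto
  qed
  ultimately show ?thesis
    unfolding upper_semi_Browder_iff by blast
qed

lemma upper_semi_Browder_right:
  assumes "commuting_tuple T" "upper_semi_Browder (tensor_tuple otens S T)"
    "null_space (tilde_op S) \<noteq> {0} \<or> \<not> closed (range (tilde_op S))"
  shows "upper_semi_Browder T"
  using eschmeier_tensor_product.upper_semi_Browder_left[OF swap] assms upper_semi_Browder_swap by blast

end

section \<open>Splitting of the tensor tuple\<close>

context eschmeier_tensor_product
begin

text \<open>The generalised inverse of the tensor tuple is \<open>(V \<otimes> I, P \<otimes> W)\<close>, and the defect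
  \<open>P \<otimes> Q\<close> is annihilated.\<close>

lemma tensor_lower_generalised_inverse:
  fixes S :: "('a \<Rightarrow>\<^sub>C\<^sub>L 'a) ^ 'n::finite" and T :: "('b \<Rightarrow>\<^sub>C\<^sub>L 'b) ^ 'm::finite"
  assumes S: "\<And>x. (\<Sum>i\<in>UNIV. cblinfun_apply (S $ i) (cblinfun_apply (V i) x)) + cblinfun_apply P x = x"
    and T: "\<And>y. (\<Sum>j\<in>UNIV. cblinfun_apply (T $ j) (cblinfun_apply (W j) y)) + cblinfun_apply Q y = y"
    and PQ: "\<And>i. otens (P o\<^sub>C\<^sub>L S $ i) Q = 0" "\<And>j. otens P (Q o\<^sub>C\<^sub>L T $ j) = 0"
  shows "has_direct_complement (null_space (hat_op (tensor_tuple otens S T)))"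
    and "otens P Q = 0 \<Longrightarrow> range (hat_op (tensor_tuple otens S T)) = UNIV"
proof -
  let ?F = "hat_op (tensor_tuple otens S T)"
  define g where "g k = (case k of Inl i \<Rightarrow> otens (V i) cblinfun_id | Inr j \<Rightarrow> otens P (W j))" for k
  define G where "G z = (\<chi> k. cblinfun_apply (g k) z)" for z
  have G: "bounded_clinear G"
    unfolding G_def[abs_def] by (intro bounded_clinear_vec_lambda bounded_clinear_cblinfun)
  have SV: "(\<Sum>i\<in>UNIV. S $ i o\<^sub>C\<^sub>L V i) = cblinfun_id - P"
    using S by (intro cblinfun_eqI) (simp add: cblinfun_apply_sum eq_diff_eq)
  have TW: "(\<Sum>j\<in>UNIV. T $ j o\<^sub>C\<^sub>L W j) = cblinfun_id - Q"
    using T by (intro cblinfun_eqI) (simp add: cblinfun_apply_sum eq_diff_eq)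
  \<comment> \<open>The two sums telescope: \<open>(I - P) \<otimes> I + P \<otimes> (I - Q) = I - P
    \<otimes> Q\<close>.\<close>
  have FG: "?F (G z) = z - cblinfun_apply (otens P Q) z" for z
  proof -
    have "?F (G z) = cblinfun_apply (\<Sum>i\<in>UNIV. otens (S $ i o\<^sub>C\<^sub>L V i) cblinfun_id) z
        + cblinfun_apply (\<Sum>j\<in>UNIV. otens P (T $ j o\<^sub>C\<^sub>L W j)) z"
      by (simp add: hat_op_tensor G_def g_def otens_apply_compose cblinfun_apply_sum)
    also have "\<dots> = cblinfun_apply (otens (cblinfun_id - P) cblinfun_id + otens P (cblinfun_id - Q)) z"
      by (simp only: otens_sum_left[symmetric] otens_sum_right[symmetric] SV TW cblinfun_apply_add)
    finally show ?thesis
      by (simp add: otens_diff_left otens_diff_right otens_id)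
  qed
  have "cblinfun_apply (otens P Q) (?F e) = 0" for e
    by (simp add: hat_op_tensor cblinfun_add_right cblinfun_sum_right otens_apply_compose PQ)
  then have "?F (G (?F e)) = ?F e" for e
    by (simp add: FG)
  then show "has_direct_complement (null_space ?F)"
    by (rule generalised_inverse_imp_complement(1)[OF bounded_clinear_hat_op G])
  show "range ?F = UNIV" if "otens P Q = 0"
    using FG that by (intro surjI[of _ G]) simp
qed

text \<open>The same telescoping sum \<open>(I - P) \<otimes> I + P \<otimes> (I - Q)\<close>, now
  for the generalised inverse applied after the tuple: \<open>P \<otimes> Q\<close> measures the
  failure of a left inverse and maps into the joint null space.\<close>

lemma tensor_upper_generalised_inverse:
  fixes S :: "('a \<Rightarrow>\<^sub>C\<^sub>L 'a) ^ 'n::finite" and T :: "('b \<Rightarrow>\<^sub>C\<^sub>L 'b) ^ 'm::finite"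
  assumes S: "\<And>x. (\<Sum>i\<in>UNIV. cblinfun_apply (V i) (cblinfun_apply (S $ i) x)) + cblinfun_apply P x = x"
    and T: "\<And>y. (\<Sum>j\<in>UNIV. cblinfun_apply (W j) (cblinfun_apply (T $ j) y)) + cblinfun_apply Q y = y"
    and PQ: "\<And>i. otens (S $ i o\<^sub>C\<^sub>L P) Q = 0" "\<And>j. otens P (T $ j o\<^sub>C\<^sub>L Q) = 0"
  shows "has_direct_complement (range (tilde_op (tensor_tuple otens S T)))"
    and "closed (range (tilde_op (tensor_tuple otens S T)))"
    and "otens P Q = 0 \<Longrightarrow> null_space (tilde_op (tensor_tuple otens S T)) = {0}"
proof -
  let ?F = "tilde_op (tensor_tuple otens S T)"
  define g where "g k = (case k of Inl i \<Rightarrow> otens (V i) cblinfun_id | Inr j \<Rightarrow> otens P (W j))" for k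
  define G where "G e = (\<Sum>k\<in>UNIV. cblinfun_apply (g k) (e $ k))" for e :: "'c ^ ('n + 'm)"
  have G: "bounded_clinear G"
    unfolding G_def[abs_def]
    by (rule bounded_clinear_sum, rule bounded_clinear_compose[OF bounded_clinear_cblinfun bounded_clinear_vec_nth])
  have SV: "(\<Sum>i\<in>UNIV. V i o\<^sub>C\<^sub>L S $ i) = cblinfun_id - P"
    using S by (intro cblinfun_eqI) (simp add: cblinfun_apply_sum eq_diff_eq)
  have TW: "(\<Sum>j\<in>UNIV. W j o\<^sub>C\<^sub>L T $ j) = cblinfun_id - Q"
    using T by (intro cblinfun_eqI) (simp add: cblinfun_apply_sum eq_diff_eq)
  have GF: "G (?F z) = z - cblinfun_apply (otens P Q) z" for z
  proof -
    have "G (?F z) = cblinfun_apply (\<Sum>i\<in>UNIV. otens (V i o\<^sub>C\<^sub>L S $ i) cblinfun_id) z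
        + cblinfun_apply (\<Sum>j\<in>UNIV. otens P (W j o\<^sub>C\<^sub>L T $ j)) z"
      by (simp add: sum_UNIV_Plus tilde_op_def G_def g_def otens_apply_compose cblinfun_apply_sum)
    also have "\<dots> = cblinfun_apply (otens (cblinfun_id - P) cblinfun_id + otens P (cblinfun_id - Q)) z"
      by (simp only: otens_sum_left[symmetric] otens_sum_right[symmetric] SV TW cblinfun_apply_add)
    finally show ?thesis
      by (simp add: otens_diff_left otens_diff_right otens_id)
  qed
  interpret F: bounded_linear ?F
    by (rule bounded_clinear_bounded_linear[OF bounded_clinear_tilde_op])
  have "?F (cblinfun_apply (otens P Q) z) = 0" for z
    by (simp add: vec_eq_iff split_sum_all tilde_op_def otens_apply_compose PQ)
  then have FGF: "?F (G (?F z)) = ?F z" for z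
    by (simp add: GF F.diff)
  show "has_direct_complement (range ?F)" "closed (range ?F)"
    by (rule generalised_inverse_imp_complement(2,3)[OF bounded_clinear_tilde_op G FGF])+
  show "null_space ?F = {0}" if "otens P Q = 0"
  proof -
    have "z = 0" if "?F z = 0" for z
      using GF[of z] bounded_clinear_bounded_linear[OF G] \<open>otens P Q = 0\<close> that by (simp add: linear_simps)
    then show ?thesis
      using complex_vector.subspace_0[OF csubspace_null_space[OF bounded_clinear_tilde_op]]
      by (auto simp: null_space_def)
  qed
qed

lemma tensor_lower_semi_Browder:
  fixes S :: "('a \<Rightarrow>\<^sub>C\<^sub>L 'a) ^ 'n::finite" and T :: "('b \<Rightarrow>\<^sub>C\<^sub>L 'b) ^ 'm::finite"
  assumes comm: "commuting_tuple S" "commuting_tuple T"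
    and S: "\<And>x. (\<Sum>i\<in>UNIV. cblinfun_apply (S $ i) (cblinfun_apply (V i) x)) + cblinfun_apply P x = x"
    and P: "finite D" "range (cblinfun_apply P) \<subseteq> cspan D"
    and lsB: "lower_semi_Browder S" "lower_semi_Browder T"
  shows "lower_semi_Browder (tensor_tuple otens S T)"
proof -
  let ?ST = "tensor_tuple otens S T"
  obtain B where B: "finite B" "cspan (R_infty S \<union> B) = UNIV"
    using lsB(1) unfolding lower_semi_Browder_def ccodim_less_infinity by blast
  obtain C where C: "finite C" "cspan (R_infty T \<union> C) = UNIV"
    using lsB(2) unfolding lower_semi_Browder_def ccodim_less_infinity by blast
  \<comment> \<open>Writing x = r + b and y = t + c along \<open>R_infty\<close> and its finite
    complements, r \<otimes> y and b \<otimes> t lie in every \<open>M_sum\<close>, so only b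
    \<otimes> c is left. It lies in the span of this set, which does not depend on the
    exponent.\<close>
  let ?D = "(\<lambda>(b, c). tens b c) ` (B \<times> C)"
  show ?thesis
  proof (rule lower_semi_BrowderI)
    show "finite ?D" using B(1) C(1) by simp
    fix k
    let ?M = "cspan (M_sum (Suc k) ?ST \<union> ?D)"
    have M_le: "z \<in> ?M" if "z \<in> M_sum (Suc k) ?ST" for z
      using that by (intro complex_vector.span_base) auto
    have "tens x y \<in> ?M" for x y
    proof -
      have "x \<in> cspan (R_infty S \<union> B)" "y \<in> cspan (R_infty T \<union> C)"
        using B(2) C(2) by auto
      then obtain r b t c where rb: "x = r + b" "r \<in> R_infty S" "b \<in> cspan B"
        and tc: "y = t + c" "t \<in> R_infty T" "c \<in> cspan C"
        unfolding cspan_Un_subspace[OF csubspace_R_infty] by blast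
      have "r \<in> M_sum (Suc k) S" "t \<in> M_sum (Suc k) T"
        using rb(2) tc(2) R_infty_subset[of "Suc k"] by auto
      then have "tens r y \<in> M_sum (Suc k) ?ST" "tens b t \<in> M_sum (Suc k) ?ST"
        unfolding M_sum_eq tuple_power_tensor
        by (auto intro: tens_range_hat_op_left tens_range_hat_op_right)
      moreover have "tens b c \<in> ?M"
        using tens_cspan[OF rb(3) tc(3)] complex_vector.span_mono[of ?D "M_sum (Suc k) ?ST \<union> ?D"] by blast
      moreover have "tens x y = tens r y + (tens b t + tens b c)"
        by (simp add: rb(1) tc(1) tens_add_left tens_add_right)
      ultimately show ?thesis
        by (simp add: M_le complex_vector.span_add)
    qed
    then have alg: "algebraic_tensors \<subseteq> ?M"
      by (intro complex_vector.span_minimal complex_vector.subspace_span) auto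
    have "z \<in> ?M" for z
    proof -
      \<comment> \<open>The operators of \<open>S\<close> alone already reach everything modulo
        algebraic tensors: z minus the sum of all \<open>(S $ i) (V i) \<otimes> I\<close> applied
        to z is the image of z under \<open>P \<otimes> I\<close>.\<close>
      have "\<exists>w. \<exists>y\<in>algebraic_tensors. z = (\<Sum>l\<in>UNIV. (cblinfun_apply (?ST $ l) ^^ Suc k) (w l)) + y"
      proof (rule power_sum_decomposition)
        show "cblinfun_apply (?ST $ i) (cblinfun_apply (?ST $ j) x)
            = cblinfun_apply (?ST $ j) (cblinfun_apply (?ST $ i) x)" for i j x
          using commuting_tuple_tensor[OF comm] unfolding commuting_tuple_def by (metis cblinfun_apply_compose)
        show "cblinfun_apply (?ST $ i) y \<in> algebraic_tensors" if "y \<in> algebraic_tensors" for i y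
          using otens_algebraic[OF that] by (cases i) simp_all
        fix z
        have "(\<Sum>i\<in>UNIV. S $ i o\<^sub>C\<^sub>L V i) = cblinfun_id - P"
          using S by (intro cblinfun_eqI) (simp add: cblinfun_apply_sum eq_diff_eq)
        then have "cblinfun_apply (otens (\<Sum>i\<in>UNIV. S $ i o\<^sub>C\<^sub>L V i) cblinfun_id) z
            = z - cblinfun_apply (otens P cblinfun_id) z"
          by (simp add: otens_diff_left otens_id)
        then have "z = (\<Sum>l\<in>UNIV. cblinfun_apply (?ST $ l)
              (case l of Inl i \<Rightarrow> cblinfun_apply (otens (V i) cblinfun_id) z | Inr j \<Rightarrow> 0))
            + cblinfun_apply (otens P cblinfun_id) z"
          by (simp add: sum_UNIV_Plus otens_apply_compose otens_sum_left cblinfun_apply_sum)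
        then show "\<exists>w. \<exists>y\<in>algebraic_tensors. z = (\<Sum>l\<in>UNIV. cblinfun_apply (?ST $ l) (w l)) + y"
          using finite_rank_algebraic[OF P] by blast
      qed (auto simp: cblinfun_add_right complex_vector.span_zero complex_vector.span_add)
      then obtain w y where wy: "y \<in> algebraic_tensors"
        "z = (\<Sum>l\<in>UNIV. (cblinfun_apply (?ST $ l) ^^ Suc k) (w l)) + y"
        by blast
      have "(\<Sum>l\<in>UNIV. (cblinfun_apply (?ST $ l) ^^ Suc k) (w l)) \<in> M_sum (Suc k) ?ST"
        unfolding M_sum_def by blast
      then show ?thesis
        unfolding wy(2) using wy(1) alg M_le by (intro complex_vector.span_add) auto
    qed
    then show "?M = UNIV" by blast
  qed
qed

text \<open>Both factors of \<open>\<pi> \<otimes> \<rho>\<close>, with \<open>\<pi>\<close> and \<open>\<rho>\<close> projections onto \<open>N\<^sup>\<infinity>(S)\<close> and \<open>N\<^sup>\<infinity>(T)\<close>, fix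
  \<open>N\<^sup>\<infinity>(S \<otimes> I, I \<otimes> T)\<close>, because its slices lie in \<open>N\<^sup>\<infinity>(S)\<close> and \<open>N\<^sup>\<infinity>(T)\<close>.\<close>

lemma tensor_upper_semi_Browder:
  fixes S :: "('a \<Rightarrow>\<^sub>C\<^sub>L 'a) ^ 'n::finite" and T :: "('b \<Rightarrow>\<^sub>C\<^sub>L 'b) ^ 'm::finite"
  assumes comm: "commuting_tuple S" "commuting_tuple T"
    and S: "\<And>x. (\<Sum>i\<in>UNIV. cblinfun_apply (V i) (cblinfun_apply (S $ i) x)) + cblinfun_apply P x = x"
    and P: "finite D" "range (cblinfun_apply P) \<subseteq> cspan D"
    and usB: "upper_semi_Browder S" "upper_semi_Browder T"
    and cl: "closed (range (tilde_op (tensor_tuple otens S T)))"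
  shows "upper_semi_Browder (tensor_tuple otens S T)"
proof -
  let ?ST = "tensor_tuple otens S T"
  interpret swap: eschmeier_tensor_product "\<lambda>y x. tens x y" "\<lambda>B A. otens A B"
    by (rule swap)
  obtain B where B: "finite B" "cspan B = N_infty S"
    using usB(1) unfolding upper_semi_Browder_iff cdim_less_infinity by blast
  obtain C where C: "finite C" "cspan C = N_infty T"
    using usB(2) unfolding upper_semi_Browder_iff cdim_less_infinity by blast
  obtain p :: "'a \<Rightarrow>\<^sub>C\<^sub>L 'a" where p: "range (cblinfun_apply p) \<subseteq> cspan B" "\<And>x. x \<in> cspan B \<Longrightarrow> cblinfun_apply p x = x"
    using finite_dim_projection[OF B(1)] by blast
  obtain q :: "'b \<Rightarrow>\<^sub>C\<^sub>L 'b" where q: "range (cblinfun_apply q) \<subseteq> cspan C" "\<And>y. y \<in> cspan C \<Longrightarrow> cblinfun_apply q y = y"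
    using finite_dim_projection[OF C(1)] by blast
  \<comment> \<open>If every \<open>S $ i \<otimes> I\<close> maps z to an algebraic tensor, then
    applying \<open>V i \<otimes> I\<close>, summing, and adding the image under
    \<open>P \<otimes> I\<close> writes z itself as an algebraic tensor. This makes slicing
    conclusive on \<open>N_infty\<close> of the tensor tuple.\<close>
  have alg: "z \<in> algebraic_tensors" if "\<And>l. (cblinfun_apply (?ST $ l) ^^ k) z = 0" for k z
  proof (rule power_joint_membership)
    show "cblinfun_apply (?ST $ i) (cblinfun_apply (?ST $ j) x)
        = cblinfun_apply (?ST $ j) (cblinfun_apply (?ST $ i) x)" for i j x
      using commuting_tuple_tensor[OF comm] unfolding commuting_tuple_def by (metis cblinfun_apply_compose)
    show "cblinfun_apply (?ST $ i) y \<in> algebraic_tensors" if "y \<in> algebraic_tensors" for i y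
      using otens_algebraic[OF that] by (cases i) simp_all
    show "(cblinfun_apply (?ST $ l) ^^ k) z \<in> algebraic_tensors" for l
      using that by (simp add: complex_vector.span_zero)
    fix z assume z: "\<And>l. cblinfun_apply (?ST $ l) z \<in> algebraic_tensors"
    have "(\<Sum>i\<in>UNIV. V i o\<^sub>C\<^sub>L S $ i) = cblinfun_id - P"
      using S by (intro cblinfun_eqI) (simp add: cblinfun_apply_sum eq_diff_eq)
    then have "cblinfun_apply (otens (\<Sum>i\<in>UNIV. V i o\<^sub>C\<^sub>L S $ i) cblinfun_id) z
        = z - cblinfun_apply (otens P cblinfun_id) z"
      by (simp add: otens_diff_left otens_id)
    then have "z = (\<Sum>i\<in>UNIV. cblinfun_apply (otens (V i) cblinfun_id) (cblinfun_apply (?ST $ Inl i) z))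
        + cblinfun_apply (otens P cblinfun_id) z"
      by (simp add: otens_apply_compose otens_sum_left cblinfun_apply_sum)
    moreover have "\<dots> \<in> algebraic_tensors"
      by (intro complex_vector.span_add complex_vector.span_sum otens_algebraic z finite_rank_algebraic[OF P])
    ultimately show "z \<in> algebraic_tensors" by metis
  qed
  have N: "z \<in> cspan ((\<lambda>(b, c). tens b c) ` (B \<times> C))" if z: "z \<in> N_infty ?ST" for z
  proof -
    have za: "z \<in> algebraic_tensors"
      using z alg unfolding N_infty_eq by blast
    have zp: "cblinfun_apply (otens p cblinfun_id) z = z"
      by (rule otens_left_fixes[OF za]) (use slice_N_infty z p(2) B(2) in blast)
    have "range (\<lambda>(y, x). tens x y) = range (\<lambda>(x, y). tens x y)"
      by auto
    then have za': "z \<in> swap.algebraic_tensors"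
      using za by simp
    have zN: "z \<in> N_infty (tensor_tuple (\<lambda>B A. otens A B) T S)"
      using z unfolding N_infty_eq by (auto simp: split_sum_all)
    have "cblinfun_apply (otens cblinfun_id q) z = z"
      by (rule swap.otens_left_fixes[OF za']) (use swap.slice_N_infty zN q(2) C(2) in blast)
    with zp have "z = cblinfun_apply (otens p q) z"
      using otens_apply_compose[of p cblinfun_id cblinfun_id q z] by simp
    with otens_finite_rank_algebraic[OF p(1) q(1) za] show ?thesis by simp
  qed
  have "cdim (N_infty ?ST) < \<infinity>"
    by (rule cdim_subset_finite[OF csubspace_N_infty]) (use N B(1) C(1) in auto)
  with cl show ?thesis
    unfolding upper_semi_Browder_iff by blast
qed

text \<open>The alternatives cover every pair of points outside the right-hand union of the theorem.
  That complement is a conjunction of two disjunctions, one for each product; on expanding it, each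
  term contains a split surjective factor or consists of two split semi-Browder factors.\<close>

lemma split_lower_semi_Browder:
  fixes S :: "('a \<Rightarrow>\<^sub>C\<^sub>L 'a) ^ 'n::finite" and T :: "('b \<Rightarrow>\<^sub>C\<^sub>L 'b) ^ 'm::finite"
  assumes comm: "commuting_tuple S" "commuting_tuple T"
    and split: "range (hat_op S) = UNIV \<and> has_direct_complement (null_space (hat_op S))
      \<or> range (hat_op T) = UNIV \<and> has_direct_complement (null_space (hat_op T))
      \<or> lower_semi_Browder S \<and> has_direct_complement (null_space (hat_op S))
        \<and> lower_semi_Browder T \<and> has_direct_complement (null_space (hat_op T))"
  shows "lower_semi_Browder (tensor_tuple otens S T)
    \<and> has_direct_complement (null_space (hat_op (tensor_tuple otens S T)))"
proof -
  have surj: "P = 0" if onto: "range (hat_op A) = UNIV" and ann: "\<And>i. P o\<^sub>C\<^sub>L A $ i = 0"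
    for A :: "('x::cbanach \<Rightarrow>\<^sub>C\<^sub>L 'x) ^ 'k::finite" and P :: "'x \<Rightarrow>\<^sub>C\<^sub>L 'x"
  proof (rule cblinfun_eqI)
    fix x
    obtain w where "x = hat_op A w" using onto by blast
    moreover have "cblinfun_apply P (cblinfun_apply (A $ i) y) = 0" for i y
      using ann[of i] by (metis cblinfun_apply_compose cblinfun_apply_zero)
    ultimately show "cblinfun_apply P x = cblinfun_apply 0 x"
      by (simp add: hat_op_def cblinfun_sum_right)
  qed
  note lsB = surjective_imp_lower_semi_Browder[OF commuting_tuple_tensor[OF comm]]
  from split show ?thesis
  proof (elim disjE conjE)
    assume S: "range (hat_op S) = UNIV" "has_direct_complement (null_space (hat_op S))"
    have "cspan (range (hat_op S) \<union> {}) = UNIV" by (simp add: S(1))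
    from lower_generalised_inverse[OF S(2) finite.emptyI this] obtain V P where
      V: "\<And>x. (\<Sum>i\<in>UNIV. cblinfun_apply (S $ i) (cblinfun_apply (V i) x)) + cblinfun_apply P x = x"
      "\<And>i. P o\<^sub>C\<^sub>L S $ i = 0" by blast
    have P0: "P = 0" using S(1) V(2) by (rule surj)
    \<comment> \<open>With \<open>P = 0\<close> nothing is asked of \<open>T\<close>: the trivial
      choice of zero operators and \<open>Q\<close> the identity satisfies its equation, and the
      products with \<open>P\<close> vanish.\<close>
    show ?thesis
      using tensor_lower_generalised_inverse[where V = V and P = P and S = S and T = T and W = "\<lambda>j. 0"
          and Q = cblinfun_id] V(1) lsB
      by (simp add: P0)
  next
    assume T: "range (hat_op T) = UNIV" "has_direct_complement (null_space (hat_op T))"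
    have "cspan (range (hat_op T) \<union> {}) = UNIV" by (simp add: T(1))
    from lower_generalised_inverse[OF T(2) finite.emptyI this] obtain W Q where
      W: "\<And>x. (\<Sum>j\<in>UNIV. cblinfun_apply (T $ j) (cblinfun_apply (W j) x)) + cblinfun_apply Q x = x"
      "\<And>j. Q o\<^sub>C\<^sub>L T $ j = 0" by blast
    have Q0: "Q = 0" using T(1) W(2) by (rule surj)
    show ?thesis
      using tensor_lower_generalised_inverse[where V = "\<lambda>i. 0" and P = cblinfun_id and S = S and T = T
          and W = W and Q = Q] W(1) lsB
      by (simp add: Q0)
  next
    assume S: "lower_semi_Browder S" "has_direct_complement (null_space (hat_op S))"
      and T: "lower_semi_Browder T" "has_direct_complement (null_space (hat_op T))"
    have codim: "\<exists>B. finite B \<and> cspan (range (hat_op A) \<union> B) = UNIV" if A: "lower_semi_Browder A"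
      for A :: "('x::cbanach \<Rightarrow>\<^sub>C\<^sub>L 'x) ^ 'k::finite"
    proof -
      obtain B where B: "finite B" "cspan (R_infty A \<union> B) = UNIV"
        using A unfolding lower_semi_Browder_def ccodim_less_infinity by blast
      have "R_infty A \<union> B \<subseteq> range (hat_op A) \<union> B"
        using R_infty_subset[of 1 A] unfolding M_sum_1 by auto
      then show ?thesis
        using B complex_vector.span_mono by blast
    qed
    obtain B1 B2 where BS: "finite B1" "cspan (range (hat_op S) \<union> B1) = UNIV"
      and BT: "finite B2" "cspan (range (hat_op T) \<union> B2) = UNIV"
      using codim[OF S(1)] codim[OF T(1)] by blast
    obtain V P D where
      V: "\<And>x. (\<Sum>i\<in>UNIV. cblinfun_apply (S $ i) (cblinfun_apply (V i) x)) + cblinfun_apply P x = x"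
      "\<And>i. P o\<^sub>C\<^sub>L S $ i = 0" "finite D" "range (cblinfun_apply P) \<subseteq> cspan D"
      using lower_generalised_inverse[OF S(2) BS] by blast
    obtain W Q where
      W: "\<And>x. (\<Sum>j\<in>UNIV. cblinfun_apply (T $ j) (cblinfun_apply (W j) x)) + cblinfun_apply Q x = x"
      "\<And>j. Q o\<^sub>C\<^sub>L T $ j = 0"
      using lower_generalised_inverse[OF T(2) BT] by blast
    show ?thesis
      using tensor_lower_semi_Browder[OF comm V(1,3,4) S(1) T(1)]
        tensor_lower_generalised_inverse(1)[OF V(1) W(1)] V(2) W(2) by simp
  qed
qed

text \<open>The alternatives arise as for the lower spectra. Closedness of the range of the tensor
  tuple is supplied by its generalised inverse.\<close>

lemma split_upper_semi_Browder:
  fixes S :: "('a \<Rightarrow>\<^sub>C\<^sub>L 'a) ^ 'n::finite" and T :: "('b \<Rightarrow>\<^sub>C\<^sub>L 'b) ^ 'm::finite"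
  assumes comm: "commuting_tuple S" "commuting_tuple T"
    and split: "null_space (tilde_op S) = {0} \<and> has_direct_complement (range (tilde_op S))
      \<or> null_space (tilde_op T) = {0} \<and> has_direct_complement (range (tilde_op T))
      \<or> upper_semi_Browder S \<and> has_direct_complement (range (tilde_op S))
        \<and> upper_semi_Browder T \<and> has_direct_complement (range (tilde_op T))"
  shows "upper_semi_Browder (tensor_tuple otens S T)
    \<and> has_direct_complement (range (tilde_op (tensor_tuple otens S T)))"
proof -
  have inj: "P = 0" if "null_space (tilde_op A) = {0}" "\<And>i. A $ i o\<^sub>C\<^sub>L P = 0"
    for A :: "('x::cbanach \<Rightarrow>\<^sub>C\<^sub>L 'x) ^ 'k::finite" and P :: "'x \<Rightarrow>\<^sub>C\<^sub>L 'x"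
  proof (rule cblinfun_eqI)
    fix x
    have "cblinfun_apply (A $ i) (cblinfun_apply P x) = 0" for i
      using that(2)[of i] by (metis cblinfun_apply_compose cblinfun_apply_zero)
    then have "cblinfun_apply P x \<in> null_space (tilde_op A)"
      unfolding null_space_tilde_op by blast
    then show "cblinfun_apply P x = cblinfun_apply 0 x"
      using that(1) by simp
  qed
  have triv: "cdim (null_space (tilde_op A)) < \<infinity>" if "null_space (tilde_op A) = {0}"
    for A :: "('x::cbanach \<Rightarrow>\<^sub>C\<^sub>L 'x) ^ 'k::finite"
  proof -
    have "finite {}" "cspan {} = null_space (tilde_op A)"
      by (simp_all add: that complex_vector.span_empty)
    then show ?thesis unfolding cdim_less_infinity by blast
  qed
  note usB = bounded_below_imp_upper_semi_Browder[OF commuting_tuple_tensor[OF comm]]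
  from split show ?thesis
  proof (elim disjE conjE)
    assume S: "null_space (tilde_op S) = {0}" "has_direct_complement (range (tilde_op S))"
    from upper_generalised_inverse[OF S(2) triv[OF S(1)]] obtain V P where
      V: "\<And>x. (\<Sum>i\<in>UNIV. cblinfun_apply (V i) (cblinfun_apply (S $ i) x)) + cblinfun_apply P x = x"
      "\<And>i. S $ i o\<^sub>C\<^sub>L P = 0" by blast
    have P0: "P = 0" using S(1) V(2) by (rule inj)
    show ?thesis
      using tensor_upper_generalised_inverse[where V = V and P = P and S = S and T = T and W = "\<lambda>j. 0"
          and Q = cblinfun_id] V(1) usB
      by (simp add: P0)
  next
    assume T: "null_space (tilde_op T) = {0}" "has_direct_complement (range (tilde_op T))"
    from upper_generalised_inverse[OF T(2) triv[OF T(1)]] obtain W Q where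
      W: "\<And>x. (\<Sum>j\<in>UNIV. cblinfun_apply (W j) (cblinfun_apply (T $ j) x)) + cblinfun_apply Q x = x"
      "\<And>j. T $ j o\<^sub>C\<^sub>L Q = 0" by blast
    have Q0: "Q = 0" using T(1) W(2) by (rule inj)
    show ?thesis
      using tensor_upper_generalised_inverse[where V = "\<lambda>i. 0" and P = cblinfun_id and S = S and T = T
          and W = W and Q = Q] W(1) usB
      by (simp add: Q0)
  next
    assume S: "upper_semi_Browder S" "has_direct_complement (range (tilde_op S))"
      and T: "upper_semi_Browder T" "has_direct_complement (range (tilde_op T))"
    have fin: "cdim (null_space (tilde_op S)) < \<infinity>" "cdim (null_space (tilde_op T)) < \<infinity>"
      using S(1) T(1) unfolding upper_semi_Browder_def upper_semi_Fredholm_def by blast+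
    obtain V P D where
      V: "\<And>x. (\<Sum>i\<in>UNIV. cblinfun_apply (V i) (cblinfun_apply (S $ i) x)) + cblinfun_apply P x = x"
      "\<And>i. S $ i o\<^sub>C\<^sub>L P = 0" "finite D" "range (cblinfun_apply P) \<subseteq> cspan D"
      using upper_generalised_inverse[OF S(2) fin(1)] by blast
    obtain W Q where
      W: "\<And>x. (\<Sum>j\<in>UNIV. cblinfun_apply (W j) (cblinfun_apply (T $ j) x)) + cblinfun_apply Q x = x"
      "\<And>j. T $ j o\<^sub>C\<^sub>L Q = 0"
      using upper_generalised_inverse[OF T(2) fin(2)] by blast
    have cl: "closed (range (tilde_op (tensor_tuple otens S T)))"
      "has_direct_complement (range (tilde_op (tensor_tuple otens S T)))"
      using tensor_upper_generalised_inverse(1,2)[OF V(1) W(1)] V(2) W(2) by simp_all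
    show ?thesis
      using tensor_upper_semi_Browder[OF comm V(1,3,4) S(1) T(1) cl(1)] cl(2) by blast
  qed
qed

end

section \<open>The spectra\<close>

lemma tuple_append_eq_iff: "tuple_append a b = tuple_append a' b' \<longleftrightarrow> a = a' \<and> b = b'"
  by (auto simp: vec_eq_iff tuple_append_def split_sum_all)

lemma tuple_append_in_spec_times: "tuple_append a b \<in> A \<times>\<^sub>s B \<longleftrightarrow> a \<in> A \<and> b \<in> B"
  unfolding spec_times_def by (auto simp: tuple_append_eq_iff)

lemma tuple_append_cases: "\<exists>a b. l = tuple_append a b"
  by (rule exI[of _ "\<chi> i. l $ Inl i"], rule exI[of _ "\<chi> j. l $ Inr j"])
    (simp add: vec_eq_iff tuple_append_def split_sum_all)

lemma subset_spec_times_iff: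
  fixes X :: "(complex ^ ('n::finite + 'm::finite)) set"
  shows "X \<subseteq> A \<times>\<^sub>s B \<union> C \<times>\<^sub>s D \<longleftrightarrow> (\<forall>a b. tuple_append a b \<in> X \<longrightarrow> a \<in> A \<and> b \<in> B \<or> a \<in> C \<and> b \<in> D)"
  "A \<times>\<^sub>s B \<union> C \<times>\<^sub>s D \<subseteq> X \<longleftrightarrow> (\<forall>a b. a \<in> A \<and> b \<in> B \<or> a \<in> C \<and> b \<in> D \<longrightarrow> tuple_append a b \<in> X)"
proof -
  have "Y \<subseteq> Z \<longleftrightarrow> (\<forall>a b. tuple_append a b \<in> Y \<longrightarrow> tuple_append a b \<in> Z)"
    for Y Z :: "(complex ^ ('n + 'm)) set"
  proof
    assume R: "\<forall>a b. tuple_append a b \<in> Y \<longrightarrow> tuple_append a b \<in> Z"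
    show "Y \<subseteq> Z"
    proof
      fix l assume "l \<in> Y"
      moreover obtain a b where "l = tuple_append a b" using tuple_append_cases by blast
      ultimately show "l \<in> Z" using R by blast
    qed
  qed blast
  then show "X \<subseteq> A \<times>\<^sub>s B \<union> C \<times>\<^sub>s D \<longleftrightarrow> (\<forall>a b. tuple_append a b \<in> X \<longrightarrow> a \<in> A \<and> b \<in> B \<or> a \<in> C \<and> b \<in> D)"
    "A \<times>\<^sub>s B \<union> C \<times>\<^sub>s D \<subseteq> X \<longleftrightarrow> (\<forall>a b. a \<in> A \<and> b \<in> B \<or> a \<in> C \<and> b \<in> D \<longrightarrow> tuple_append a b \<in> X)"
    by (simp_all only: Un_iff tuple_append_in_spec_times)
qed

lemma sigma_delta_iff: "l \<in> sigma_delta T \<longleftrightarrow> range (hat_op (tuple_shift T l)) \<noteq> UNIV"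
  unfolding sigma_delta_def mem_Collect_eq M_sum_1 ccodim_eq_0[OF csubspace_range[OF bounded_clinear_hat_op]] ..

lemma sp_delta_iff: "l \<in> sp_delta T \<longleftrightarrow> \<not> (range (hat_op (tuple_shift T l)) = UNIV
    \<and> has_direct_complement (null_space (hat_op (tuple_shift T l))))"
  unfolding sp_delta_def by (auto simp: sigma_delta_iff C_minus_def)

lemma sp_B_minus_iff: "l \<in> sp_B_minus T \<longleftrightarrow> \<not> (lower_semi_Browder (tuple_shift T l)
    \<and> has_direct_complement (null_space (hat_op (tuple_shift T l))))"
  unfolding sp_B_minus_def lower_semi_Browder_def by simp

text \<open>\<open>has_direct_complement\<close> asks for a closed complement and says nothing on
  the closedness of the range; that follows from the generalised inverse, and ultimately from the
  open mapping theorem.\<close>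

lemma has_direct_complement_imp_closed_range:
  assumes "has_direct_complement (range (tilde_op T))" "cdim (null_space (tilde_op T)) < \<infinity>"
  shows "closed (range (tilde_op T))"
proof -
  from upper_generalised_inverse[OF assms] obtain V P where
    V: "\<And>x. (\<Sum>i\<in>UNIV. cblinfun_apply (V i) (cblinfun_apply (T $ i) x)) + cblinfun_apply P x = x"
    "\<And>i. T $ i o\<^sub>C\<^sub>L P = 0" by blast
  define G where "G e = (\<Sum>i\<in>UNIV. cblinfun_apply (V i) (e $ i))" for e
  have G: "bounded_clinear G"
    unfolding G_def[abs_def]
    by (rule bounded_clinear_sum, rule bounded_clinear_compose[OF bounded_clinear_cblinfun bounded_clinear_vec_nth])
  have "tilde_op T (G (tilde_op T x)) = tilde_op T x" for x
  proof -
    have "G (tilde_op T x) = x - cblinfun_apply P x"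
      using V(1)[of x] by (simp add: G_def tilde_op_def eq_diff_eq)
    moreover have "cblinfun_apply (T $ i) (cblinfun_apply P x) = 0" for i
      using V(2)[of i] by (metis cblinfun_apply_compose cblinfun_apply_zero)
    ultimately show ?thesis
      by (simp add: tilde_op_def vec_eq_iff cblinfun_diff_right)
  qed
  then show ?thesis
    by (rule generalised_inverse_imp_complement(3)[OF bounded_clinear_tilde_op G])
qed

lemma sigma_pi_iff: "l \<in> sigma_pi T \<longleftrightarrow> null_space (tilde_op (tuple_shift T l)) \<noteq> {0}
    \<or> \<not> closed (range (tilde_op (tuple_shift T l)))"
  by (simp add: sigma_pi_def)

lemma sp_pi_iff: "l \<in> sp_pi T \<longleftrightarrow> \<not> (null_space (tilde_op (tuple_shift T l)) = {0}
    \<and> has_direct_complement (range (tilde_op (tuple_shift T l))))"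
proof -
  have "closed (range (tilde_op A))"
    if "null_space (tilde_op A) = {0}" "has_direct_complement (range (tilde_op A))"
    for A :: "('x::cbanach \<Rightarrow>\<^sub>C\<^sub>L 'x) ^ 'k::finite"
  proof -
    have "finite {}" "cspan {} = null_space (tilde_op A)"
      by (simp_all add: that(1) complex_vector.span_empty)
    then show ?thesis
      using has_direct_complement_imp_closed_range[OF that(2)] unfolding cdim_less_infinity by blast
  qed
  then show ?thesis
    unfolding sp_pi_def by (auto simp: sigma_pi_iff C_plus_def)
qed

lemma sp_B_plus_iff: "l \<in> sp_B_plus T \<longleftrightarrow> \<not> (upper_semi_Browder (tuple_shift T l)
    \<and> has_direct_complement (range (tilde_op (tuple_shift T l))))"
  by (simp add: sp_B_plus_def)

text \<open>Null spaces of bounded operators are closed, hence complemented. A range that is not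
  closed already puts the point into \<open>sigma_pi\<close> and \<open>sigma_B_plus\<close>, so
  \<open>C_minus\<close> and \<open>C_plus\<close> contribute no new points to the unions.\<close>

lemma hilbert_split_spectra:
  fixes T :: "('a::cbanach \<Rightarrow>\<^sub>C\<^sub>L 'a) ^ 'n::finite"
  assumes "hilbert_space TYPE('a)"
  shows "sp_delta T = sigma_delta T" "sp_B_minus T = sigma_B_minus T"
    "sp_pi T = sigma_pi T" "sp_B_plus T = sigma_B_plus T"
proof -
  have "hilbert_space TYPE('a ^ 'n)"
    by (rule hilbert_space_vec[OF assms])
  note compl = hilbert_space_has_direct_complement[OF this]
  have null: "has_direct_complement (null_space (hat_op A))" for A :: "('a \<Rightarrow>\<^sub>C\<^sub>L 'a) ^ 'n"
    by (intro compl csubspace_null_space closed_null_space bounded_clinear_hat_op)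
  have range: "has_direct_complement (range (tilde_op A))" if "closed (range (tilde_op A))"
    for A :: "('a \<Rightarrow>\<^sub>C\<^sub>L 'a) ^ 'n"
    using that by (intro compl csubspace_range bounded_clinear_tilde_op)
  show "sp_delta T = sigma_delta T"
    by (auto simp: sp_delta_iff sigma_delta_iff null)
  show "sp_B_minus T = sigma_B_minus T"
    by (auto simp: sp_B_minus_iff sigma_B_minus_def null)
  show "sp_pi T = sigma_pi T"
    unfolding sp_pi_def by (auto simp: sigma_pi_def C_plus_def intro: range)
  show "sp_B_plus T = sigma_B_plus T"
    unfolding sp_B_plus_def sigma_B_plus_def by (auto simp: upper_semi_Browder_iff intro: range)
qed

theorem theorem5p1:
  fixes tens :: "'a::cbanach \<Rightarrow> 'b::cbanach \<Rightarrow> 'c::cbanach"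
    and otens :: "('a \<Rightarrow>\<^sub>C\<^sub>L 'a) \<Rightarrow> ('b \<Rightarrow>\<^sub>C\<^sub>L 'b) \<Rightarrow> ('c \<Rightarrow>\<^sub>C\<^sub>L 'c)"
    and S :: "('a \<Rightarrow>\<^sub>C\<^sub>L 'a) ^ 'n::finite"
    and T :: "('b \<Rightarrow>\<^sub>C\<^sub>L 'b) ^ 'm::finite"
  assumes "eschmeier_tensor_product tens otens"
    and "commuting_tuple S"
    and "commuting_tuple T"
  defines "ST \<equiv> tensor_tuple otens S T"
  shows
    "(sigma_B_minus S \<times>\<^sub>s sigma_delta T \<union> sigma_delta S \<times>\<^sub>s sigma_B_minus T \<subseteq> sigma_B_minus ST
      \<and> sigma_B_minus ST \<subseteq> sp_B_minus ST
      \<and> sp_B_minus ST \<subseteq> sp_B_minus S \<times>\<^sub>s sp_delta T \<union> sp_delta S \<times>\<^sub>s sp_B_minus T)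
    \<and> (sigma_B_plus S \<times>\<^sub>s sigma_pi T \<union> sigma_pi S \<times>\<^sub>s sigma_B_plus T \<subseteq> sigma_B_plus ST
      \<and> sigma_B_plus ST \<subseteq> sp_B_plus ST
      \<and> sp_B_plus ST \<subseteq> sp_B_plus S \<times>\<^sub>s sp_pi T \<union> sp_pi S \<times>\<^sub>s sp_B_plus T)
    \<and> (hilbert_space TYPE('a) \<and> hilbert_space TYPE('b) \<longrightarrow>
        (sigma_B_minus S \<times>\<^sub>s sigma_delta T \<union> sigma_delta S \<times>\<^sub>s sigma_B_minus T = sigma_B_minus ST
          \<and> sigma_B_minus ST = sp_B_minus ST
          \<and> sp_B_minus ST = sp_B_minus S \<times>\<^sub>s sp_delta T \<union> sp_delta S \<times>\<^sub>s sp_B_minus T)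
        \<and> (sigma_B_plus S \<times>\<^sub>s sigma_pi T \<union> sigma_pi S \<times>\<^sub>s sigma_B_plus T = sigma_B_plus ST
          \<and> sigma_B_plus ST = sp_B_plus ST
          \<and> sp_B_plus ST = sp_B_plus S \<times>\<^sub>s sp_pi T \<union> sp_pi S \<times>\<^sub>s sp_B_plus T))"
proof -
  interpret eschmeier_tensor_product tens otens by fact
  note shift = tuple_shift_tensor[of S T, folded ST_def]
  have comm: "commuting_tuple (tuple_shift S a)" "commuting_tuple (tuple_shift T b)" for a b
    by (simp_all add: commuting_tuple_shift assms(2,3))
  have minus1: "sigma_B_minus S \<times>\<^sub>s sigma_delta T \<union> sigma_delta S \<times>\<^sub>s sigma_B_minus T \<subseteq> sigma_B_minus ST"
    unfolding subset_spec_times_iff sigma_delta_iff sigma_B_minus_def mem_Collect_eq shift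
  proof (intro allI impI)
    fix a b
    assume "\<not> lower_semi_Browder (tuple_shift S a) \<and> range (hat_op (tuple_shift T b)) \<noteq> UNIV
      \<or> range (hat_op (tuple_shift S a)) \<noteq> UNIV \<and> \<not> lower_semi_Browder (tuple_shift T b)"
    then show "\<not> lower_semi_Browder (tensor_tuple otens (tuple_shift S a) (tuple_shift T b))"
      using lower_semi_Browder_left[OF comm(1)[of a], of "tuple_shift T b"]
        lower_semi_Browder_right[OF comm(2)[of b], of "tuple_shift S a"] by argo
  qed
  have minus2: "sigma_B_minus ST \<subseteq> sp_B_minus ST"
    unfolding sp_B_minus_def sigma_B_minus_def lower_semi_Browder_def by blast
  have minus3: "sp_B_minus ST \<subseteq> sp_B_minus S \<times>\<^sub>s sp_delta T \<union> sp_delta S \<times>\<^sub>s sp_B_minus T"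
    unfolding subset_spec_times_iff sp_delta_iff sp_B_minus_iff shift
  proof (intro allI impI)
    fix a b
    show "\<not> (lower_semi_Browder (tuple_shift S a) \<and> has_direct_complement (null_space (hat_op (tuple_shift S a))))
        \<and> \<not> (range (hat_op (tuple_shift T b)) = UNIV \<and> has_direct_complement (null_space (hat_op (tuple_shift T b))))
      \<or> \<not> (range (hat_op (tuple_shift S a)) = UNIV \<and> has_direct_complement (null_space (hat_op (tuple_shift S a))))
        \<and> \<not> (lower_semi_Browder (tuple_shift T b) \<and> has_direct_complement (null_space (hat_op (tuple_shift T b))))"
      if "\<not> (lower_semi_Browder (tensor_tuple otens (tuple_shift S a) (tuple_shift T b))
        \<and> has_direct_complement (null_space (hat_op (tensor_tuple otens (tuple_shift S a) (tuple_shift T b)))))"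
      using that split_lower_semi_Browder[OF comm, of a b] by argo
  qed
  have plus1: "sigma_B_plus S \<times>\<^sub>s sigma_pi T \<union> sigma_pi S \<times>\<^sub>s sigma_B_plus T \<subseteq> sigma_B_plus ST"
    unfolding subset_spec_times_iff sigma_pi_iff sigma_B_plus_def mem_Collect_eq shift
  proof (intro allI impI)
    fix a b
    assume "\<not> upper_semi_Browder (tuple_shift S a)
        \<and> (null_space (tilde_op (tuple_shift T b)) \<noteq> {0} \<or> \<not> closed (range (tilde_op (tuple_shift T b))))
      \<or> (null_space (tilde_op (tuple_shift S a)) \<noteq> {0} \<or> \<not> closed (range (tilde_op (tuple_shift S a))))
        \<and> \<not> upper_semi_Browder (tuple_shift T b)"
    then show "\<not> upper_semi_Browder (tensor_tuple otens (tuple_shift S a) (tuple_shift T b))"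
      using upper_semi_Browder_left[OF comm(1)[of a], of "tuple_shift T b"]
        upper_semi_Browder_right[OF comm(2)[of b], of "tuple_shift S a"] by argo
  qed
  have plus2: "sigma_B_plus ST \<subseteq> sp_B_plus ST"
    unfolding sp_B_plus_def sigma_B_plus_def by blast
  have plus3: "sp_B_plus ST \<subseteq> sp_B_plus S \<times>\<^sub>s sp_pi T \<union> sp_pi S \<times>\<^sub>s sp_B_plus T"
    unfolding subset_spec_times_iff sp_pi_iff sp_B_plus_iff shift
  proof (intro allI impI)
    fix a b
    show "\<not> (upper_semi_Browder (tuple_shift S a) \<and> has_direct_complement (range (tilde_op (tuple_shift S a))))
        \<and> \<not> (null_space (tilde_op (tuple_shift T b)) = {0} \<and> has_direct_complement (range (tilde_op (tuple_shift T b))))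
      \<or> \<not> (null_space (tilde_op (tuple_shift S a)) = {0} \<and> has_direct_complement (range (tilde_op (tuple_shift S a))))
        \<and> \<not> (upper_semi_Browder (tuple_shift T b) \<and> has_direct_complement (range (tilde_op (tuple_shift T b))))"
      if "\<not> (upper_semi_Browder (tensor_tuple otens (tuple_shift S a) (tuple_shift T b))
        \<and> has_direct_complement (range (tilde_op (tensor_tuple otens (tuple_shift S a) (tuple_shift T b)))))"
      using that split_upper_semi_Browder[OF comm, of a b] by argo
  qed
  show ?thesis
  proof (intro conjI impI)
    assume H: "hilbert_space TYPE('a) \<and> hilbert_space TYPE('b)"
    \<comment> \<open>Only the spectra of \<open>S\<close> and \<open>T\<close> are rewritten. The
      two ends of each chain of inclusions then coincide, and the spectra of \<open>ST\<close>
      between them are squeezed.\<close>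
    note sp = hilbert_split_spectra[OF conjunct1[OF H]] hilbert_split_spectra[OF conjunct2[OF H]]
    show "sigma_B_minus S \<times>\<^sub>s sigma_delta T \<union> sigma_delta S \<times>\<^sub>s sigma_B_minus T = sigma_B_minus ST"
      "sigma_B_minus ST = sp_B_minus ST"
      "sp_B_minus ST = sp_B_minus S \<times>\<^sub>s sp_delta T \<union> sp_delta S \<times>\<^sub>s sp_B_minus T"
      using minus1 minus2 minus3 unfolding sp by blast+
    show "sigma_B_plus S \<times>\<^sub>s sigma_pi T \<union> sigma_pi S \<times>\<^sub>s sigma_B_plus T = sigma_B_plus ST"
      "sigma_B_plus ST = sp_B_plus ST"
      "sp_B_plus ST = sp_B_plus S \<times>\<^sub>s sp_pi T \<union> sp_pi S \<times>\<^sub>s sp_B_plus T"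
      using plus1 plus2 plus3 unfolding sp by blast+
  qed (fact minus1 minus2 minus3 plus1 plus2 plus3)+
qed

end
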